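(* For every nonempty CW complex $X$ and every $n\ge1$, the space $\mathcal B_n(X)$ is $(n-2)$-connected.
   Context: For a topological space $Z$ and $n\ge 1$, $\mathcal B_n(Z)$ is the space of finitely supported probability measures $\mu=\sum\lambda_z z$ on $Z$ ($\lambda_z\ge0$, $\sum\lambda_z=1$) with $|\mathrm{supp}(\mu)|\le n$. It carries the quotient topology from the map $(z_1,\dots,z_n;t_1,\dots,t_n)\mapsto \sum t_iz_i$ (equivalently, the quotient topology from the symmetric join $\mathrm{Symm}^{*n}(Z)=(Z*\cdots*Z)/S_n$). $(-1)$-connected means nonempty. *)

theory Defs
  imports "HOL-Homology.Simplices" "HOL-Library.Poly_Mapping"
begin

section \<open>CW complexes\<close>

definition closed_disc :: "nat \<Rightarrow> (nat \<Rightarrow> real) topology" where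
  "closed_disc k = subtopology (Euclidean_space k) {x. (\<Sum>i<k. (x i)\<^sup>2) \<le> 1}"

definition open_disc :: "nat \<Rightarrow> (nat \<Rightarrow> real) topology" where
  "open_disc k = subtopology (Euclidean_space k) {x. (\<Sum>i<k. (x i)\<^sup>2) < 1}"

text \<open>
  Whitehead's definition. The open cells are indexed by themselves: \<open>E\<close> is the set of
  open cells, \<open>d e\<close> the dimension and \<open>\<Phi> e\<close> the characteristic map of the cell \<open>e\<close>. The
  cell complex may be infinite and infinite-dimensional. For \<open>k = 0\<close> both discs are a single
  point and the boundary is empty.
\<close>

definition cw_structure ::
  "'a topology \<Rightarrow> 'a set set \<Rightarrow> ('a set \<Rightarrow> nat) \<Rightarrow> ('a set \<Rightarrow> (nat \<Rightarrow> real) \<Rightarrow> 'a) \<Rightarrow> bool"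
where
  "cw_structure X E d \<Phi> \<longleftrightarrow>
     Hausdorff_space X \<and>
     \<Union>E = topspace X \<and> disjoint E \<and>
     (\<forall>e\<in>E. continuous_map (closed_disc (d e)) X (\<Phi> e) \<and>
            homeomorphic_map (open_disc (d e)) (subtopology X e) (\<Phi> e) \<and>
            (\<exists>F. finite F \<and> F \<subseteq> {e' \<in> E. d e' < d e} \<and>
                 \<Phi> e ` (topspace (closed_disc (d e)) - topspace (open_disc (d e))) \<subseteq> \<Union>F)) \<and>
     (\<forall>A \<subseteq> topspace X. (\<forall>e\<in>E. closedin X (A \<inter> X closure_of e)) \<longrightarrow> closedin X A)"

definition CW_complex :: "'a topology \<Rightarrow> bool" where
  "CW_complex X \<longleftrightarrow> (\<exists>E d \<Phi>. cw_structure X E d \<Phi>)"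


section \<open>Connectivity\<close>

definition sphere_base :: "nat \<Rightarrow> real" where
  "sphere_base = (\<lambda>i. if i = 0 then 1 else 0)"

text \<open>
  Triviality of \<open>\<pi>\<^sub>k(Z, z)\<close>: every pointed map from the \<open>k\<close>-sphere is homotopic, through
  pointed maps, to the constant map. For \<open>k = 0\<close> this says that \<open>Z\<close> is path connected
  if \<open>z\<close> lies in \<open>Z\<close>.
\<close>

definition trivial_homotopy_group :: "nat \<Rightarrow> 'b topology \<Rightarrow> 'b \<Rightarrow> bool" where
  "trivial_homotopy_group k Z z \<longleftrightarrow>
     (\<forall>f. continuous_map (nsphere k) Z f \<and> f sphere_base = z \<longrightarrow>
          homotopic_with (\<lambda>h. h sphere_base = z) (nsphere k) Z f (\<lambda>_. z))"

text \<open>Only meaningful for \<open>m \<ge> -1\<close>; for \<open>m = -1\<close> it says that \<open>Z\<close> is nonempty.\<close>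

definition n_connected :: "int \<Rightarrow> 'b topology \<Rightarrow> bool" where
  "n_connected m Z \<longleftrightarrow>
     topspace Z \<noteq> {} \<and>
     (\<forall>k. int k \<le> m \<longrightarrow> (\<forall>z \<in> topspace Z. trivial_homotopy_group k Z z))"


section \<open>Spaces of finitely supported probability measures\<close>

text \<open>
  The measure \<open>\<Sum> \<lambda>\<^sub>z z\<close> is the finitely supported function \<open>z \<mapsto> \<lambda>\<^sub>z\<close>, whose \<open>keys\<close> are
  the support.
\<close>

definition barycenters :: "nat \<Rightarrow> 'a topology \<Rightarrow> ('a \<Rightarrow>\<^sub>0 real) set" where
  "barycenters n Z =
     {\<mu>. Poly_Mapping.keys \<mu> \<subseteq> topspace Z \<and> card (Poly_Mapping.keys \<mu>) \<le> n \<and>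
         (\<forall>z. 0 \<le> Poly_Mapping.lookup \<mu> z) \<and>
         (\<Sum>z\<in>Poly_Mapping.keys \<mu>. Poly_Mapping.lookup \<mu> z) = 1}"

text \<open>
  \<open>Z\<^sup>n \<times> \<Delta>\<close> with the product topology, where \<open>\<Delta>\<close> is the simplex of dimension \<open>n - 1\<close>, whose
  points have the \<open>n\<close> coordinates \<open>0, \<dots>, n - 1\<close>. Here and below, \<open>n \<ge> 1\<close> is intended.
\<close>

definition weighted_points :: "nat \<Rightarrow> 'a topology \<Rightarrow> ((nat \<Rightarrow> 'a) \<times> (nat \<Rightarrow> real)) topology" where
  "weighted_points n Z =
     prod_topology (product_topology (\<lambda>_. Z) {..<n})
                   (subtopology (powertop_real UNIV) (standard_simplex (n - 1)))"

definition weighted_sum :: "nat \<Rightarrow> (nat \<Rightarrow> 'a) \<times> (nat \<Rightarrow> real) \<Rightarrow> ('a \<Rightarrow>\<^sub>0 real)" where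
  "weighted_sum n = (\<lambda>(z, t). \<Sum>i<n. Poly_Mapping.single (z i) (t i))"

definition barycenter_space :: "nat \<Rightarrow> 'a topology \<Rightarrow> ('a \<Rightarrow>\<^sub>0 real) topology" where
  "barycenter_space n Z =
     topology (\<lambda>U. U \<subseteq> barycenters n Z \<and>
       openin (weighted_points n Z) {p \<in> topspace (weighted_points n Z). weighted_sum n p \<in> U})"

lemma openin_barycenter_space:
  "openin (barycenter_space n Z) U \<longleftrightarrow>
     U \<subseteq> barycenters n Z \<and>
     openin (weighted_points n Z) {p \<in> topspace (weighted_points n Z). weighted_sum n p \<in> U}"
proof -
  let ?P = "weighted_points n Z"
  have "istopology (\<lambda>U. U \<subseteq> barycenters n Z \<and>
       openin ?P {p \<in> topspace ?P. weighted_sum n p \<in> U})" (is "istopology ?L")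
    unfolding istopology_def
  proof (intro conjI allI impI)
    fix S T assume "?L S" "?L T"
    moreover have "{p \<in> topspace ?P. weighted_sum n p \<in> S \<inter> T} =
        {p \<in> topspace ?P. weighted_sum n p \<in> S} \<inter> {p \<in> topspace ?P. weighted_sum n p \<in> T}"
      by auto
    ultimately show "S \<inter> T \<subseteq> barycenters n Z"
      and "openin ?P {p \<in> topspace ?P. weighted_sum n p \<in> S \<inter> T}"
      by auto
  next
    fix K assume K: "\<forall>S\<in>K. ?L S"
    have "{p \<in> topspace ?P. weighted_sum n p \<in> \<Union>K} =
        (\<Union>S\<in>K. {p \<in> topspace ?P. weighted_sum n p \<in> S})"
      by auto
    with K show "openin ?P {p \<in> topspace ?P. weighted_sum n p \<in> \<Union>K}"
      by auto
    from K show "\<Union>K \<subseteq> barycenters n Z" by auto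
  qed
  then show ?thesis
    by (simp add: barycenter_space_def)
qed

lemma weighted_sum_in_barycenters:
  assumes "n \<ge> 1" and p: "p \<in> topspace (weighted_points n Z)"
  shows "weighted_sum n p \<in> barycenters n Z"
proof -
  obtain z t where [simp]: "p = (z, t)" by (cases p)
  have z: "\<And>i. i < n \<Longrightarrow> z i \<in> topspace Z"
    using p by (auto simp: weighted_points_def PiE_iff)
  have t: "\<And>i. 0 \<le> t i" "(\<Sum>i<n. t i) = 1"
    using p \<open>n \<ge> 1\<close> lessThan_Suc_atMost[of "n - 1"]
    by (auto simp: weighted_points_def standard_simplex_def)
  let ?\<mu> = "\<Sum>i<n. Poly_Mapping.single (z i) (t i)"
  have lk: "Poly_Mapping.lookup ?\<mu> x = (\<Sum>i<n. if z i = x then t i else 0)" for x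
    by (simp add: lookup_sum lookup_single when_def)
  have sub: "Poly_Mapping.keys ?\<mu> \<subseteq> z ` {..<n}"
    using keys_sum[of "\<lambda>i. Poly_Mapping.single (z i) (t i)" "{..<n}"] by (auto split: if_splits)
  have "card (Poly_Mapping.keys ?\<mu>) \<le> n"
    using card_mono[OF _ sub] card_image_le[of "{..<n}" z] by simp
  moreover have "(\<Sum>x\<in>Poly_Mapping.keys ?\<mu>. Poly_Mapping.lookup ?\<mu> x) =
      (\<Sum>x\<in>z ` {..<n}. Poly_Mapping.lookup ?\<mu> x)"
    by (rule sum.mono_neutral_left) (use sub in \<open>auto simp: in_keys_iff\<close>)
  moreover have "\<dots> = (\<Sum>i<n. \<Sum>x\<in>z ` {..<n}. if z i = x then t i else 0)"
    unfolding lk by (rule sum.swap)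
  moreover have "\<dots> = 1"
    using t by simp
  moreover have "\<And>x. 0 \<le> Poly_Mapping.lookup ?\<mu> x"
    unfolding lk by (intro sum_nonneg) (use t in auto)
  ultimately show ?thesis
    using sub z unfolding barycenters_def weighted_sum_def by fastforce
qed

lemma barycenters_subset_image:
  assumes "n \<ge> 1" and \<mu>: "\<mu> \<in> barycenters n Z"
  shows "\<mu> \<in> weighted_sum n ` topspace (weighted_points n Z)"
proof -
  let ?K = "Poly_Mapping.keys \<mu>" and ?l = "Poly_Mapping.lookup \<mu>"
  define m where "m = card ?K"
  have m: "m \<le> n" and sum1: "sum ?l ?K = 1" and K: "?K \<subseteq> topspace Z" and nn: "\<And>x. 0 \<le> ?l x"
    using \<mu> by (auto simp: barycenters_def m_def)
  obtain h where h: "bij_betw h {..<m} ?K"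
    using ex_bij_betw_nat_finite[of ?K] unfolding m_def lessThan_atLeast0 by auto
  obtain a where a: "a \<in> ?K"
    using sum1 by fastforce
  define z where "z = (\<lambda>i\<in>{..<n}. if i < m then h i else a)"
  define t where "t = (\<lambda>i. if i < m then ?l (h i) else 0)"
  have hK: "h i \<in> ?K" if "i < m" for i
    using h that by (auto simp: bij_betw_def)
  have sumt: "(\<Sum>i<n. g i) = (\<Sum>i<m. g i)" if "\<And>i. i \<ge> m \<Longrightarrow> g i = 0" for g :: "nat \<Rightarrow> real"
    by (rule sum.mono_neutral_right) (use m that in auto)
  have t1: "(\<Sum>i<n. t i) = 1"
    by (subst sumt) (use sum.reindex_bij_betw[OF h, of ?l] sum1 in \<open>auto simp: t_def\<close>)
  have "t i \<le> 1" for i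
  proof (cases "i < n")
    case True
    then show ?thesis
      using member_le_sum[of i "{..<n}" t] t1 nn by (auto simp: t_def)
  qed (use m in \<open>auto simp: t_def\<close>)
  then have "t \<in> standard_simplex (n - 1)"
    using nn m t1 \<open>n \<ge> 1\<close> lessThan_Suc_atMost[of "n - 1"]
    by (auto simp: standard_simplex_def t_def)
  moreover have "z \<in> (\<Pi>\<^sub>E i\<in>{..<n}. topspace Z)"
    using hK a K by (auto simp: z_def)
  moreover have "weighted_sum n (z, t) = \<mu>"
  proof (rule poly_mapping_eqI)
    fix x
    have "Poly_Mapping.lookup (weighted_sum n (z, t)) x = (\<Sum>i<n. if z i = x then t i else 0)"
      by (simp add: weighted_sum_def lookup_sum lookup_single when_def)
    also have "\<dots> = (\<Sum>i<m. if z i = x then t i else 0)"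
      by (rule sumt) (auto simp: t_def)
    also have "\<dots> = (\<Sum>i<m. (\<lambda>y. if y = x then ?l y else 0) (h i))"
      by (rule sum.cong) (use m in \<open>auto simp: t_def z_def\<close>)
    also have "\<dots> = (\<Sum>y\<in>?K. if y = x then ?l y else 0)"
      by (rule sum.reindex_bij_betw[OF h])
    also have "\<dots> = ?l x"
      by (simp add: in_keys_iff)
    finally show "Poly_Mapping.lookup (weighted_sum n (z, t)) x = ?l x" .
  qed
  ultimately show ?thesis
    by (intro image_eqI[of _ _ "(z, t)"]) (auto simp: weighted_points_def)
qed

lemma topspace_barycenter_space:
  assumes "n \<ge> 1"
  shows "topspace (barycenter_space n Z) = barycenters n Z"
proof -
  have "{p \<in> topspace (weighted_points n Z). weighted_sum n p \<in> barycenters n Z} =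
      topspace (weighted_points n Z)"
    using weighted_sum_in_barycenters[OF assms] by blast
  then have "openin (barycenter_space n Z) (barycenters n Z)"
    unfolding openin_barycenter_space by auto
  then show ?thesis
    using openin_subset openin_barycenter_space openin_topspace by (metis subset_antisym)
qed

lemma quotient_map_weighted_sum:
  assumes "n \<ge> 1"
  shows "quotient_map (weighted_points n Z) (barycenter_space n Z) (weighted_sum n)"
  using weighted_sum_in_barycenters[OF assms] barycenters_subset_image[OF assms]
  unfolding quotient_map_def openin_barycenter_space topspace_barycenter_space[OF assms]
  by blast

end

theory Submission
  imports Defs "HOL-Analysis.Analysis"
begin

text \<open>
  Let \<open>f\<close> map the \<open>k\<close>-sphere to \<open>\<B>\<^sub>n(X)\<close>, where \<open>k \<le> n - 2\<close>. If \<open>f\<close> is homotopic to a map with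
  values in \<open>\<B>\<^sub>n\<^sub>-\<^sub>1(X)\<close>, coning off to a point \<open>x\<^sub>0\<close> of \<open>X\<close> makes it null-homotopic within
  \<open>\<B>\<^sub>n(X)\<close>. By compactness \<open>f\<close> lives over a finite subcomplex \<open>K\<close>, which is compact and locally
  contractible.

  The \<open>k\<close>-sphere has arbitrarily fine open covers with \<open>k + 1\<close> colours in which sets of equal colour
  are disjoint. Attach to each set \<open>v\<close> of such a cover a small open set \<open>V\<^sub>v\<close> of \<open>K\<close> that carries mass
  of \<open>f(s)\<close> for all \<open>s\<close> in \<open>v\<close>. Reweighting moves the mass of \<open>f(s)\<close> into the union of those \<open>V\<^sub>v\<close> with
  \<open>v\<close> containing \<open>s\<close>, without enlarging the support. At the same time, a homotopy of self-maps of
  \<open>K\<close> depending on \<open>s\<close> collapses each of these \<open>V\<^sub>v\<close> to a point; it is composed of local contractions,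
  one colour after the other, on scales that grow with each colour. Neither operation increases
  the number of points of the support, and in the end at most \<open>k + 1 \<le> n - 1\<close> points remain.
\<close>

section \<open>Maps into spaces of measures\<close>

text \<open>The topology on measures is a quotient topology, so a homotopy of measures has to come
  from operations that are continuous on weighted points. Push-forward and multiplication by a
  density are such operations, and they treat each point of the support separately. Hence the points
  are moved by self-maps of all of \<open>K\<close> that depend on the parameters alone.

  Sets of different colours that are active at the same \<open>s\<close> may overlap, and collapsing
  one of them distorts the others. This is why the scales grow: wherever the earlier collapses carry
  a set of a later colour, its image must still lie in one set that the later collapse shrinks to a
  point. The cover of \<open>K\<close> therefore depends only on the number of colours, and the
  cover of the sphere is chosen after it.\<close>

lemma continuous_map_compose':
  "continuous_map Y Z g \<Longrightarrow> continuous_map X Y f \<Longrightarrow> continuous_map X Z (\<lambda>x. g (f x))"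
  using continuous_map_compose[of X Y f Z g] by (simp add: o_def)

text \<open>Additivity in the weight makes the sum over the support computable from any presentation
  of the measure, including presentations with repeated points or zero weights. Through this,
  integrals and push-forwards descend from \<open>weighted_points\<close> to measures.\<close>

lemma sum_keys_additive:
  fixes F :: "'a \<Rightarrow> real \<Rightarrow> 'b::comm_monoid_add" and z :: "'i \<Rightarrow> 'a" and t :: "'i \<Rightarrow> real"
  assumes F: "\<And>x. F x 0 = 0" "\<And>x a b. F x (a + b) = F x a + F x b" and I: "finite I"
  defines "\<mu> \<equiv> \<Sum>i\<in>I. Poly_Mapping.single (z i) (t i)"
  shows "(\<Sum>x\<in>Poly_Mapping.keys \<mu>. F x (Poly_Mapping.lookup \<mu> x)) = (\<Sum>i\<in>I. F (z i) (t i))"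
proof -
  have Fsum: "F x (\<Sum>i\<in>J. g i) = (\<Sum>i\<in>J. F x (g i))" if "finite J" for J :: "'i set" and g x
    using that by induction (auto simp: F)
  have sub: "Poly_Mapping.keys \<mu> \<subseteq> z ` I"
    using keys_sum[of "\<lambda>i. Poly_Mapping.single (z i) (t i)" I] unfolding \<mu>_def
    by (auto split: if_splits)
  have lk: "Poly_Mapping.lookup \<mu> x = (\<Sum>i\<in>I. if z i = x then t i else 0)" for x
    by (simp add: \<mu>_def lookup_sum lookup_single when_def)
  have "(\<Sum>x\<in>Poly_Mapping.keys \<mu>. F x (Poly_Mapping.lookup \<mu> x)) =
      (\<Sum>x\<in>z ` I. F x (Poly_Mapping.lookup \<mu> x))"
    by (rule sum.mono_neutral_left) (use sub I F in \<open>auto simp: in_keys_iff\<close>)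
  also have "\<dots> = (\<Sum>x\<in>z ` I. \<Sum>i\<in>I. F x (if z i = x then t i else 0))"
    unfolding lk using Fsum[OF I] by simp
  also have "\<dots> = (\<Sum>i\<in>I. \<Sum>x\<in>z ` I. F x (if z i = x then t i else 0))"
    by (rule sum.swap)
  also have "\<dots> = (\<Sum>i\<in>I. \<Sum>x\<in>z ` I. if x = z i then F (z i) (t i) else 0)"
    by (intro sum.cong refl) (auto simp: F)
  also have "\<dots> = (\<Sum>i\<in>I. F (z i) (t i))"
    using I by simp
  finally show ?thesis .
qed

definition integ :: "('a \<Rightarrow>\<^sub>0 real) \<Rightarrow> ('a \<Rightarrow> real) \<Rightarrow> real" where
  "integ \<mu> g = (\<Sum>x\<in>Poly_Mapping.keys \<mu>. Poly_Mapping.lookup \<mu> x * g x)"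

text \<open>The push-forward along \<open>\<phi>\<close> of the measure with density
  \<open>a\<close> with respect to \<open>\<mu>\<close>.\<close>

definition transport :: "('a \<Rightarrow>\<^sub>0 real) \<Rightarrow> ('a \<Rightarrow> real) \<Rightarrow> ('a \<Rightarrow> 'b) \<Rightarrow> ('b \<Rightarrow>\<^sub>0 real)" where
  "transport \<mu> a \<phi> =
     (\<Sum>x\<in>Poly_Mapping.keys \<mu>. Poly_Mapping.single (\<phi> x) (Poly_Mapping.lookup \<mu> x * a x))"

lemma integ_sum_single:
  "finite I \<Longrightarrow> integ (\<Sum>i\<in>I. Poly_Mapping.single (z i) (t i)) g = (\<Sum>i\<in>I. t i * g (z i))"
  unfolding integ_def by (rule sum_keys_additive) (auto simp: algebra_simps)

lemma transport_sum_single: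
  "finite I \<Longrightarrow> transport (\<Sum>i\<in>I. Poly_Mapping.single (z i) (t i)) a \<phi> =
     (\<Sum>i\<in>I. Poly_Mapping.single (\<phi> (z i)) (t i * a (z i)))"
  unfolding transport_def by (rule sum_keys_additive) (auto simp: algebra_simps single_add)

lemma transport_id: "transport \<mu> (\<lambda>_. 1) (\<lambda>x. x) = \<mu>"
proof (rule poly_mapping_eqI)
  fix y
  show "Poly_Mapping.lookup (transport \<mu> (\<lambda>_. 1) (\<lambda>x. x)) y = Poly_Mapping.lookup \<mu> y"
    by (simp add: transport_def lookup_sum lookup_single when_def in_keys_iff)
qed

section \<open>Coordinates and continuity criteria for the quotient topology\<close>

lemma weighted_pointsD:
  assumes "n \<ge> 1" "(z, t) \<in> topspace (weighted_points n Z)"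
  shows "\<And>i. i < n \<Longrightarrow> z i \<in> topspace Z" "\<And>i. 0 \<le> t i" "(\<Sum>i<n. t i) = 1" "\<And>i. i \<ge> n \<Longrightarrow> t i = 0"
    "\<And>i. t i \<le> 1"
  using assms lessThan_Suc_atMost[of "n - 1"]
  by (auto simp: weighted_points_def standard_simplex_def PiE_iff)

lemma weighted_sum_pair:
  "weighted_sum n (z, t) = (\<Sum>i<n. Poly_Mapping.single (z i) (t i))"
  by (simp add: weighted_sum_def)

lemma continuous_map_into_weighted_points:
  assumes n: "n \<ge> 1"
    and z: "\<And>i. i < n \<Longrightarrow> continuous_map Y Z (\<lambda>y. z y i)"
    and t: "\<And>i. i < n \<Longrightarrow> continuous_map Y euclideanreal (\<lambda>y. t y i)"
    and t0: "\<And>y i. y \<in> topspace Y \<Longrightarrow> i < n \<Longrightarrow> 0 \<le> t y i"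
    and t1: "\<And>y. y \<in> topspace Y \<Longrightarrow> (\<Sum>i<n. t y i) = 1"
  shows "continuous_map Y (weighted_points n Z)
           (\<lambda>y. (\<lambda>i\<in>{..<n}. z y i, \<lambda>i. if i < n then t y i else 0))"
proof -
  have le1: "t y i \<le> 1" if "y \<in> topspace Y" "i < n" for y i
    using member_le_sum[of i "{..<n}" "t y"] t1 t0 that by auto
  have eq: "{..n - Suc 0} = {..<n}" using n by auto
  show ?thesis
    unfolding weighted_points_def
  proof (intro continuous_map_pairedI continuous_map_into_subtopology)
    show "continuous_map Y (product_topology (\<lambda>_. Z) {..<n}) (\<lambda>y. \<lambda>i\<in>{..<n}. z y i)"
      using z by (auto simp: continuous_map_componentwise)
    show "continuous_map Y (powertop_real UNIV) (\<lambda>y i. if i < n then t y i else 0)"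
      using t by (auto simp: continuous_map_componentwise_UNIV)
    show "(\<lambda>y i. if i < n then t y i else 0) \<in> topspace Y \<rightarrow> standard_simplex (n - 1)"
      using n by (auto simp: standard_simplex_def t0 le1 t1 eq)
  qed
qed

lemma continuous_map_weighted_points_coords:
  "i < n \<Longrightarrow> continuous_map (weighted_points n Z) Z (\<lambda>p. fst p i)"
  "continuous_map (weighted_points n Z) euclideanreal (\<lambda>p. snd p i)"
proof -
  show "continuous_map (weighted_points n Z) Z (\<lambda>p. fst p i)" if "i < n"
    unfolding weighted_points_def
    by (rule continuous_map_compose'[OF _ continuous_map_fst, where g="\<lambda>x. x i"])
      (use that continuous_map_product_coordinates[of i "{..<n}" "\<lambda>_. Z"] in auto)
  show "continuous_map (weighted_points n Z) euclideanreal (\<lambda>p. snd p i)"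
    unfolding weighted_points_def
    by (rule continuous_map_compose'[OF _ continuous_map_snd, where g="\<lambda>x. x i"])
      (use continuous_map_from_subtopology[OF continuous_map_product_coordinates[of i UNIV "\<lambda>_. euclideanreal"]] in auto)
qed

lemma continuous_map_into_barycenter_space:
  assumes n: "n \<ge> 1"
    and z: "\<And>i. i < n \<Longrightarrow> continuous_map Y Z (\<lambda>y. z y i)"
    and t: "\<And>i. i < n \<Longrightarrow> continuous_map Y euclideanreal (\<lambda>y. t y i)"
    and t0: "\<And>y i. y \<in> topspace Y \<Longrightarrow> i < n \<Longrightarrow> 0 \<le> t y i"
    and t1: "\<And>y. y \<in> topspace Y \<Longrightarrow> (\<Sum>i<n. t y i) = 1"
  shows "continuous_map Y (barycenter_space n Z) (\<lambda>y. \<Sum>i<n. Poly_Mapping.single (z y i) (t y i))"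
proof -
  have "continuous_map Y (barycenter_space n Z)
      (\<lambda>y. weighted_sum n (\<lambda>i\<in>{..<n}. z y i, \<lambda>i. if i < n then t y i else 0))"
    by (rule continuous_map_compose'[OF quotient_imp_continuous_map[OF quotient_map_weighted_sum[OF n]]
          continuous_map_into_weighted_points[OF assms]])
  then show ?thesis
    by (simp add: weighted_sum_pair)
qed

text \<open>The index set may have more than \<open>n\<close> elements; only the number of nonzero
  weights at each \<open>y\<close> is bounded. The closed sets on which the weights outside a fixed
  \<open>J\<close> of at most \<open>n\<close> indices vanish form a finite cover of
  \<open>Y\<close>, and over each of them an enumeration of \<open>J\<close> gives a continuous lift
  to \<open>n\<close> weighted points.\<close>

lemma continuous_map_into_barycenter_space_family:
  assumes n: "n \<ge> 1" and I: "finite I"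
    and P: "\<And>v. v \<in> I \<Longrightarrow> continuous_map Y Z (P v)"
    and a: "\<And>v. v \<in> I \<Longrightarrow> continuous_map Y euclideanreal (a v)"
    and a0: "\<And>y v. y \<in> topspace Y \<Longrightarrow> v \<in> I \<Longrightarrow> 0 \<le> a v y"
    and a1: "\<And>y. y \<in> topspace Y \<Longrightarrow> (\<Sum>v\<in>I. a v y) = 1"
    and card: "\<And>y. y \<in> topspace Y \<Longrightarrow> card {v \<in> I. a v y \<noteq> 0} \<le> n"
  shows "continuous_map Y (barycenter_space n Z) (\<lambda>y. \<Sum>v\<in>I. Poly_Mapping.single (P v y) (a v y))"
    (is "continuous_map Y ?B ?g")
proof (rule pasting_lemma_closed[where f = "\<lambda>_. ?g"])
  define \<J> where "\<J> = {J. J \<subseteq> I \<and> J \<noteq> {} \<and> card J \<le> n}"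
  define T where "T J = {y \<in> topspace Y. \<forall>v\<in>I - J. a v y = 0}" for J
  show "finite \<J>" using I by (simp add: \<J>_def)
  show "closedin Y (T J)" if "J \<in> \<J>" for J
  proof -
    have TJ: "T J = topspace Y \<inter> (\<Inter>v\<in>I - J. {y \<in> topspace Y. a v y \<in> {0}})"
      by (auto simp: T_def)
    then show ?thesis
    proof (cases "I - J = {}")
      case False
      have "closedin Y (\<Inter>v\<in>I - J. {y \<in> topspace Y. a v y \<in> {0}})"
        by (intro closedin_INT[OF False] closedin_continuous_map_preimage[OF a]) auto
      then show ?thesis
        using TJ by auto
    next
      case True
      then have "T J = topspace Y" unfolding TJ by blast
      then show ?thesis by simp
    qed
  qed
  show "\<exists>J. J \<in> \<J> \<and> y \<in> T J \<and> ?g y = ?g y" if y: "y \<in> topspace Y" for y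
  proof (intro exI[of _ "{v \<in> I. a v y \<noteq> 0}"] conjI)
    have "{v \<in> I. a v y \<noteq> 0} \<noteq> {}"
      using a1[OF y] by (metis (mono_tags, lifting) empty_iff mem_Collect_eq sum.neutral zero_neq_one)
    then show "{v \<in> I. a v y \<noteq> 0} \<in> \<J>"
      using card[OF y] by (auto simp: \<J>_def)
  qed (use y in \<open>auto simp: T_def\<close>)
  show "continuous_map (subtopology Y (T J)) ?B ?g" if J: "J \<in> \<J>" for J
  proof -
    let ?m = "card J"
    have fJ: "finite J" and m: "0 < ?m" "?m \<le> n" and JI: "J \<subseteq> I"
      using J I finite_subset by (auto simp: \<J>_def card_gt_0_iff)
    obtain h where h: "bij_betw h {..<?m} J"
      using ex_bij_betw_nat_finite[OF fJ] unfolding lessThan_atLeast0 by auto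
    have hJ: "h i \<in> J" if "i < ?m" for i
      using h that by (auto simp: bij_betw_def)
    have red: "(\<Sum>i<n. if i < ?m then F (h i) else 0) = (\<Sum>v\<in>I. F v)"
      if F: "\<And>v. v \<in> I - J \<Longrightarrow> F v = 0" for F :: "'a \<Rightarrow> 'z::comm_monoid_add"
    proof -
      have "(\<Sum>i<n. if i < ?m then F (h i) else 0) = (\<Sum>i<?m. F (h i))"
        by (rule sum.mono_neutral_cong_right) (use m in auto)
      also have "\<dots> = (\<Sum>v\<in>J. F v)" by (rule sum.reindex_bij_betw[OF h])
      also have "\<dots> = (\<Sum>v\<in>I. F v)"
        by (rule sum.mono_neutral_left) (use I JI F in auto)
      finally show ?thesis .
    qed
    \<comment> \<open>Slots from \<open>card J\<close> on get weight 0, so the point there is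
      arbitrary; \<open>h 0\<close> exists because \<open>J\<close> is nonempty.\<close>
    define z where "z y i = P (h (if i < ?m then i else 0)) y" for y i
    define t where "t y i = (if i < ?m then a (h i) y else 0)" for y i
    have sub: "y \<in> topspace Y" "\<And>v. v \<in> I - J \<Longrightarrow> a v y = 0" if "y \<in> topspace (subtopology Y (T J))" for y
      using that by (auto simp: T_def)
    have "continuous_map (subtopology Y (T J)) ?B
        (\<lambda>y. \<Sum>i<n. Poly_Mapping.single (z y i) (t y i))"
    proof (rule continuous_map_into_barycenter_space[OF n])
      show "continuous_map (subtopology Y (T J)) Z (\<lambda>y. z y i)" for i
        unfolding z_def using hJ m JI by (intro continuous_map_from_subtopology P) auto
      show "continuous_map (subtopology Y (T J)) euclideanreal (\<lambda>y. t y i)" for i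
        unfolding t_def using hJ JI by (auto intro!: continuous_map_from_subtopology a)
      show "0 \<le> t y i" if "y \<in> topspace (subtopology Y (T J))" for y i
        using sub(1)[OF that] hJ JI a0 by (auto simp: t_def)
      show "(\<Sum>i<n. t y i) = 1" if "y \<in> topspace (subtopology Y (T J))" for y
        unfolding t_def using red[of "\<lambda>v. a v y"] sub[OF that] a1 by auto
    qed
    moreover have "(\<Sum>i<n. Poly_Mapping.single (z y i) (t y i)) = ?g y"
      if "y \<in> topspace (subtopology Y (T J))" for y
    proof -
      have "(\<Sum>i<n. Poly_Mapping.single (z y i) (t y i)) =
          (\<Sum>i<n. if i < ?m then Poly_Mapping.single (P (h i) y) (a (h i) y) else 0)"
        by (rule sum.cong) (auto simp: z_def t_def)
      also have "\<dots> = ?g y"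
        by (rule red) (use sub[OF that] in auto)
      finally show ?thesis .
    qed
    ultimately show ?thesis
      by (rule continuous_map_eq)
  qed
qed auto

text \<open>
  Reweighting by \<open>a\<close> need not be defined on all of \<open>P \<times> \<B>\<^sub>n(Z)\<close>; the quotient map is restricted
  to the open set where the total mass is positive.
\<close>

lemma continuous_map_transport:
  fixes P :: "'p topology" and Z :: "'a topology"
  assumes n: "n \<ge> 1" and P: "compact_space P" "Hausdorff_space P"
    and f: "continuous_map P (barycenter_space n Z) f"
    and \<phi>: "continuous_map (prod_topology P Z) Z \<phi>"
    and a: "continuous_map (prod_topology P Z) euclideanreal a"
    and a0: "\<And>p x. p \<in> topspace P \<Longrightarrow> x \<in> topspace Z \<Longrightarrow> 0 \<le> a (p, x)"
    and pos: "\<And>p. p \<in> topspace P \<Longrightarrow> 0 < integ (f p) (\<lambda>x. a (p, x))"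
  shows "continuous_map P (barycenter_space n Z)
    (\<lambda>p. transport (f p) (\<lambda>x. a (p, x) / integ (f p) (\<lambda>x. a (p, x))) (\<lambda>x. \<phi> (p, x)))"
proof -
  let ?W = "weighted_points n Z" and ?B = "barycenter_space n Z"
  define Q where "Q = (\<lambda>(p :: 'p, w). (p, weighted_sum n w :: 'a \<Rightarrow>\<^sub>0 real))"
  \<comment> \<open>The product of a quotient map with an identity map need not be a quotient map;
    it is one here because \<open>P\<close> is compact Hausdorff, hence locally compact.\<close>
  have Q: "quotient_map (prod_topology P ?W) (prod_topology P ?B) Q"
    unfolding Q_def
    using quotient_map_prod_right[OF compact_imp_locally_compact_space[OF P(1)] _
        quotient_map_weighted_sum[OF n]] P(2) by blast
  define G where "G = (\<lambda>(p, \<mu>). integ \<mu> (\<lambda>x. a (p, x)))"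
  have coord: "continuous_map (prod_topology P ?W) (prod_topology P Z) (\<lambda>q. (fst q, fst (snd q) i))"
    if "i < n" for i
    by (intro continuous_map_pairedI continuous_map_fst
        continuous_map_compose'[OF continuous_map_weighted_points_coords(1) continuous_map_snd] that)
  have wt: "continuous_map (prod_topology P ?W) euclideanreal (\<lambda>q. snd (snd q) i)" for i
    by (rule continuous_map_compose'[OF continuous_map_weighted_points_coords(2) continuous_map_snd])
  have GQ: "G (Q q) = (\<Sum>i<n. snd (snd q) i * a (fst q, fst (snd q) i))" for q
    by (cases q) (auto simp: G_def Q_def weighted_sum_def integ_sum_single split: prod.splits)
  have GQcont: "continuous_map (prod_topology P ?W) euclideanreal (\<lambda>q. G (Q q))"
    unfolding GQ
    by (intro continuous_map_sum continuous_map_real_mult wt continuous_map_compose'[OF a coord]) auto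
  then have G: "continuous_map (prod_topology P ?B) euclideanreal G"
    using continuous_compose_quotient_map[OF Q] by (simp add: o_def)
  define \<Omega> where "\<Omega> = {q \<in> topspace (prod_topology P ?B). G q \<in> {0<..}}"
  have open\<Omega>: "openin (prod_topology P ?B) \<Omega>"
    unfolding \<Omega>_def by (rule openin_continuous_map_preimage[OF G]) auto
  define \<Omega>' where "\<Omega>' = {q \<in> topspace (prod_topology P ?W). Q q \<in> \<Omega>}"
  have Q': "quotient_map (subtopology (prod_topology P ?W) \<Omega>') (subtopology (prod_topology P ?B) \<Omega>) Q"
    by (rule quotient_map_restriction[OF Q]) (use open\<Omega> in \<open>auto simp: \<Omega>'_def\<close>)
  define T where "T = (\<lambda>(p, \<mu>). transport \<mu> (\<lambda>x. a (p, x) / G (p, \<mu>)) (\<lambda>x. \<phi> (p, x)))"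
  have TQ: "T (Q q) = (\<Sum>i<n. Poly_Mapping.single (\<phi> (fst q, fst (snd q) i))
      (snd (snd q) i * (a (fst q, fst (snd q) i) / G (Q q))))" for q
    by (cases q) (auto simp: T_def Q_def weighted_sum_def transport_sum_single split: prod.splits)
  have pos': "G (Q q) > 0" if "q \<in> topspace (subtopology (prod_topology P ?W) \<Omega>')" for q
    using that by (auto simp: \<Omega>'_def \<Omega>_def)
  have mem: "fst q \<in> topspace P" "(fst (snd q), snd (snd q)) \<in> topspace ?W"
    if "q \<in> topspace (subtopology (prod_topology P ?W) \<Omega>')" for q
    using that by auto
  have "continuous_map (subtopology (prod_topology P ?W) \<Omega>') ?B (\<lambda>q. T (Q q))"
    unfolding TQ
  proof (rule continuous_map_into_barycenter_space[OF n])
    fix i assume i: "i < n"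
    show "continuous_map (subtopology (prod_topology P ?W) \<Omega>') Z (\<lambda>q. \<phi> (fst q, fst (snd q) i))"
      by (intro continuous_map_from_subtopology continuous_map_compose'[OF \<phi> coord] i)
    show "continuous_map (subtopology (prod_topology P ?W) \<Omega>') euclideanreal
        (\<lambda>q. snd (snd q) i * (a (fst q, fst (snd q) i) / G (Q q)))"
      using pos' by (intro continuous_map_real_mult continuous_map_real_divide
          continuous_map_from_subtopology wt continuous_map_compose'[OF a coord] i GQcont) force+
    show "0 \<le> snd (snd q) i * (a (fst q, fst (snd q) i) / G (Q q))"
      if q: "q \<in> topspace (subtopology (prod_topology P ?W) \<Omega>')" for q
      using weighted_pointsD[OF n mem(2)[OF q]] mem(1)[OF q] pos'[OF q] a0 i
      by (intro mult_nonneg_nonneg divide_nonneg_nonneg) (auto simp: less_imp_le)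
  next
    fix q assume q: "q \<in> topspace (subtopology (prod_topology P ?W) \<Omega>')"
    have "(\<Sum>i<n. snd (snd q) i * (a (fst q, fst (snd q) i) / G (Q q))) = G (Q q) / G (Q q)"
      by (subst (2) GQ) (simp add: sum_divide_distrib)
    then show "(\<Sum>i<n. snd (snd q) i * (a (fst q, fst (snd q) i) / G (Q q))) = 1"
      using pos'[OF q] by simp
  qed
  then have T: "continuous_map (subtopology (prod_topology P ?B) \<Omega>) ?B T"
    using continuous_compose_quotient_map[OF Q'] by (simp add: o_def)
  \<comment> \<open>Continuity of \<open>f\<close> enters only through its graph, which the
    assumption on the total mass places in \<open>\<Omega>\<close>.\<close>
  have graph: "continuous_map P (subtopology (prod_topology P ?B) \<Omega>) (\<lambda>p. (p, f p))"
    using pos continuous_map_image_subset_topspace[OF f]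
    by (intro continuous_map_into_subtopology continuous_map_pairedI f)
      (auto simp: \<Omega>_def G_def)
  have "continuous_map P ?B (\<lambda>p. T (p, f p))"
    by (rule continuous_map_compose'[OF T graph])
  then show ?thesis
    by (simp add: T_def G_def)
qed

lemma continuous_map_integ:
  assumes n: "n \<ge> 1" and \<psi>: "continuous_map Z euclideanreal \<psi>"
  shows "continuous_map (barycenter_space n Z) euclideanreal (\<lambda>\<mu>. integ \<mu> \<psi>)"
proof -
  have "continuous_map (weighted_points n Z) euclideanreal (\<lambda>p. \<Sum>i<n. snd p i * \<psi> (fst p i))"
    by (intro continuous_map_sum continuous_map_real_mult continuous_map_weighted_points_coords
        continuous_map_compose'[OF \<psi>]) auto
  moreover have "(\<lambda>\<mu>. integ \<mu> \<psi>) \<circ> weighted_sum n = (\<lambda>p. \<Sum>i<n. snd p i * \<psi> (fst p i))"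
    by (auto simp: weighted_sum_def integ_sum_single o_def)
  ultimately show ?thesis
    using continuous_compose_quotient_map[OF quotient_map_weighted_sum[OF n]] by metis
qed

text \<open>Nonnegative weights on the same point cannot cancel.\<close>

lemma keys_sum_single_nonneg:
  fixes t :: "'i \<Rightarrow> real"
  assumes "finite I" "\<And>i. i \<in> I \<Longrightarrow> 0 \<le> t i"
  shows "Poly_Mapping.keys (\<Sum>i\<in>I. Poly_Mapping.single (z i) (t i)) = z ` {i \<in> I. t i \<noteq> 0}"
proof -
  have lk: "Poly_Mapping.lookup (\<Sum>i\<in>I. Poly_Mapping.single (z i) (t i)) x = (\<Sum>i\<in>I. if z i = x then t i else 0)"
    for x by (simp add: lookup_sum lookup_single when_def)
  have "(\<Sum>i\<in>I. if z i = x then t i else 0) = 0 \<longleftrightarrow> (\<forall>i\<in>I. (if z i = x then t i else 0) = 0)" for x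
    by (rule sum_nonneg_eq_0_iff) (use assms in auto)
  then show ?thesis
    by (auto simp: in_keys_iff lk split: if_splits)
qed

section \<open>Closed subspaces, closed points and compact families of measures\<close>

lemma closedin_barycenter_space_iff:
  assumes "n \<ge> 1"
  shows "closedin (barycenter_space n Z) C \<longleftrightarrow> C \<subseteq> barycenters n Z \<and>
    closedin (weighted_points n Z) {p \<in> topspace (weighted_points n Z). weighted_sum n p \<in> C}"
proof -
  have "{p \<in> topspace (weighted_points n Z). weighted_sum n p \<in> barycenters n Z - C} =
      topspace (weighted_points n Z) - {p \<in> topspace (weighted_points n Z). weighted_sum n p \<in> C}"
    using weighted_sum_in_barycenters[OF assms] by blast
  then show ?thesis
    unfolding closedin_def topspace_barycenter_space[OF assms] openin_barycenter_space by auto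
qed

text \<open>The difficulty is that a point of weight 0 may lie outside \<open>K\<close>, so the
  preimage of \<open>C\<close> does not consist of weighted points of \<open>K\<close> alone. On the
  closed set \<open>S J\<close>, where the points with index in \<open>J\<close> lie in
  \<open>K\<close> and the other weights vanish, \<open>r J\<close> replaces the points with index
  outside \<open>J\<close> by one with index in \<open>J\<close>. This changes no measure and
  reduces the claim to weighted points of \<open>K\<close>.\<close>

lemma closedin_barycenter_space_subtopology:
  assumes n: "n \<ge> 1" and K: "closedin X K"
    and C: "closedin (barycenter_space n (subtopology X K)) C"
  shows "closedin (barycenter_space n X) C"
proof -
  let ?W = "weighted_points n X" and ?WK = "weighted_points n (subtopology X K)"
  have KX: "K \<subseteq> topspace X" using K closedin_subset by blast
  define D where "D = {p \<in> topspace ?WK. weighted_sum n p \<in> C}"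
  have CK: "C \<subseteq> barycenters n (subtopology X K)" and D: "closedin ?WK D"
    using C by (simp_all add: closedin_barycenter_space_iff[OF n] D_def)
  define S where "S J = {p \<in> topspace ?W. \<forall>i<n. if i \<in> J then fst p i \<in> K else snd p i \<in> {0}}" for J
  define r where "r J = (\<lambda>p :: (nat \<Rightarrow> 'a) \<times> (nat \<Rightarrow> real).
      (\<lambda>i\<in>{..<n}. fst p (if i \<in> J then i else Min J), \<lambda>i. if i < n then snd p i else 0))" for J
  define \<J> where "\<J> = {J. J \<subseteq> {..<n} \<and> J \<noteq> {}}"
  have MinJ: "Min J \<in> J" "Min J < n" if "J \<in> \<J>" for J
  proof -
    show "Min J \<in> J"
      using that Min_in[of J] finite_subset[of J "{..<n}"] by (auto simp: \<J>_def)
    then show "Min J < n" using that by (auto simp: \<J>_def)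
  qed
  have Wc: "p \<in> topspace ?W \<Longrightarrow> i < n \<Longrightarrow> fst p i \<in> topspace X"
    "p \<in> topspace ?W \<Longrightarrow> 0 \<le> snd p i" "p \<in> topspace ?W \<Longrightarrow> (\<Sum>i<n. snd p i) = 1" for p i
    using weighted_pointsD[OF n, of "fst p" "snd p"] by auto
  have closedS: "closedin ?W (S J)" for J
  proof -
    have "S J = (\<Inter>i\<in>{..<n}. {p \<in> topspace ?W. if i \<in> J then fst p i \<in> K else snd p i \<in> {0}})"
    proof -
      have "0 \<in> {..<n}" using n by simp
      then show ?thesis by (auto simp: S_def)
    qed
    also have "closedin ?W \<dots>"
    proof (intro closedin_INT)
      show "closedin ?W {p \<in> topspace ?W. if i \<in> J then fst p i \<in> K else snd p i \<in> {0}}" if "i \<in> {..<n}" for i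
        using that closedin_continuous_map_preimage[OF continuous_map_weighted_points_coords(1) K, of i n]
          closedin_continuous_map_preimage[OF continuous_map_weighted_points_coords(2), of "{0}" n X i]
        by (cases "i \<in> J") auto
    qed (use n in \<open>auto simp: lessThan_empty_iff\<close>)
    finally show ?thesis .
  qed
  have r: "continuous_map (subtopology ?W (S J)) ?WK (r J)" if J: "J \<in> \<J>" for J
    unfolding r_def
  proof (rule continuous_map_into_weighted_points[OF n])
    fix i assume i: "i < n"
    have "(if i \<in> J then i else Min J) \<in> J" "(if i \<in> J then i else Min J) < n"
      using MinJ[OF J] i by auto
    then show "continuous_map (subtopology ?W (S J)) (subtopology X K) (\<lambda>p. fst p (if i \<in> J then i else Min J))"
      by (intro continuous_map_into_subtopology continuous_map_from_subtopology
          continuous_map_weighted_points_coords) (fastforce simp: S_def)+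
    show "continuous_map (subtopology ?W (S J)) euclideanreal (\<lambda>p. snd p i)"
      by (intro continuous_map_from_subtopology continuous_map_weighted_points_coords)
  qed (use Wc in auto)
  have qr: "weighted_sum n (r J p) = weighted_sum n p" if "p \<in> S J" for J p
    using that by (cases p) (auto simp: weighted_sum_def r_def S_def intro!: sum.cong split: if_splits)
  have "{p \<in> topspace ?W. weighted_sum n p \<in> C} = (\<Union>J\<in>\<J>. {p \<in> S J. r J p \<in> D})" (is "?L = ?R")
  proof (intro equalityI subsetI)
    fix p assume p: "p \<in> ?L"
    \<comment> \<open>The indices of positive weight: their points make up the support, which lies
      in \<open>K\<close>.\<close>
    define J where "J = {i \<in> {..<n}. snd p i \<noteq> 0}"
    have "J \<noteq> {}"
    proof
      assume "J = {}"
      then have "(\<Sum>i<n. snd p i) = 0" by (intro sum.neutral) (auto simp: J_def)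
      then show False using Wc(3)[of p] p by auto
    qed
    then have J: "J \<in> \<J>" by (auto simp: \<J>_def J_def)
    have "Poly_Mapping.keys (weighted_sum n p) = fst p ` J"
      using Wc(2)[of p] p keys_sum_single_nonneg[of "{..<n}" "snd p" "fst p"]
      by (auto simp: weighted_sum_def J_def split: prod.splits)
    moreover have "Poly_Mapping.keys (weighted_sum n p) \<subseteq> K"
      using p CK by (auto simp: barycenters_def)
    ultimately have pS: "p \<in> S J"
      using p by (auto simp: S_def J_def)
    then have "r J p \<in> topspace ?WK"
      using continuous_map_image_subset_topspace[OF r[OF J]] p by auto
    then have "r J p \<in> D" using qr[OF pS] p by (simp add: D_def)
    then show "p \<in> ?R" using J pS by auto
  next
    fix p assume "p \<in> ?R"
    then obtain J where "p \<in> S J" "r J p \<in> D" by (elim UN_E CollectE conjE)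
    have "weighted_sum n (r J p) \<in> C" using \<open>r J p \<in> D\<close> by (simp add: D_def)
    then have "weighted_sum n p \<in> C" by (simp only: qr[OF \<open>p \<in> S J\<close>])
    moreover have "p \<in> topspace ?W" using \<open>p \<in> S J\<close> by (simp add: S_def)
    ultimately show "p \<in> ?L" by simp
  qed
  moreover have "closedin ?W {p \<in> S J. r J p \<in> D}" if "J \<in> \<J>" for J
  proof -
    have "{p \<in> topspace (subtopology ?W (S J)). r J p \<in> D} = {p \<in> S J. r J p \<in> D}"
      by (auto simp: S_def)
    then have "closedin (subtopology ?W (S J)) {p \<in> S J. r J p \<in> D}"
      using closedin_continuous_map_preimage[OF r[OF that] D] by simp
    then show ?thesis
      by (rule closedin_trans_full[OF _ closedS])
  qed
  moreover have "finite \<J>" by (simp add: \<J>_def)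
  ultimately have "closedin ?W {p \<in> topspace ?W. weighted_sum n p \<in> C}"
    by (auto intro!: closedin_Union)
  moreover have "C \<subseteq> barycenters n X" using CK by (auto simp: barycenters_def)
  ultimately show ?thesis by (simp add: closedin_barycenter_space_iff[OF n])
qed

text \<open>Preimages of closed sets can be computed over \<open>X\<close>, because closed sets of
  measures on \<open>K\<close> stay closed among the measures on \<open>X\<close>.\<close>

lemma continuous_map_into_barycenter_space_subtopology:
  assumes n: "n \<ge> 1" and K: "closedin X K" and f: "continuous_map S (barycenter_space n X) f"
    and keys: "\<And>s. s \<in> topspace S \<Longrightarrow> Poly_Mapping.keys (f s) \<subseteq> K"
  shows "continuous_map S (barycenter_space n (subtopology X K)) f"
proof -
  have "f s \<in> barycenters n (subtopology X K)" if "s \<in> topspace S" for s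
    using continuous_map_image_subset_topspace[OF f] keys that
    by (auto simp: topspace_barycenter_space[OF n] barycenters_def image_subset_iff)
  then show ?thesis
    using f closedin_barycenter_space_subtopology[OF n K]
    by (auto simp: continuous_map_closedin topspace_barycenter_space[OF n])
qed

text \<open>It is enough to work over the support of \<open>\<mu>\<close>, a finite closed subspace
  and hence discrete. There the weight of a single point is the integral of a continuous
  function.\<close>

lemma closedin_barycenter_space_singleton:
  assumes n: "n \<ge> 1" and X: "Hausdorff_space X" and \<mu>: "\<mu> \<in> barycenters n X"
  shows "closedin (barycenter_space n X) {\<mu>}"
proof -
  let ?K = "Poly_Mapping.keys \<mu>" and ?l = "Poly_Mapping.lookup \<mu>"
  have KX: "?K \<subseteq> topspace X" using \<mu> by (auto simp: barycenters_def)
  have K: "closedin X ?K" by (rule closedin_Hausdorff_finite[OF X KX]) auto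
  have cont: "continuous_map (subtopology X ?K) euclideanreal g" for g :: "'a \<Rightarrow> real"
    unfolding continuous_map_closedin
  proof (intro conjI allI impI)
    fix C
    have "{x \<in> topspace (subtopology X ?K). g x \<in> C} \<subseteq> ?K" by auto
    then show "closedin (subtopology X ?K) {x \<in> topspace (subtopology X ?K). g x \<in> C}"
      by (intro closedin_subset_topspace closedin_Hausdorff_finite[OF X]) (use KX in \<open>auto intro: finite_subset\<close>)
  qed auto
  have lk: "integ \<nu> (\<lambda>y. if y = x then 1 else 0) = Poly_Mapping.lookup \<nu> x" for \<nu> :: "'a \<Rightarrow>\<^sub>0 real" and x
  proof -
    have "integ \<nu> (\<lambda>y. if y = x then 1 else 0) =
        (\<Sum>y\<in>Poly_Mapping.keys \<nu>. if y = x then Poly_Mapping.lookup \<nu> y else 0)"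
      unfolding integ_def by (rule sum.cong) auto
    then show ?thesis by (simp add: in_keys_iff)
  qed
  let ?B = "barycenter_space n (subtopology X ?K)"
  have "?K \<noteq> {}" using \<mu> by (auto simp: barycenters_def)
  have mem: "\<mu> \<in> topspace ?B"
    using \<mu> by (auto simp: topspace_barycenter_space[OF n] barycenters_def)
  have "{\<mu>} = (\<Inter>x\<in>?K. {\<nu> \<in> topspace ?B. integ \<nu> (\<lambda>y. if y = x then 1 else 0) \<in> {?l x}})"
  proof (intro equalityI subsetI)
    fix \<nu> assume \<nu>: "\<nu> \<in> (\<Inter>x\<in>?K. {\<nu> \<in> topspace ?B. integ \<nu> (\<lambda>y. if y = x then 1 else 0) \<in> {?l x}})"
    obtain x where "x \<in> ?K" using \<open>?K \<noteq> {}\<close> by blast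
    with \<nu> have "\<nu> \<in> topspace ?B" by blast
    then have "Poly_Mapping.keys \<nu> \<subseteq> ?K"
      by (auto simp: topspace_barycenter_space[OF n] barycenters_def)
    then have "Poly_Mapping.lookup \<nu> x = ?l x" for x
      using \<nu> by (cases "x \<in> ?K") (auto simp: lk in_keys_iff)
    then show "\<nu> \<in> {\<mu>}" by (auto intro: poly_mapping_eqI)
  qed (use mem in \<open>auto simp: lk\<close>)
  also have "closedin ?B \<dots>"
    by (intro closedin_INT \<open>?K \<noteq> {}\<close> closedin_continuous_map_preimage[OF continuous_map_integ[OF n cont]]) auto
  finally show ?thesis
    by (rule closedin_barycenter_space_subtopology[OF n K])
qed

text \<open>
  Choosing a measure \<open>m x\<close> with \<open>x\<close> in its support for every \<open>x \<in> D\<close> yields a closed discrete set of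
  measures: near a given point of \<open>X\<^sup>n \<times> \<Delta>\<close>, only the finitely many \<open>x\<close> among its coordinates matter.
\<close>

lemma finite_discrete_in_support:
  assumes n: "n \<ge> 1" and X: "Hausdorff_space X" and S: "compact_space S"
    and f: "continuous_map S (barycenter_space n X) f"
    and D: "\<And>A. A \<subseteq> D \<Longrightarrow> closedin X A"
    and supp: "\<And>x. x \<in> D \<Longrightarrow> \<exists>s\<in>topspace S. x \<in> Poly_Mapping.keys (f s)"
  shows "finite D"
proof -
  let ?B = "barycenter_space n X" and ?W = "weighted_points n X"
  have "\<forall>x\<in>D. \<exists>\<mu>. \<mu> \<in> f ` topspace S \<and> x \<in> Poly_Mapping.keys \<mu>"
    using supp by blast
  then obtain m where m: "\<And>x. x \<in> D \<Longrightarrow> m x \<in> f ` topspace S \<and> x \<in> Poly_Mapping.keys (m x)"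
    by metis
  have fB: "f ` topspace S \<subseteq> barycenters n X"
    using continuous_map_image_subset_topspace[OF f] topspace_barycenter_space[OF n] by metis
  have closed: "closedin ?B (m ` A)" if A: "A \<subseteq> D" for A
    unfolding closedin_barycenter_space_iff[OF n]
  proof (intro conjI)
    show "m ` A \<subseteq> barycenters n X" using m A fB by blast
    let ?E = "\<lambda>A. {p \<in> topspace ?W. weighted_sum n p \<in> m ` A}"
    have finE: "closedin ?W (?E F)" if "finite F" "F \<subseteq> D" for F
    proof -
      have "closedin ?B (\<Union>x\<in>F. {m x})"
        using m fB that by (intro closedin_Union)
          (auto intro!: closedin_barycenter_space_singleton[OF n X])
      then have "closedin ?B (m ` F)" by (simp add: UNION_singleton_eq_range)
      then show ?thesis by (simp add: closedin_barycenter_space_iff[OF n])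
    qed
    show "closedin ?W (?E A)"
      unfolding closedin_def
    proof (intro conjI)
      show "openin ?W (topspace ?W - ?E A)"
      proof (subst openin_subopen, intro ballI)
        fix p assume p: "p \<in> topspace ?W - ?E A"
        \<comment> \<open>Near \<open>p\<close> each coordinate avoids all points of
          \<open>D\<close>, except possibly the one that the same coordinate of \<open>p\<close>
          already occupies. So a measure \<open>m x\<close> presented by a point of \<open>N\<close>
          has \<open>x\<close> among the coordinates of \<open>p\<close>.\<close>
        define N where "N = {p' \<in> topspace ?W. \<forall>i\<in>{..<n}. fst p' i \<in> topspace X - (D - {fst p i})}"
        define F where "F = {x \<in> A. \<exists>i<n. x = fst p i}"
        have "F \<subseteq> fst p ` {..<n}" by (auto simp: F_def)
        then have F: "finite F" "F \<subseteq> A" using finite_subset by (auto simp: F_def)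
        have "N = topspace ?W \<inter> (\<Inter>i\<in>{..<n}. {p' \<in> topspace ?W. fst p' i \<in> topspace X - (D - {fst p i})})"
          by (auto simp: N_def)
        moreover have "openin ?W {p' \<in> topspace ?W. fst p' i \<in> topspace X - (D - {fst p i})}" if "i < n" for i
          by (rule openin_continuous_map_preimage[OF continuous_map_weighted_points_coords(1)[OF that]])
            (use D in auto)
        ultimately have "openin ?W N"
          using n by (auto intro!: openin_Int openin_Inter simp: lessThan_empty_iff)
        then have op: "openin ?W (N - ?E F)"
          using finE[of F] F A by (intro openin_diff) auto
        have pN: "p \<in> N - ?E F"
          using p F(2) weighted_pointsD(1)[OF n, of "fst p" "snd p" X] by (auto simp: N_def)
        have "N - ?E F \<subseteq> topspace ?W - ?E A"
        proof
          fix p' assume p': "p' \<in> N - ?E F"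
          have "p' \<notin> ?E A"
          proof
            assume "p' \<in> ?E A"
            then obtain x where x: "x \<in> A" "weighted_sum n p' = m x" by auto
            have "Poly_Mapping.keys (weighted_sum n p') \<subseteq> fst p' ` {..<n}"
              using keys_sum_single_nonneg[of "{..<n}" "snd p'" "fst p'"]
                weighted_pointsD(2)[OF n, of "fst p'" "snd p'" X] p'
              by (auto simp: N_def weighted_sum_def split: prod.splits)
            then obtain i where i: "i < n" "x = fst p' i"
              using m[of x] x A by fastforce
            then have "x = fst p i" using p' x A by (auto simp: N_def)
            then have "x \<in> F" using x i by (auto simp: F_def)
            then show False using p' x by (auto simp: N_def)
          qed
          then show "p' \<in> topspace ?W - ?E A" using p' by (auto simp: N_def)
        qed
        then show "\<exists>T. openin ?W T \<and> p \<in> T \<and> T \<subseteq> topspace ?W - ?E A"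
          using op pN by blast
      qed
    qed auto
  qed
  \<comment> \<open>\<open>?M\<close> is compact, as a closed subset of the image of
    \<open>f\<close>, and discrete, hence finite. Since \<open>m\<close> need not be injective,
    \<open>D\<close> is recovered from the supports of the measures in \<open>?M\<close>.\<close>
  let ?M = "m ` D"
  have "compactin ?B ?M"
  proof (rule closed_compactin)
    show "compactin ?B (f ` topspace S)"
      using S f image_compactin unfolding compact_space_def by blast
  qed (use m closed in auto)
  moreover have "subtopology ?B ?M = discrete_topology ?M"
  proof (rule sym, subst discrete_topology_unique, intro conjI ballI)
    show top: "topspace (subtopology ?B ?M) = ?M"
      using m fB topspace_barycenter_space[OF n, of X] by auto
    fix \<mu> assume \<mu>: "\<mu> \<in> ?M"
    have "?M - {\<mu>} = m ` {x \<in> D. m x \<noteq> \<mu>}" by auto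
    then have "closedin ?B (?M - {\<mu>})" using closed[of "{x \<in> D. m x \<noteq> \<mu>}"] by simp
    then have "closedin (subtopology ?B ?M) (?M - {\<mu>})"
      by (rule closedin_subset_topspace) auto
    then show "openin (subtopology ?B ?M) {\<mu>}"
      using \<mu> unfolding closedin_def top by (simp add: double_diff)
  qed
  ultimately have "finite ?M"
    by (simp add: compactin_subspace compact_space_discrete_topology)
  then have "finite (\<Union>\<mu>\<in>?M. Poly_Mapping.keys \<mu>)"
    by (rule finite_UN_I) auto
  moreover have "D \<subseteq> (\<Union>\<mu>\<in>?M. Poly_Mapping.keys \<mu>)" using m by blast
  ultimately show ?thesis by (rule finite_subset[rotated])
qed

section \<open>Coloured covers of spheres\<close>

text \<open>The members of the family are the open sets where \<open>c v\<close> is positive; at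
  most one of each colour contains a given point. They are recorded through functions because the
  collapses below use \<open>c v\<close> as a time parameter.\<close>

definition coloured_family ::
  "'s topology \<Rightarrow> 'i set \<Rightarrow> ('i \<Rightarrow> 's \<Rightarrow> real) \<Rightarrow> ('i \<Rightarrow> nat) \<Rightarrow> nat \<Rightarrow> bool" where
  "coloured_family S I c col b \<longleftrightarrow> finite I \<and>
     (\<forall>v\<in>I. continuous_map S euclideanreal (c v) \<and> col v < b) \<and>
     (\<forall>s\<in>topspace S. \<forall>v\<in>I. 0 \<le> c v s) \<and>
     (\<forall>s\<in>topspace S. \<forall>v\<in>I. \<forall>w\<in>I. 0 < c v s \<longrightarrow> 0 < c w s \<longrightarrow> col v = col w \<longrightarrow> v = w)"

lemma continuous_map_Max:
  fixes f :: "'i \<Rightarrow> 'a \<Rightarrow> real"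
  assumes "finite I" "I \<noteq> {}" "\<And>i. i \<in> I \<Longrightarrow> continuous_map X euclideanreal (f i)"
  shows "continuous_map X euclideanreal (\<lambda>x. Max ((\<lambda>i. f i x) ` I))"
  using assms
proof (induction rule: finite_ne_induct)
  case (insert i I)
  have "(\<lambda>x. Max ((\<lambda>i. f i x) ` insert i I)) = (\<lambda>x. max (f i x) (Max ((\<lambda>i. f i x) ` I)))"
    using insert.hyps by (simp add: Max_insert)
  then show ?case
    using insert by (simp add: continuous_map_real_max)
qed simp

section \<open>Spheres as compact Hausdorff spaces\<close>

lemma topspace_nsphere: "s \<in> topspace (nsphere k) \<longleftrightarrow> (\<Sum>i\<le>k. (s i)\<^sup>2) = 1 \<and> (\<forall>i>k. s i = 0)"
  by (auto simp: nsphere)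

lemma compact_space_nsphere: "compact_space (nsphere k)"
proof -
  have "topspace (nsphere k) \<subseteq> (UNIV \<rightarrow>\<^sub>E {-1..1})"
  proof
    fix s assume s: "s \<in> topspace (nsphere k)"
    have "(s i)\<^sup>2 \<le> 1" for i
    proof (cases "i \<le> k")
      case True
      then have "(s i)\<^sup>2 \<le> (\<Sum>i\<le>k. (s i)\<^sup>2)" by (intro member_le_sum) auto
      then show ?thesis using s by (simp add: topspace_nsphere)
    qed (use s in \<open>simp add: topspace_nsphere\<close>)
    then show "s \<in> (UNIV \<rightarrow>\<^sub>E {-1..1})" by (auto simp: abs_square_le_1 abs_le_iff)
  qed
  moreover have "compactin (powertop_real UNIV) (UNIV \<rightarrow>\<^sub>E {-1..1})"
    by (simp add: compactin_PiE)
  moreover have "closedin (powertop_real UNIV) (topspace (nsphere k))"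
  proof -
    have "topspace (nsphere k) = (\<Inter>i\<in>{k<..}. {s \<in> topspace (powertop_real UNIV). s i \<in> {0}}) \<inter>
        {s \<in> topspace (powertop_real UNIV). (\<Sum>i\<le>k. (s i)\<^sup>2) \<in> {1}}"
      by (auto simp: nsphere)
    also have "closedin (powertop_real UNIV) \<dots>"
      by (intro closedin_Int closedin_INT closedin_continuous_map_preimage[where Y = euclideanreal]
          continuous_map_sum continuous_map_real_pow continuous_map_product_projection) auto
    finally show ?thesis .
  qed
  ultimately have "compactin (powertop_real UNIV) (topspace (nsphere k))"
    using closed_compactin by blast
  then show ?thesis
    by (simp add: compactin_subspace nsphere)
qed

lemma Hausdorff_space_nsphere: "Hausdorff_space (nsphere k)"
  by (simp add: nsphere Hausdorff_space_subtopology Hausdorff_space_product_topology)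

text \<open>As entries differ by at most 1, the nonzero ones all have the same sign. One of the
  \<open>k + 1\<close> entries vanishes, so the absolute value of the sum is at most
  \<open>k\<close>; divisibility by \<open>k + 1\<close> makes the sum 0, and with it every
  entry.\<close>

lemma integer_steps_zero:
  fixes e :: "nat \<Rightarrow> int"
  assumes e1: "\<And>i. i \<le> k \<Longrightarrow> \<bar>e i\<bar> \<le> 1" and e2: "\<And>i j. i \<le> k \<Longrightarrow> j \<le> k \<Longrightarrow> \<bar>e i - e j\<bar> \<le> 1"
    and i0: "i0 \<le> k" "e i0 = 0" and dv: "int (Suc k) dvd (\<Sum>i\<le>k. e i)"
  shows "\<forall>i\<le>k. e i = 0"
proof -
  have pos: "\<forall>i\<le>k. e i = 0" if nn: "\<And>i. i \<le> k \<Longrightarrow> 0 \<le> e i" and e1: "\<And>i. i \<le> k \<Longrightarrow> e i \<le> 1"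
    and i0: "i0 \<le> k" "e i0 = 0" and dv: "int (Suc k) dvd (\<Sum>i\<le>k. e i)" for e :: "nat \<Rightarrow> int"
  proof -
    have "(\<Sum>i\<le>k. e i) = (\<Sum>i\<in>{..k} - {i0}. e i)"
      using i0 by (simp add: sum.remove[of "{..k}" i0])
    also have "\<dots> \<le> of_nat (card ({..k} - {i0})) * 1"
      by (rule sum_bounded_above) (use e1 in auto)
    also have "\<dots> = int k" using i0 by simp
    finally have "(\<Sum>i\<le>k. e i) \<le> int k" .
    moreover have "0 \<le> (\<Sum>i\<le>k. e i)" by (rule sum_nonneg) (use nn in auto)
    ultimately have "(\<Sum>i\<le>k. e i) = 0" using zdvd_imp_le[OF dv] by linarith
    then show ?thesis using sum_nonneg_eq_0_iff[of "{..k}" e] nn by auto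
  qed
  show ?thesis
  proof (cases "\<exists>i\<le>k. e i < 0")
    case True
    then obtain i where "i \<le> k" "e i < 0" by blast
    then have "e j \<le> 0" if "j \<le> k" for j using e2[of i j] that by linarith
    then have "\<forall>i\<le>k. - e i = 0"
      using e1 i0 dv by (intro pos) (fastforce simp: sum_negf abs_le_iff)+
    then show ?thesis by simp
  next
    case False
    then show ?thesis using e1 i0 dv by (intro pos) (fastforce simp: abs_le_iff)+
  qed
qed

text \<open>
  The functions \<open>t v\<close> are modelled on the hat functions of the Kuhn triangulation of
  \<open>\<real>\<^bsup>k+1\<^esup>\<close>, restricted to the boundary of the cube \<open>[-N, N]\<^bsup>k+1\<^esup>\<close>. The vertices \<open>v\<close> of a
  simplex in this boundary share a coordinate, so that their coordinate sums differ by at most \<open>k\<close>.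
\<close>

lemma nsphere_coloured_family:
  assumes op: "\<And>C. C \<in> \<C> \<Longrightarrow> openin (nsphere k) C" and cov: "topspace (nsphere k) \<subseteq> \<Union>\<C>"
  obtains I :: "(nat \<Rightarrow> int) set" and t col where "coloured_family (nsphere k) I t col (Suc k)"
    "\<And>v. v \<in> I \<Longrightarrow> \<exists>C\<in>\<C>. \<forall>s\<in>topspace (nsphere k). 0 < t v s \<longrightarrow> s \<in> C"
    "\<And>s. s \<in> topspace (nsphere k) \<Longrightarrow> \<exists>v\<in>I. 0 < t v s"
proof -
  let ?S = "nsphere k"
  define m where "m s = Max ((\<lambda>i. \<bar>s i\<bar>) ` {..k})" for s :: "nat \<Rightarrow> real"
  have coord: "continuous_map ?S euclideanreal (\<lambda>s. s i)" for i
    by (rule continuous_map_nsphere_projection)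
  have m: "continuous_map ?S euclideanreal m"
    unfolding m_def by (rule continuous_map_Max) (auto intro: continuous_map_real_abs coord)
  have m_ge: "\<bar>s i\<bar> \<le> m s" if "i \<le> k" for s i
    unfolding m_def using that by (intro Max_ge) auto
  have m_eq: "\<exists>i\<le>k. m s = \<bar>s i\<bar>" for s
  proof -
    have "m s \<in> (\<lambda>i. \<bar>s i\<bar>) ` {..k}" unfolding m_def by (rule Max_in) auto
    then show ?thesis by auto
  qed
  have m_pos: "0 < m s" if s: "s \<in> topspace ?S" for s
  proof (rule ccontr)
    assume "\<not> 0 < m s"
    then have "s i = 0" if "i \<le> k" for i using m_ge[OF that, of s] by linarith
    then show False using s by (simp add: topspace_nsphere)
  qed
  \<comment> \<open>\<open>r\<close> projects the sphere radially onto the boundary of the cube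
    \<open>[-1, 1]^(k+1)\<close>.\<close>
  define r where "r i s = s i / m s" for i and s :: "nat \<Rightarrow> real"
  have r: "continuous_map ?S euclideanreal (r i)" for i
    unfolding r_def using m_pos by (intro continuous_map_real_divide coord m) force
  have r_inj: "s = s'" if s: "s \<in> topspace ?S" "s' \<in> topspace ?S" and eq: "\<And>i. i \<le> k \<Longrightarrow> r i s = r i s'" for s s'
  proof -
    define c where "c = m s / m s'"
    have "c > 0" using m_pos s by (simp add: c_def)
    have sc: "s i = c * s' i" for i
      using eq[of i] m_pos[OF s(1)] m_pos[OF s(2)] s
      by (cases "i \<le> k") (auto simp: r_def c_def field_simps topspace_nsphere)
    have "1 = (\<Sum>i\<le>k. (c * s' i)\<^sup>2)" using s(1) sc by (simp add: topspace_nsphere)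
    also have "\<dots> = c\<^sup>2" using s(2) by (simp add: power_mult_distrib topspace_nsphere flip: sum_distrib_left)
    finally have "c = 1" using \<open>c > 0\<close> by (simp add: power2_eq_1_iff)
    then show ?thesis using sc by auto
  qed
  \<comment> \<open>Since \<open>r\<close> is injective and the complement of \<open>C\<close> is
    compact, the sup-distance from \<open>s\<close> in the coordinates \<open>r\<close> has a
    positive minimum on that complement.\<close>
  have nbhd: "\<exists>\<epsilon>>0. \<forall>s'\<in>topspace ?S. (\<forall>i\<le>k. \<bar>r i s' - r i s\<bar> < \<epsilon>) \<longrightarrow> s' \<in> C"
    if s: "s \<in> C" and C: "openin ?S C" for s C
  proof (cases "topspace ?S - C = {}")
    case True
    then show ?thesis by (intro exI[of _ 1]) auto
  next
    case False
    define D where "D s' = Max ((\<lambda>i. \<bar>r i s' - r i s\<bar>) ` {..k})" for s'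
    have D: "continuous_map ?S euclideanreal D"
      unfolding D_def by (rule continuous_map_Max) (auto intro!: continuous_map_real_abs continuous_map_diff r)
    have "compactin ?S (topspace ?S - C)"
      using C compact_space_nsphere by (intro closedin_compact_space) auto
    then have "compact (D ` (topspace ?S - C))"
      using image_compactin[OF _ D] by (simp add: compactin_euclidean_iff)
    then obtain s1 where s1: "s1 \<in> topspace ?S - C" "\<And>s'. s' \<in> topspace ?S - C \<Longrightarrow> D s1 \<le> D s'"
      using compact_attains_inf[of "D ` (topspace ?S - C)"] False by auto
    have D_ge: "\<bar>r i s' - r i s\<bar> \<le> D s'" if "i \<le> k" for i s'
      unfolding D_def using that by (intro Max_ge) auto
    have "D s1 > 0"
    proof (rule ccontr)
      assume "\<not> D s1 > 0"
      then have "r i s1 = r i s" if "i \<le> k" for i using D_ge[OF that, of s1] by linarith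
      then have "s1 = s" using s1 s C openin_subset by (intro r_inj) blast+
      then show False using s1 s by blast
    qed
    moreover have "s' \<in> C" if "s' \<in> topspace ?S" "\<forall>i\<le>k. \<bar>r i s' - r i s\<bar> < D s1" for s'
    proof (rule ccontr)
      assume "s' \<notin> C"
      then have "D s1 \<le> D s'" using s1 that by blast
      moreover have "D s' < D s1"
        unfolding D_def[of s'] using that by (subst Max_less_iff) auto
      ultimately show False by linarith
    qed
    ultimately show ?thesis by blast
  qed
  have "\<forall>s\<in>topspace ?S. \<exists>C \<epsilon>. C \<in> \<C> \<and> 0 < \<epsilon> \<and>
      (\<forall>s'\<in>topspace ?S. (\<forall>i\<le>k. \<bar>r i s' - r i s\<bar> < \<epsilon>) \<longrightarrow> s' \<in> C)"
    using nbhd cov op by (meson UnionE subsetD)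
  then obtain C \<epsilon> where C: "\<And>s. s \<in> topspace ?S \<Longrightarrow> C s \<in> \<C>" and \<epsilon>: "\<And>s. s \<in> topspace ?S \<Longrightarrow> 0 < \<epsilon> s"
    and C\<epsilon>: "\<And>s s'. s \<in> topspace ?S \<Longrightarrow> s' \<in> topspace ?S \<Longrightarrow> (\<And>i. i \<le> k \<Longrightarrow> \<bar>r i s' - r i s\<bar> < \<epsilon> s) \<Longrightarrow> s' \<in> C s"
    by metis
  \<comment> \<open>Lebesgue number argument: finitely many boxes of half the admissible size cover
    the sphere, so a nonempty set whose \<open>r\<close>-diameter is below all these half sizes lies
    in one member of \<open>\<C>\<close>.\<close>
  define B where "B s = topspace ?S \<inter> (\<Inter>i\<in>{..k}. {s' \<in> topspace ?S. \<bar>r i s' - r i s\<bar> \<in> {..<\<epsilon> s / 2}})" for s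
  have "openin ?S (B s)" for s
    unfolding B_def
    by (intro openin_Int openin_topspace openin_INT2 openin_continuous_map_preimage[where Y = euclideanreal]
        continuous_map_real_abs continuous_map_diff r) auto
  moreover have "s \<in> B s" if "s \<in> topspace ?S" for s
    using that \<epsilon> by (auto simp: B_def)
  ultimately have "\<exists>\<F>. finite \<F> \<and> \<F> \<subseteq> B ` topspace ?S \<and> topspace ?S \<subseteq> \<Union>\<F>"
    by (intro compact_space_nsphere[unfolded compact_space_alt, rule_format]) blast
  then obtain A where A: "finite A" "A \<subseteq> topspace ?S" "topspace ?S \<subseteq> (\<Union>a\<in>A. B a)"
    by (metis finite_subset_image)
  have "topspace ?S \<noteq> {}" using in_topspace_nsphere by blast
  then have "A \<noteq> {}" using A by auto
  define \<delta> where "\<delta> = Min ((\<lambda>s. \<epsilon> s / 2) ` A)"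
  have "\<delta> > 0" unfolding \<delta>_def using A \<epsilon> \<open>A \<noteq> {}\<close> by (subst Min_gr_iff) auto
  have \<delta>_le: "\<delta> \<le> \<epsilon> a / 2" if "a \<in> A" for a
    unfolding \<delta>_def using A that by (intro Min_le) auto
  \<comment> \<open>On the support of a hat the coordinates \<open>N * r\<close> vary by less than
    2, so \<open>r\<close> varies by less than \<open>2 / N < \<delta>\<close>.\<close>
  obtain N where N: "2 / \<delta> < real N" using reals_Archimedean2 by blast
  then have N0: "0 < real N" using \<open>\<delta> > 0\<close> by (smt (verit) divide_pos_pos)
  have close: "\<exists>C\<in>\<C>. \<forall>s\<in>T. s \<in> C"
    if T: "T \<subseteq> topspace ?S" "T \<noteq> {}" and d: "\<And>s s' i. s \<in> T \<Longrightarrow> s' \<in> T \<Longrightarrow> i \<le> k \<Longrightarrow> \<bar>r i s' - r i s\<bar> < \<delta>" for T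
  proof -
    obtain s where s: "s \<in> T" using T by blast
    then obtain a where a: "a \<in> A" "s \<in> B a" using A T by blast
    have "s' \<in> C a" if s': "s' \<in> T" for s'
    proof (rule C\<epsilon>)
      show "\<bar>r i s' - r i a\<bar> < \<epsilon> a" if "i \<le> k" for i
      proof -
        have "\<bar>r i s - r i a\<bar> < \<epsilon> a / 2" using a(2) that by (auto simp: B_def)
        then show ?thesis using d[OF s s' that] \<delta>_le[OF a(1)] by linarith
      qed
    qed (use a A T s' in auto)
    then show ?thesis using C a A by blast
  qed
  define y where "y i s = real N * r i s" for i s
  have y: "continuous_map ?S euclideanreal (y i)" for i
    unfolding y_def by (intro continuous_map_real_mult r) auto
  have y0: "y i s = 0" if "s \<in> topspace ?S" "i > k" for i s
    using that by (simp add: y_def r_def topspace_nsphere)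
  have yN: "\<bar>y i s\<bar> \<le> real N" if "s \<in> topspace ?S" "i \<le> k" for i s
    using m_ge[OF that(2), of s] m_pos[OF that(1)] by (simp add: y_def r_def abs_mult pos_divide_le_eq mult_left_mono)
  define I where "I = {v. \<forall>i. (i \<in> {..k} \<longrightarrow> v i \<in> {- int N - 1..int N + 1}) \<and> (i \<notin> {..k} \<longrightarrow> v i = 0)}"
  \<comment> \<open>Coordinate \<open>Suc k\<close> is 0 for \<open>y\<close> on the sphere and for
    \<open>v\<close> in \<open>I\<close>, so the factors that involve it bound
    \<open>\<bar>y i s - v i\<bar>\<close> itself. The product is positive exactly on the open star
    of \<open>v\<close> in the Kuhn triangulation.\<close>
  define t where "t v s = (\<Prod>p\<in>{..Suc k} \<times> {..Suc k}.
      max 0 (1 - \<bar>(y (fst p) s - v (fst p)) - (y (snd p) s - v (snd p))\<bar>))" for v :: "nat \<Rightarrow> int" and s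
  define col where "col v = nat ((\<Sum>i\<le>k. v i) mod int (Suc k))" for v :: "nat \<Rightarrow> int"
  have t_nonneg: "0 \<le> t v s" for v s
    unfolding t_def by (rule prod_nonneg) auto
  have t_pos: "0 < t v s \<longleftrightarrow> (\<forall>i\<le>Suc k. \<forall>j\<le>Suc k. \<bar>(y i s - v i) - (y j s - v j)\<bar> < 1)" for v s
  proof -
    have "0 < t v s \<longleftrightarrow> t v s \<noteq> 0" using t_nonneg[of v s] by linarith
    also have "\<dots> \<longleftrightarrow> (\<forall>p\<in>{..Suc k} \<times> {..Suc k}.
        max 0 (1 - \<bar>(y (fst p) s - v (fst p)) - (y (snd p) s - v (snd p))\<bar>) \<noteq> 0)"
      unfolding t_def by (subst prod_zero_iff) auto
    also have "\<dots> \<longleftrightarrow> (\<forall>i\<le>Suc k. \<forall>j\<le>Suc k. \<bar>(y i s - v i) - (y j s - v j)\<bar> < 1)"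
    proof -
      have "max 0 (1 - \<bar>x\<bar>) \<noteq> 0 \<longleftrightarrow> \<bar>x\<bar> < 1" for x :: real by (auto simp: max_def)
      then show ?thesis by (simp only:) auto
    qed
    finally show ?thesis .
  qed
  have t_pos1: "\<bar>y i s - v i\<bar> < 1" if "0 < t v s" "v \<in> I" "s \<in> topspace ?S" "i \<le> k" for v s i
  proof -
    have "\<bar>(y i s - v i) - (y (Suc k) s - v (Suc k))\<bar> < 1"
      using that unfolding t_pos by auto
    then show ?thesis using y0[of s "Suc k"] that by (simp add: I_def)
  qed
  have col_inj: "v = w"
    if s: "s \<in> topspace ?S" and v: "v \<in> I" "0 < t v s" and w: "w \<in> I" "0 < t w s" and eq: "col v = col w" for s v w
  proof -
    define e where "e i = w i - v i" for i
    \<comment> \<open>At a coordinate of maximal absolute value \<open>y\<close> is \<open>N\<close>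
      or \<open>- N\<close>, an integer, so \<open>v\<close> and \<open>w\<close> must both take
      that value there. This is where restricting to the boundary of the cube saves one
      colour.\<close>
    obtain i0 where i0: "i0 \<le> k" "m s = \<bar>s i0\<bar>" using m_eq by blast
    have "y i0 s = real N \<or> y i0 s = - real N"
      using i0(2) m_pos[OF s] by (auto simp: y_def r_def abs_if split: if_splits)
    then obtain z :: int where z: "y i0 s = of_int z"
      by (metis of_int_minus of_int_of_nat_eq)
    have "\<bar>z - v i0\<bar> < 1" "\<bar>z - w i0\<bar> < 1"
      using t_pos1[OF v(2,1) s i0(1)] t_pos1[OF w(2,1) s i0(1)] unfolding z by linarith+
    then have e0: "e i0 = 0" by (simp add: e_def)
    have "\<forall>i\<le>k. e i = 0"
    proof (rule integer_steps_zero[where e = e, OF _ _ i0(1) e0])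
      show "\<bar>e i\<bar> \<le> 1" if "i \<le> k" for i
        using t_pos1[OF v(2,1) s that] t_pos1[OF w(2,1) s that] unfolding e_def by linarith
      show "\<bar>e i - e j\<bar> \<le> 1" if "i \<le> k" "j \<le> k" for i j
      proof -
        have "\<bar>(y i s - v i) - (y j s - v j)\<bar> < 1" "\<bar>(y i s - w i) - (y j s - w j)\<bar> < 1"
          using v(2) w(2) that unfolding t_pos by auto
        then show ?thesis unfolding e_def by linarith
      qed
      have "(\<Sum>i\<le>k. w i) mod int (Suc k) = (\<Sum>i\<le>k. v i) mod int (Suc k)"
        using eq unfolding col_def by (metis Euclidean_Rings.pos_mod_sign eq_nat_nat_iff of_nat_0_less_iff zero_less_Suc)
      then show "int (Suc k) dvd (\<Sum>i\<le>k. e i)"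
        unfolding e_def sum_subtractf by (metis mod_eq_dvd_iff)
    qed
    then have "v i = w i" for i
      using v w by (cases "i \<le> k") (auto simp: e_def I_def)
    then show ?thesis by blast
  qed
  show thesis
  proof
    show "coloured_family ?S I t col (Suc k)"
      unfolding coloured_family_def
    proof (intro conjI ballI impI)
      show "finite I" unfolding I_def by (rule finite_set_of_finite_funs) auto
      show "continuous_map ?S euclideanreal (t v)" for v
        unfolding t_def
        by (intro continuous_map_prod continuous_map_real_max continuous_map_diff continuous_map_real_abs y) auto
      show "col v < Suc k" for v
      proof -
        have "(\<Sum>i\<le>k. v i) mod int (Suc k) < int (Suc k)" by simp
        then show ?thesis unfolding col_def by linarith
      qed
    qed (use t_nonneg col_inj in auto)
    show "\<exists>C\<in>\<C>. \<forall>s\<in>topspace ?S. 0 < t v s \<longrightarrow> s \<in> C" if v: "v \<in> I" for v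
    proof (cases "{s \<in> topspace ?S. 0 < t v s} = {}")
      case True
      obtain C where "C \<in> \<C>" using cov \<open>topspace ?S \<noteq> {}\<close> by blast
      then show ?thesis using True by blast
    next
      case False
      have "\<exists>C\<in>\<C>. \<forall>s\<in>{s \<in> topspace ?S. 0 < t v s}. s \<in> C"
      proof (rule close[OF _ False])
        fix s s' i assume s: "s \<in> {s \<in> topspace ?S. 0 < t v s}" "s' \<in> {s \<in> topspace ?S. 0 < t v s}" and i: "i \<le> k"
        have "\<bar>y i s' - y i s\<bar> < 2"
          using t_pos1[of v s i] t_pos1[of v s' i] s v i by auto
        then have "real N * \<bar>r i s' - r i s\<bar> < 2"
          using N0 by (simp add: y_def abs_mult flip: right_diff_distrib)
        also have "2 < real N * \<delta>" using N \<open>\<delta> > 0\<close> by (simp add: field_simps)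
        finally show "\<bar>r i s' - r i s\<bar> < \<delta>" using N0 by simp
      qed auto
      then show ?thesis by blast
    qed
    show "\<exists>v\<in>I. 0 < t v s" if s: "s \<in> topspace ?S" for s
    proof (rule bexI[of _ "\<lambda>i. \<lfloor>y i s\<rfloor>"])
      \<comment> \<open>Fractional parts lie in \<open>[0, 1)\<close>, so any two of them differ by
        less than 1.\<close>
      show "0 < t (\<lambda>i. \<lfloor>y i s\<rfloor>) s"
        unfolding t_pos by (intro allI impI) linarith
      have "- int N - 1 \<le> \<lfloor>y i s\<rfloor> \<and> \<lfloor>y i s\<rfloor> \<le> int N + 1" if "i \<le> k" for i
        using yN[OF s that] by linarith
      then show "(\<lambda>i. \<lfloor>y i s\<rfloor>) \<in> I"
        using y0[OF s] by (auto simp: I_def)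
    qed
  qed
qed

section \<open>Collapses of locally contractible spaces\<close>

abbreviation unit_interval :: "real topology" where
  "unit_interval \<equiv> top_of_set {0..1}"

definition locally_contractible_space :: "'a topology \<Rightarrow> bool" where
  "locally_contractible_space X \<longleftrightarrow>
     (\<forall>U x. openin X U \<and> x \<in> U \<longrightarrow>
        (\<exists>V h c. openin X V \<and> x \<in> V \<and> V \<subseteq> U \<and>
           continuous_map (prod_topology (subtopology X V) unit_interval) X h \<and>
           (\<forall>y\<in>V. h (y, 0) = y \<and> h (y, 1) = c \<and> (\<forall>t\<in>{0..1}. h (y, t) \<in> U))))"

text \<open>Finitely many open \<open>N a\<close> cover \<open>K\<close>, with closed sets
  \<open>F a\<close> between \<open>N a\<close> and \<open>U a\<close>. The set \<open>V x\<close>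
  lies in \<open>U a\<close> if \<open>x\<close> is in \<open>F a\<close>, and misses
  \<open>F a\<close> otherwise. Hence every \<open>V x\<close> that contains a point of
  \<open>F a\<close> lies in \<open>U a\<close>.\<close>

lemma barycentric_refinement:
  assumes K: "compact_space K" "Hausdorff_space K"
    and op: "\<And>U. U \<in> \<U> \<Longrightarrow> openin K U" and cov: "topspace K \<subseteq> \<Union>\<U>"
  obtains \<V> where "\<And>V. V \<in> \<V> \<Longrightarrow> openin K V" "topspace K \<subseteq> \<Union>\<V>"
    "\<And>z. z \<in> topspace K \<Longrightarrow> \<exists>U\<in>\<U>. \<forall>V\<in>\<V>. z \<in> V \<longrightarrow> V \<subseteq> U"
proof -
  have reg: "neighbourhood_base_of (closedin K) K"
    using compact_Hausdorff_imp_regular_space[OF K] neighbourhood_base_of_closedin by blast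
  have "\<forall>x\<in>topspace K. \<exists>U N F. U \<in> \<U> \<and> openin K N \<and> closedin K F \<and> x \<in> N \<and> N \<subseteq> F \<and> F \<subseteq> U"
  proof
    fix x assume "x \<in> topspace K"
    then obtain U where "U \<in> \<U>" "x \<in> U" using cov by auto
    then show "\<exists>U N F. U \<in> \<U> \<and> openin K N \<and> closedin K F \<and> x \<in> N \<and> N \<subseteq> F \<and> F \<subseteq> U"
      using reg op unfolding neighbourhood_base_of by meson
  qed
  then obtain U N F where UNF: "\<And>x. x \<in> topspace K \<Longrightarrow>
      U x \<in> \<U> \<and> openin K (N x) \<and> closedin K (F x) \<and> x \<in> N x \<and> N x \<subseteq> F x \<and> F x \<subseteq> U x"
    by metis
  have "\<exists>\<F>. finite \<F> \<and> \<F> \<subseteq> N ` topspace K \<and> topspace K \<subseteq> \<Union>\<F>"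
  proof (rule K(1)[unfolded compact_space_alt, rule_format], intro conjI ballI)
    show "openin K V" if "V \<in> N ` topspace K" for V using that UNF by auto
    show "topspace K \<subseteq> \<Union> (N ` topspace K)" using UNF by auto
  qed
  then obtain A where A: "finite A" "A \<subseteq> topspace K" "topspace K \<subseteq> (\<Union>a\<in>A. N a)"
    by (metis finite_subset_image)
  define V where "V x = topspace K \<inter> (\<Inter>a\<in>A. if x \<in> F a then U a else topspace K - F a)" for x
  show thesis
  proof
    show "openin K W" if WV: "W \<in> V ` topspace K" for W
    proof -
      obtain x where W: "W = V x" using WV by auto
      have "A \<noteq> {}" using A(3) WV by auto
      then show ?thesis
        unfolding W V_def
      proof (intro openin_Int openin_topspace openin_Inter)
        fix T assume "T \<in> (\<lambda>a. if x \<in> F a then U a else topspace K - F a) ` A"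
        then obtain a where "a \<in> A" "T = (if x \<in> F a then U a else topspace K - F a)" by blast
        then show "openin K T" using UNF[of a] A(2) op by auto
      qed (use A in auto)
    qed
    have "x \<in> V x" if "x \<in> topspace K" for x
      using that UNF A by (auto simp: V_def)
    then show "topspace K \<subseteq> \<Union> (V ` topspace K)" by blast
    fix z assume z: "z \<in> topspace K"
    then obtain a where a: "a \<in> A" "z \<in> N a" using A by auto
    then have za: "z \<in> F a" "U a \<in> \<U>" using UNF A by auto
    have "V x \<subseteq> U a" if "z \<in> V x" for x
    proof -
      have "x \<in> F a"
      proof (rule ccontr)
        assume "x \<notin> F a"
        then have "V x \<subseteq> topspace K - F a" using a(1) by (auto simp: V_def)
        then show False using that za by blast
      qed
      then show ?thesis using a by (auto simp: V_def)
    qed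
    then show "\<exists>U\<in>\<U>. \<forall>W\<in>V ` topspace K. z \<in> W \<longrightarrow> W \<subseteq> U"
      using za by blast
  qed
qed

text \<open>Two barycentric refinements in a row. If \<open>W'\<close> meets \<open>W\<close>, then
  both lie in one member of the intermediate cover. That member contains a fixed \<open>w\<close> in
  \<open>W\<close>, and all members containing \<open>w\<close> lie in a common
  \<open>U\<close>.\<close>

lemma star_refinement:
  assumes K: "compact_space K" "Hausdorff_space K"
    and op: "\<And>U. U \<in> \<U> \<Longrightarrow> openin K U" and cov: "topspace K \<subseteq> \<Union>\<U>"
  obtains \<W> where "\<And>W. W \<in> \<W> \<Longrightarrow> openin K W" "topspace K \<subseteq> \<Union>\<W>"
    "\<And>W. W \<in> \<W> \<Longrightarrow> W \<noteq> {} \<Longrightarrow> \<exists>U\<in>\<U>. \<forall>W'\<in>\<W>. W \<inter> W' \<noteq> {} \<longrightarrow> W' \<subseteq> U"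
proof -
  obtain \<V> where V: "\<And>V. V \<in> \<V> \<Longrightarrow> openin K V" "topspace K \<subseteq> \<Union>\<V>"
    "\<And>z. z \<in> topspace K \<Longrightarrow> \<exists>U\<in>\<U>. \<forall>V\<in>\<V>. z \<in> V \<longrightarrow> V \<subseteq> U"
    using barycentric_refinement[OF K op cov] by blast
  obtain \<W> where W: "\<And>V. V \<in> \<W> \<Longrightarrow> openin K V" "topspace K \<subseteq> \<Union>\<W>"
    "\<And>z. z \<in> topspace K \<Longrightarrow> \<exists>U\<in>\<V>. \<forall>V\<in>\<W>. z \<in> V \<longrightarrow> V \<subseteq> U"
    using barycentric_refinement[OF K V(1,2)] by blast
  show thesis
  proof
    fix W assume "W \<in> \<W>" "W \<noteq> {}"
    then obtain w where w: "w \<in> W" "w \<in> topspace K" using W(1) openin_subset by blast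
    then obtain U where U: "U \<in> \<U>" "\<forall>V\<in>\<V>. w \<in> V \<longrightarrow> V \<subseteq> U" using V(3) by blast
    have "W' \<subseteq> U" if "W' \<in> \<W>" "z \<in> W" "z \<in> W'" for W' z
    proof -
      have "z \<in> topspace K" using that W(1) openin_subset by blast
      then obtain V' where "V' \<in> \<V>" "\<forall>V\<in>\<W>. z \<in> V \<longrightarrow> V \<subseteq> V'" using W(3) by blast
      then show ?thesis using that U w \<open>W \<in> \<W>\<close> by blast
    qed
    then show "\<exists>U\<in>\<U>. \<forall>W'\<in>\<W>. W \<inter> W' \<noteq> {} \<longrightarrow> W' \<subseteq> U" using U by blast
  qed (use W in auto)
qed

text \<open>The time of a local contraction is multiplied by a Urysohn function
  \<open>\<psi>\<close> that is 1 near \<open>x\<close> and vanishes outside a closed subset of the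
  domain \<open>V1\<close>. Near \<open>x\<close> the contraction still runs to its end, while the
  identity extends it to all of \<open>K\<close>.\<close>

lemma local_collapse:
  assumes K: "compact_space K" "Hausdorff_space K" and lc: "locally_contractible_space K"
    and W: "openin K W" and x: "x \<in> W"
  obtains V \<kappa> where "openin K V" "x \<in> V" "V \<subseteq> W"
    "continuous_map (prod_topology K unit_interval) K \<kappa>"
    "\<And>y. y \<in> topspace K \<Longrightarrow> \<kappa> (y, 0) = y" "\<exists>c. \<forall>y\<in>V. \<kappa> (y, 1) = c"
    "\<And>y t. y \<in> W \<Longrightarrow> t \<in> {0..1} \<Longrightarrow> \<kappa> (y, t) \<in> W" "\<And>y t. y \<notin> W \<Longrightarrow> \<kappa> (y, t) = y"
proof -
  have reg: "neighbourhood_base_of (closedin K) K"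
    using compact_Hausdorff_imp_regular_space[OF K] neighbourhood_base_of_closedin by blast
  obtain V1 h c where V1: "openin K V1" "x \<in> V1" "V1 \<subseteq> W"
    and h: "continuous_map (prod_topology (subtopology K V1) unit_interval) K h"
    and h01: "\<And>y. y \<in> V1 \<Longrightarrow> h (y, 0) = y" "\<And>y. y \<in> V1 \<Longrightarrow> h (y, 1) = c"
      "\<And>y t. y \<in> V1 \<Longrightarrow> t \<in> {0..1} \<Longrightarrow> h (y, t) \<in> W"
    using lc W x unfolding locally_contractible_space_def by metis
  obtain N C where N: "openin K N" "closedin K C" "x \<in> N" "N \<subseteq> C" "C \<subseteq> V1"
    using reg V1 unfolding neighbourhood_base_of by meson
  obtain N' C' where N': "openin K N'" "closedin K C'" "x \<in> N'" "N' \<subseteq> C'" "C' \<subseteq> N"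
    using reg N unfolding neighbourhood_base_of by meson
  have "normal_space K" using K compact_Hausdorff_or_regular_imp_normal_space by blast
  moreover have cl: "closedin K (topspace K - N)" using N by auto
  moreover have dis: "disjnt (topspace K - N) C'" using N' by (auto simp: disjnt_iff)
  ultimately obtain \<psi> where \<psi>: "continuous_map K (top_of_set {0..1::real}) \<psi>" "\<psi> ` (topspace K - N) \<subseteq> {0}" "\<psi> ` C' \<subseteq> {1}"
    using Urysohn_lemma[where a = 0 and b = 1 and X = K, OF _ cl N'(2) dis] by auto
  define \<kappa> where "\<kappa> = (\<lambda>(y, t). if y \<in> V1 then h (y, t * \<psi> y) else y)"
  have \<psi>01: "\<psi> y \<in> {0..1}" if "y \<in> topspace K" for y
    using \<psi>(1) that by (force simp: continuous_map_in_subtopology)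
  have \<psi>N: "\<psi> y = 0" if "y \<in> topspace K" "y \<notin> C" for y
    using \<psi>(2) N(4) that by blast
  have V1K: "V1 \<subseteq> topspace K" "W \<subseteq> topspace K" using V1 W openin_subset by auto
  have t\<psi>: "t * \<psi> y \<in> {0..1}" if "y \<in> topspace K" "t \<in> {0..1}" for y t
    using \<psi>01[OF that(1)] that(2) by (auto simp: mult_le_one)
  \<comment> \<open>The open sets \<open>V1\<close> and \<open>topspace K - C\<close> cover
    \<open>K\<close>, and on their overlap \<open>\<psi>\<close> is 0.\<close>
  have "continuous_map (prod_topology K unit_interval) K \<kappa>"
  proof (rule pasting_lemma[where I = UNIV and T = "\<lambda>b. (if b then V1 else topspace K - C) \<times> {0..1}"
        and f = "\<lambda>b. if b then (\<lambda>(y, t). h (y, t * \<psi> y)) else fst"])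
    fix b
    show "openin (prod_topology K unit_interval) ((if b then V1 else topspace K - C) \<times> {0..1})"
      using V1 N by (auto simp: openin_prod_Times_iff)
    have "continuous_map (prod_topology (subtopology K V1) unit_interval) K (\<lambda>(y, t). h (y, t * \<psi> y))"
      unfolding case_prod_unfold
    proof (rule continuous_map_compose'[OF h], intro continuous_map_pairedI continuous_map_fst continuous_map_into_subtopology
        continuous_map_real_mult)
      show "continuous_map (prod_topology (subtopology K V1) unit_interval) euclideanreal snd"
        using continuous_map_snd continuous_map_into_fulltopology by blast
      show "continuous_map (prod_topology (subtopology K V1) unit_interval) euclideanreal (\<lambda>x. \<psi> (fst x))"
        using \<psi>(1) continuous_map_into_fulltopology[of K]
        by (intro continuous_map_compose'[OF _ continuous_map_fst]) (auto intro: continuous_map_from_subtopology)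
    qed (use t\<psi> in auto)
    then show "continuous_map (subtopology (prod_topology K unit_interval) ((if b then V1 else topspace K - C) \<times> {0..1}))
        K (if b then (\<lambda>(y, t). h (y, t * \<psi> y)) else fst)"
      by (auto simp: subtopology_Times subtopology_subtopology continuous_map_subtopology_fst
          intro: continuous_map_into_fulltopology[OF continuous_map_fst])
  next
    fix i j p assume "p \<in> topspace (prod_topology K unit_interval) \<inter> (if i then V1 else topspace K - C) \<times> {0..1} \<inter>
          (if j then V1 else topspace K - C) \<times> {0..1}"
    then show "(if i then \<lambda>(y, t). h (y, t * \<psi> y) else fst) p = (if j then \<lambda>(y, t). h (y, t * \<psi> y) else fst) p"
      using \<psi>N h01(1) by auto
  next
    fix p assume "p \<in> topspace (prod_topology K unit_interval)"
    then show "\<exists>j. j \<in> UNIV \<and> p \<in> (if j then V1 else topspace K - C) \<times> {0..1} \<and>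
        \<kappa> p = (if j then \<lambda>(y, t). h (y, t * \<psi> y) else fst) p"
      using N(5) by (intro exI[of _ "fst p \<in> V1"]) (auto simp: \<kappa>_def)
  qed
  moreover have "\<kappa> (y, t) \<in> W" if "y \<in> W" "t \<in> {0..1}" for y t
    using that h01(3)[of y "t * \<psi> y"] t\<psi>[of y t] V1K by (auto simp: \<kappa>_def)
  moreover have "\<forall>y\<in>N'. \<kappa> (y, 1) = c"
  proof
    fix y assume "y \<in> N'"
    moreover from this have "y \<in> C'" using N' by blast
    ultimately have "y \<in> V1" "\<psi> y = 1" using N N' \<psi>(3) by blast+
    then show "\<kappa> (y, 1) = c" using h01(2) by (simp add: \<kappa>_def)
  qed
  ultimately show thesis
    using N N' V1 h01(1) by (intro that[of N' \<kappa>]) (auto simp: \<kappa>_def)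
qed

text \<open>
  The set \<open>\<rho> V'\<close> bounds the image of \<open>V'\<close> under the collapse of every \<open>V\<close>, so that the next
  collapse can be chosen without knowing which \<open>V\<close> has been collapsed.
\<close>

lemma collapse_refinement:
  assumes K: "compact_space K" "Hausdorff_space K" and lc: "locally_contractible_space K"
    and op: "\<And>U. U \<in> \<U> \<Longrightarrow> openin K U" and cov: "topspace K \<subseteq> \<Union>\<U>"
  obtains \<V> \<rho> \<kappa> where "\<And>V. V \<in> \<V> \<Longrightarrow> openin K V" "topspace K \<subseteq> \<Union>\<V>"
    "\<And>V. V \<in> \<V> \<Longrightarrow> \<rho> V \<in> \<U>"
    "\<And>V. V \<in> \<V> \<Longrightarrow> continuous_map (prod_topology K unit_interval) K (\<kappa> V)"
    "\<And>V y. V \<in> \<V> \<Longrightarrow> y \<in> topspace K \<Longrightarrow> \<kappa> V (y, 0) = y"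
    "\<And>V. V \<in> \<V> \<Longrightarrow> \<exists>c. \<forall>y\<in>V. \<kappa> V (y, 1) = c"
    "\<And>V V' y t. V \<in> \<V> \<Longrightarrow> V' \<in> \<V> \<Longrightarrow> y \<in> V' \<Longrightarrow> t \<in> {0..1} \<Longrightarrow> \<kappa> V (y, t) \<in> \<rho> V'"
proof -
  obtain \<W> where W: "\<And>W. W \<in> \<W> \<Longrightarrow> openin K W" "topspace K \<subseteq> \<Union>\<W>"
    "\<And>W. W \<in> \<W> \<Longrightarrow> W \<noteq> {} \<Longrightarrow> \<exists>U\<in>\<U>. \<forall>W'\<in>\<W>. W \<inter> W' \<noteq> {} \<longrightarrow> W' \<subseteq> U"
    using star_refinement[OF K op cov] by blast
  \<comment> \<open>\<open>W\<close> confines the motion of \<open>\<kappa>\<close>: nothing inside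
    leaves it and nothing outside moves. Nonemptiness of \<open>V\<close> passes to
    \<open>W\<close>, where the star property of \<open>\<W>\<close> asks for it.\<close>
  define good where "good V W \<kappa> \<longleftrightarrow> W \<in> \<W> \<and> openin K V \<and> V \<noteq> {} \<and> V \<subseteq> W \<and>
      continuous_map (prod_topology K unit_interval) K \<kappa> \<and> (\<forall>y\<in>topspace K. \<kappa> (y, 0) = y) \<and>
      (\<exists>c. \<forall>y\<in>V. \<kappa> (y, 1) = c) \<and> (\<forall>y\<in>W. \<forall>t\<in>{0..1}. \<kappa> (y, t) \<in> W) \<and> (\<forall>y t. y \<notin> W \<longrightarrow> \<kappa> (y, t) = y)"
    for V W \<kappa>
  define \<V> where "\<V> = {V. \<exists>W \<kappa>. good V W \<kappa>}"
  have "\<forall>V\<in>\<V>. \<exists>W \<kappa>. good V W \<kappa>" unfolding \<V>_def by blast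
  then obtain w \<kappa> where g: "\<And>V. V \<in> \<V> \<Longrightarrow> good V (w V) (\<kappa> V)"
    by metis
  have wW: "w V \<in> \<W>" "w V \<noteq> {}" if "V \<in> \<V>" for V
    using g[OF that] by (auto simp: good_def)
  \<comment> \<open>\<open>\<rho> V\<close> contains every member of \<open>\<W>\<close> that meets
    \<open>w V\<close>, in particular the confining set of any collapse that moves a point of
    \<open>V\<close>.\<close>
  obtain \<rho> where \<rho>: "\<And>V. V \<in> \<V> \<Longrightarrow> \<rho> V \<in> \<U> \<and> (\<forall>W'\<in>\<W>. w V \<inter> W' \<noteq> {} \<longrightarrow> W' \<subseteq> \<rho> V)"
    using W(3)[OF wW] by metis
  show thesis
  proof
    show "topspace K \<subseteq> \<Union>\<V>"
    proof
      fix x assume "x \<in> topspace K"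
      then obtain W' where W': "W' \<in> \<W>" "x \<in> W'" using W by auto
      then have "openin K W'" using W by auto
      from local_collapse[OF K lc this W'(2)] obtain V \<kappa> where "openin K V" "x \<in> V" "V \<subseteq> W'"
        "continuous_map (prod_topology K unit_interval) K \<kappa>"
        "\<And>y. y \<in> topspace K \<Longrightarrow> \<kappa> (y, 0) = y" "\<exists>c. \<forall>y\<in>V. \<kappa> (y, 1) = c"
        "\<And>y t. y \<in> W' \<Longrightarrow> t \<in> {0..1} \<Longrightarrow> \<kappa> (y, t) \<in> W'" "\<And>y t. y \<notin> W' \<Longrightarrow> \<kappa> (y, t) = y"
        by blast
      then have "good V W' \<kappa>" using W' by (auto simp: good_def)
      then show "x \<in> \<Union>\<V>" using \<open>x \<in> V\<close> by (auto simp: \<V>_def)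
    qed
    show "\<kappa> V (y, t) \<in> \<rho> V'" if V: "V \<in> \<V>" "V' \<in> \<V>" and y: "y \<in> V'" and t: "t \<in> {0..1}" for V V' y t
    proof (cases "y \<in> w V")
      case True
      then have "\<kappa> V (y, t) \<in> w V" using g[OF V(1)] t by (auto simp: good_def)
      moreover have "y \<in> w V'" using g[OF V(2)] y by (auto simp: good_def)
      ultimately show ?thesis using \<rho>[OF V(2)] wW(1)[OF V(1)] True by blast
    next
      case False
      then have "\<kappa> V (y, t) = y" using g[OF V(1)] by (auto simp: good_def)
      moreover have "y \<in> w V'" using g[OF V(2)] y by (auto simp: good_def)
      ultimately show ?thesis using \<rho>[OF V(2)] wW[OF V(2)] by auto
    qed
  qed (use g \<rho> in \<open>auto simp: good_def\<close>)
qed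

text \<open>All the \<open>\<kappa> v\<close> are applied in succession, each at time
  \<open>t * c v s\<close>. At each \<open>s\<close> at most one of these times is positive, and at
  time 0 a collapse is the identity, so the composite acts as the single active collapse. Being a
  composite, it is continuous in \<open>s\<close> without any case distinction.\<close>

lemma disjoint_collapse:
  assumes J: "finite J"
    and \<kappa>: "\<And>v. v \<in> J \<Longrightarrow> continuous_map (prod_topology K unit_interval) K (\<kappa> v)"
      "\<And>v y. v \<in> J \<Longrightarrow> y \<in> topspace K \<Longrightarrow> \<kappa> v (y, 0) = y"
    and c: "\<And>v. v \<in> J \<Longrightarrow> continuous_map S euclideanreal (c v)"
      "\<And>v s. v \<in> J \<Longrightarrow> s \<in> topspace S \<Longrightarrow> 0 \<le> c v s \<and> c v s \<le> 1"
    and disj: "\<And>v w s. s \<in> topspace S \<Longrightarrow> v \<in> J \<Longrightarrow> w \<in> J \<Longrightarrow> 0 < c v s \<Longrightarrow> 0 < c w s \<Longrightarrow> v = w"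
  obtains \<phi> where "continuous_map (prod_topology (prod_topology S unit_interval) K) K \<phi>"
    "\<And>s t x. s \<in> topspace S \<Longrightarrow> x \<in> topspace K \<Longrightarrow> t \<in> {0..1} \<Longrightarrow> \<forall>v\<in>J. c v s = 0 \<Longrightarrow> \<phi> ((s, t), x) = x"
    "\<And>s t x v. s \<in> topspace S \<Longrightarrow> x \<in> topspace K \<Longrightarrow> t \<in> {0..1} \<Longrightarrow> v \<in> J \<Longrightarrow> 0 < c v s \<Longrightarrow>
       \<phi> ((s, t), x) = \<kappa> v (x, t * c v s)"
proof -
  let ?P = "prod_topology (prod_topology S unit_interval) K"
  have "\<exists>\<phi>. continuous_map ?P K \<phi> \<and>
    (\<forall>s\<in>topspace S. \<forall>x\<in>topspace K. \<forall>t\<in>{0..1}. (\<forall>v\<in>J. c v s = 0) \<longrightarrow> \<phi> ((s, t), x) = x) \<and>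
    (\<forall>s\<in>topspace S. \<forall>x\<in>topspace K. \<forall>t\<in>{0..1}. \<forall>v\<in>J. 0 < c v s \<longrightarrow> \<phi> ((s, t), x) = \<kappa> v (x, t * c v s))"
    using J \<kappa> c disj
  proof (induction J)
    case empty
    show ?case by (rule exI[of _ snd]) (simp add: continuous_map_snd)
  next
    case (insert v J)
    have "\<exists>\<phi>. continuous_map ?P K \<phi> \<and>
      (\<forall>s\<in>topspace S. \<forall>x\<in>topspace K. \<forall>t\<in>{0..1}. (\<forall>v\<in>J. c v s = 0) \<longrightarrow> \<phi> ((s, t), x) = x) \<and>
      (\<forall>s\<in>topspace S. \<forall>x\<in>topspace K. \<forall>t\<in>{0..1}. \<forall>v\<in>J. 0 < c v s \<longrightarrow> \<phi> ((s, t), x) = \<kappa> v (x, t * c v s))"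
    proof (rule insert.IH)
      show "continuous_map (prod_topology K unit_interval) K (\<kappa> w)" if "w \<in> J" for w
        using insert.prems(1) that by blast
      show "\<kappa> w (y, 0) = y" if "w \<in> J" "y \<in> topspace K" for w y
        using insert.prems(2) that by blast
      show "continuous_map S euclideanreal (c w)" if "w \<in> J" for w
        using insert.prems(3) that by blast
      show "0 \<le> c w s \<and> c w s \<le> 1" if "w \<in> J" "s \<in> topspace S" for w s
        using insert.prems(4) that by blast
      show "v = w" if "s \<in> topspace S" "v \<in> J" "w \<in> J" "0 < c v s" "0 < c w s" for v w s
        using insert.prems(5)[OF that(1) _ _ that(4,5)] that(2,3) by blast
    qed
    then obtain \<phi> where \<phi>: "continuous_map ?P K \<phi>"
      "\<And>s x t. s \<in> topspace S \<Longrightarrow> x \<in> topspace K \<Longrightarrow> t \<in> {0..1} \<Longrightarrow> \<forall>v\<in>J. c v s = 0 \<Longrightarrow> \<phi> ((s, t), x) = x"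
      "\<And>s x t v. s \<in> topspace S \<Longrightarrow> x \<in> topspace K \<Longrightarrow> t \<in> {0..1} \<Longrightarrow> v \<in> J \<Longrightarrow> 0 < c v s \<Longrightarrow>
         \<phi> ((s, t), x) = \<kappa> v (x, t * c v s)"
      by blast
    define \<phi>' where "\<phi>' = (\<lambda>p. \<kappa> v (\<phi> p, snd (fst p) * c v (fst (fst p))))"
    have cv: "continuous_map S euclideanreal (c v)" "\<And>s. s \<in> topspace S \<Longrightarrow> 0 \<le> c v s \<and> c v s \<le> 1"
      and \<kappa>v: "continuous_map (prod_topology K unit_interval) K (\<kappa> v)" "\<And>y. y \<in> topspace K \<Longrightarrow> \<kappa> v (y, 0) = y"
      using insert.prems(1-4) by blast+
    have fst1: "continuous_map ?P S (\<lambda>p. fst (fst p))"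
      by (rule continuous_map_compose'[OF continuous_map_fst continuous_map_fst])
    have snd1: "continuous_map ?P unit_interval (\<lambda>p. snd (fst p))"
      by (rule continuous_map_compose'[OF continuous_map_snd continuous_map_fst])
    have cont: "continuous_map ?P K \<phi>'"
      unfolding \<phi>'_def
    proof (rule continuous_map_compose'[OF \<kappa>v(1)], intro continuous_map_pairedI \<phi>(1) continuous_map_into_subtopology
        continuous_map_real_mult)
      show "continuous_map ?P euclideanreal (\<lambda>p. snd (fst p))"
        using snd1 continuous_map_into_fulltopology by blast
      show "continuous_map ?P euclideanreal (\<lambda>p. c v (fst (fst p)))"
        by (rule continuous_map_compose'[OF cv(1) fst1])
      show "(\<lambda>p. snd (fst p) * c v (fst (fst p))) \<in> topspace ?P \<rightarrow> {0..1}"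
        using cv(2) by (auto simp: mult_le_one)
    qed
    have in\<phi>: "\<phi> ((s, t), x) \<in> topspace K" if "s \<in> topspace S" "x \<in> topspace K" "t \<in> {0..1}" for s t x
      using continuous_map_image_subset_topspace[OF \<phi>(1)] that by (force simp: image_subset_iff)
    have off: "\<phi>' ((s, t), x) = \<phi> ((s, t), x)"
      if "s \<in> topspace S" "x \<in> topspace K" "t \<in> {0..1}" "c v s = 0" for s t x
      using \<kappa>v(2)[OF in\<phi>[OF that(1-3)]] that(4) by (simp add: \<phi>'_def)
    have others: "c w s = 0" if "s \<in> topspace S" "u \<in> insert v J" "0 < c u s" "w \<in> insert v J" "w \<noteq> u" for s u w
    proof -
      have "\<not> 0 < c w s" using insert.prems(5)[OF that(1,2,4,3)] that(5) by blast
      then show ?thesis using insert.prems(4)[OF that(4,1)] by linarith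
    qed
    have "\<phi>' ((s, t), x) = x"
      if "s \<in> topspace S" "x \<in> topspace K" "t \<in> {0..1}" "\<forall>w\<in>insert v J. c w s = 0" for s t x
    proof -
      have "\<phi>' ((s, t), x) = \<phi> ((s, t), x)" by (rule off) (use that in auto)
      also have "\<dots> = x" by (rule \<phi>(2)) (use that in auto)
      finally show ?thesis .
    qed
    moreover have "\<phi>' ((s, t), x) = \<kappa> w (x, t * c w s)"
      if s: "s \<in> topspace S" and x: "x \<in> topspace K" and t: "t \<in> {0..1}" and w: "w \<in> insert v J" "0 < c w s" for s t x w
    proof (cases "w = v")
      case True
      have "\<forall>u\<in>J. c u s = 0" using others[OF s w] True \<open>v \<notin> J\<close> by blast
      then show ?thesis using \<phi>(2)[OF s x t] True by (simp add: \<phi>'_def)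
    next
      case False
      then have "c v s = 0" using others[OF s w, of v] by simp
      then have "\<phi>' ((s, t), x) = \<phi> ((s, t), x)" by (rule off[OF s x t])
      also have "\<dots> = \<kappa> w (x, t * c w s)" by (rule \<phi>(3)[OF s x t]) (use w False in auto)
      finally show ?thesis .
    qed
    ultimately show ?case using cont by blast
  qed
  then show thesis using that by blast
qed

text \<open>Induction on the number of colours. The cover for \<open>Suc b\<close> colours comes
  from the one for \<open>b\<close> by \<open>collapse_refinement\<close>, and the top colour is
  collapsed first, at the finest scale. This carries a set \<open>V v\<close> of lower colour into
  \<open>\<rho> (V v)\<close>, a member of the coarser cover, and the induction hypothesis for these
  larger sets supplies the remaining collapses.\<close>

lemma multi_collapse:
  fixes S :: "'s topology" and K :: "'a topology"
  assumes K: "compact_space K" "Hausdorff_space K" and lc: "locally_contractible_space K"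
  obtains \<O> where "\<And>V. V \<in> \<O> \<Longrightarrow> openin K V" "topspace K \<subseteq> \<Union>\<O>"
    "\<And>I :: 'i set. \<And>V c col.
       \<lbrakk>coloured_family S I c col b; \<And>v. v \<in> I \<Longrightarrow> V v \<in> \<O>; \<And>v s. v \<in> I \<Longrightarrow> s \<in> topspace S \<Longrightarrow> c v s \<le> 1\<rbrakk> \<Longrightarrow>
       \<exists>\<phi>. continuous_map (prod_topology (prod_topology S unit_interval) K) K \<phi> \<and>
          (\<forall>s\<in>topspace S. \<forall>x\<in>topspace K. \<phi> ((s, 0), x) = x) \<and>
          (\<forall>s\<in>topspace S. \<forall>v\<in>I. c v s = 1 \<longrightarrow> (\<exists>p. \<forall>x\<in>V v. \<phi> ((s, 1), x) = p))"
proof -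
  let ?P = "prod_topology (prod_topology S unit_interval) K"
  define concl where "concl I V c \<longleftrightarrow> (\<exists>\<phi>. continuous_map ?P K \<phi> \<and>
      (\<forall>s\<in>topspace S. \<forall>x\<in>topspace K. \<phi> ((s, 0), x) = x) \<and>
      (\<forall>s\<in>topspace S. \<forall>v\<in>I. c v s = 1 \<longrightarrow> (\<exists>p. \<forall>x\<in>V v. \<phi> ((s, 1), x) = p)))"
    for I :: "'i set" and V and c :: "'i \<Rightarrow> 's \<Rightarrow> real"
  define prem where "prem I V c col b \<O> \<longleftrightarrow> coloured_family S I c col b \<and> (\<forall>v\<in>I. V v \<in> \<O>) \<and>
      (\<forall>v\<in>I. \<forall>s\<in>topspace S. c v s \<le> 1)"
    for I :: "'i set" and V and c :: "'i \<Rightarrow> 's \<Rightarrow> real" and col b and \<O> :: "'a set set"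
  have "\<exists>\<O>. (\<forall>V\<in>\<O>. openin K V) \<and> topspace K \<subseteq> \<Union>\<O> \<and> (\<forall>I V c col. prem I V c col b \<O> \<longrightarrow> concl I V c)"
  proof (induction b)
    case 0
    have "concl I V c" if "prem I V c col 0 {topspace K}" for I V c col
    proof -
      have "I = {}" using that by (auto simp: prem_def coloured_family_def)
      then show ?thesis unfolding concl_def by (intro exI[of _ snd]) (simp add: continuous_map_snd)
    qed
    then show ?case by (intro exI[of _ "{topspace K}"]) auto
  next
    case (Suc b)
    then obtain \<O> where O: "\<And>V. V \<in> \<O> \<Longrightarrow> openin K V" "topspace K \<subseteq> \<Union>\<O>"
      and IH: "\<And>I V c col. prem I V c col b \<O> \<Longrightarrow> concl I V c"
      by metis
    obtain \<V> \<rho> \<kappa> where V: "\<And>V. V \<in> \<V> \<Longrightarrow> openin K V" "topspace K \<subseteq> \<Union>\<V>"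
      and \<rho>: "\<And>V. V \<in> \<V> \<Longrightarrow> \<rho> V \<in> \<O>"
      and \<kappa>: "\<And>V. V \<in> \<V> \<Longrightarrow> continuous_map (prod_topology K unit_interval) K (\<kappa> V)"
      "\<And>V y. V \<in> \<V> \<Longrightarrow> y \<in> topspace K \<Longrightarrow> \<kappa> V (y, 0) = y"
      "\<And>V. V \<in> \<V> \<Longrightarrow> \<exists>c. \<forall>y\<in>V. \<kappa> V (y, 1) = c"
      "\<And>V V' y t. V \<in> \<V> \<Longrightarrow> V' \<in> \<V> \<Longrightarrow> y \<in> V' \<Longrightarrow> t \<in> {0..1} \<Longrightarrow> \<kappa> V (y, t) \<in> \<rho> V'"
      by (rule collapse_refinement[OF K lc O]) blast+
    have "concl I V c" if pr: "prem I V c col (Suc b) \<V>" for I V c col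
    proof -
      have I: "finite I" and VV: "\<And>v. v \<in> I \<Longrightarrow> V v \<in> \<V>"
        and cc: "\<And>v. v \<in> I \<Longrightarrow> continuous_map S euclideanreal (c v)"
        and c01: "\<And>v s. v \<in> I \<Longrightarrow> s \<in> topspace S \<Longrightarrow> 0 \<le> c v s \<and> c v s \<le> 1"
        and dis: "\<And>v w s. s \<in> topspace S \<Longrightarrow> v \<in> I \<Longrightarrow> w \<in> I \<Longrightarrow> 0 < c v s \<Longrightarrow> 0 < c w s \<Longrightarrow> col v = col w \<Longrightarrow> v = w"
        using pr unfolding prem_def coloured_family_def by blast+
      let ?J = "{v \<in> I. col v = b}" and ?I' = "{v \<in> I. col v < b}"
      obtain \<phi>0 where \<phi>0: "continuous_map ?P K \<phi>0"
        "\<And>s t x. s \<in> topspace S \<Longrightarrow> x \<in> topspace K \<Longrightarrow> t \<in> {0..1} \<Longrightarrow> \<forall>v\<in>?J. c v s = 0 \<Longrightarrow> \<phi>0 ((s, t), x) = x"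
        "\<And>s t x v. s \<in> topspace S \<Longrightarrow> x \<in> topspace K \<Longrightarrow> t \<in> {0..1} \<Longrightarrow> v \<in> ?J \<Longrightarrow> 0 < c v s \<Longrightarrow>
           \<phi>0 ((s, t), x) = \<kappa> (V v) (x, t * c v s)"
      proof (rule disjoint_collapse[where K = K and S = S and J = ?J and \<kappa> = "\<lambda>v. \<kappa> (V v)" and c = c])
        show "finite ?J" using I by simp
        show "continuous_map (prod_topology K unit_interval) K (\<kappa> (V v))" if "v \<in> ?J" for v
          using \<kappa>(1)[OF VV] that by blast
        show "\<kappa> (V v) (y, 0) = y" if "v \<in> ?J" "y \<in> topspace K" for v y
          using \<kappa>(2)[OF VV] that by blast
        show "continuous_map S euclideanreal (c v)" if "v \<in> ?J" for v
          using cc that by blast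
        show "0 \<le> c v s \<and> c v s \<le> 1" if "v \<in> ?J" "s \<in> topspace S" for v s
          using c01 that by blast
        show "v = w" if "s \<in> topspace S" "v \<in> ?J" "w \<in> ?J" "0 < c v s" "0 < c w s" for v w s
          using dis[OF that(1) _ _ that(4,5)] that(2,3) by simp
      qed blast
      have "prem ?I' (\<lambda>v. \<rho> (V v)) c col b \<O>"
        unfolding prem_def coloured_family_def
        using I cc c01 \<rho>[OF VV] dis by simp
      then obtain \<phi>1 where \<phi>1: "continuous_map ?P K \<phi>1"
        "\<And>s x. s \<in> topspace S \<Longrightarrow> x \<in> topspace K \<Longrightarrow> \<phi>1 ((s, 0), x) = x"
        "\<And>s v. s \<in> topspace S \<Longrightarrow> v \<in> ?I' \<Longrightarrow> c v s = 1 \<Longrightarrow> \<exists>p. \<forall>x\<in>\<rho> (V v). \<phi>1 ((s, 1), x) = p"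
      proof -
        assume *: "\<And>\<phi>1. continuous_map ?P K \<phi>1 \<Longrightarrow>
          (\<And>s x. s \<in> topspace S \<Longrightarrow> x \<in> topspace K \<Longrightarrow> \<phi>1 ((s, 0), x) = x) \<Longrightarrow>
          (\<And>s v. s \<in> topspace S \<Longrightarrow> v \<in> ?I' \<Longrightarrow> c v s = 1 \<Longrightarrow> \<exists>p. \<forall>x\<in>\<rho> (V v). \<phi>1 ((s, 1), x) = p) \<Longrightarrow> thesis"
        assume "prem ?I' (\<lambda>v. \<rho> (V v)) c col b \<O>"
        from IH[OF this] show thesis
          unfolding concl_def by (elim exE conjE) (rule *, assumption, blast, blast)
      qed
      have VK: "x \<in> topspace K" if "v \<in> I" "x \<in> V v" for v x
        using V(1)[OF VV] that openin_subset by blast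
      show "concl I V c"
        unfolding concl_def
      proof (intro exI[of _ "\<lambda>p. \<phi>1 (fst p, \<phi>0 p)"] conjI ballI impI)
        show "continuous_map ?P K (\<lambda>p. \<phi>1 (fst p, \<phi>0 p))"
          by (intro continuous_map_compose'[OF \<phi>1(1)] continuous_map_pairedI continuous_map_fst \<phi>0(1))
        fix s assume s: "s \<in> topspace S"
        have \<phi>0s: "\<phi>0 ((s, t), x) = x \<or> (\<exists>v\<in>?J. \<phi>0 ((s, t), x) = \<kappa> (V v) (x, t * c v s))"
          if "x \<in> topspace K" "t \<in> {0..1}" for x t
        proof (cases "\<forall>v\<in>?J. c v s = 0")
          case True
          then show ?thesis using \<phi>0(2)[OF s that] by blast
        next
          case False
          then obtain v where v: "v \<in> ?J" "c v s \<noteq> 0" by blast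
          then have "0 < c v s" using c01[of v s] s by auto
          then show ?thesis using \<phi>0(3)[OF s that v(1)] v(1) by blast
        qed
        show "\<phi>1 (fst ((s, 0), x), \<phi>0 ((s, 0), x)) = x" if x: "x \<in> topspace K" for x
        proof -
          have "\<phi>0 ((s, 0), x) = x"
            using \<phi>0s[OF x, of 0] \<kappa>(2)[OF VV x] by auto
          then show ?thesis using \<phi>1(2)[OF s x] by simp
        qed
        fix v assume v: "v \<in> I" "c v s = 1"
        have "col v \<le> b" using pr v(1) by (auto simp: prem_def coloured_family_def)
        then consider "col v = b" | "col v < b" by linarith
        then show "\<exists>p. \<forall>x\<in>V v. \<phi>1 (fst ((s, 1), x), \<phi>0 ((s, 1), x)) = p"
        proof cases
          case 1
          \<comment> \<open>The first stage already makes \<open>V v\<close> a single point, and the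
            later stages keep it one.\<close>
          obtain p where p: "\<forall>y\<in>V v. \<kappa> (V v) (y, 1) = p" using \<kappa>(3)[OF VV[OF v(1)]] by blast
          have "\<phi>0 ((s, 1), x) = p" if "x \<in> V v" for x
            using \<phi>0(3)[OF s VK[OF v(1) that], of 1 v] v 1 p that by simp
          then show ?thesis by simp
        next
          case 2
          have "\<phi>0 ((s, 1), x) \<in> \<rho> (V v)" if x: "x \<in> V v" for x
          proof -
            have xK: "x \<in> topspace K" using VK[OF v(1) x] .
            show ?thesis
              using \<phi>0s[OF xK, of 1]
            proof
              assume "\<phi>0 ((s, 1), x) = x"
              \<comment> \<open>The bound on \<open>\<kappa>\<close> at time 0 gives
                \<open>V v \<subseteq> \<rho> (V v)\<close>.\<close>
              then show ?thesis
                using \<kappa>(4)[OF VV[OF v(1)] VV[OF v(1)] x, of 0] \<kappa>(2)[OF VV[OF v(1)] xK] by simp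
            next
              assume "\<exists>w\<in>?J. \<phi>0 ((s, 1), x) = \<kappa> (V w) (x, 1 * c w s)"
              then obtain w where w: "w \<in> I" "\<phi>0 ((s, 1), x) = \<kappa> (V w) (x, c w s)" by auto
              have "c w s \<in> {0..1}" using c01[OF w(1) s] by simp
              then show ?thesis
                unfolding w(2) by (rule \<kappa>(4)[OF VV[OF w(1)] VV[OF v(1)] x])
            qed simp
          qed
          moreover obtain p where "\<forall>x\<in>\<rho> (V v). \<phi>1 ((s, 1), x) = p" using \<phi>1(3)[OF s _ v(2)] v 2 by blast
          ultimately show ?thesis by auto
        qed
      qed
    qed
    then have "\<forall>I V c col. prem I V c col (Suc b) \<V> \<longrightarrow> concl I V c" by (intro allI impI)
    moreover have "\<forall>V\<in>\<V>. openin K V" by (intro ballI V(1))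
    ultimately show ?case using V(2) by (intro exI[of _ \<V>] conjI)
  qed
  then obtain \<O> where O: "\<forall>V\<in>\<O>. openin K V" "topspace K \<subseteq> \<Union>\<O>"
    "\<forall>I V c col. prem I V c col b \<O> \<longrightarrow> concl I V c" by (elim exE conjE)
  show thesis
  proof (rule that[OF O(1)[rule_format] O(2)])
    fix I :: "'i set" and V :: "'i \<Rightarrow> 'a set" and c :: "'i \<Rightarrow> 's \<Rightarrow> real" and col
    assume "coloured_family S I c col b" "\<And>v. v \<in> I \<Longrightarrow> V v \<in> \<O>"
      "\<And>v s. v \<in> I \<Longrightarrow> s \<in> topspace S \<Longrightarrow> c v s \<le> 1"
    then have "prem I V c col b \<O>" unfolding prem_def by blast
    from O(3)[rule_format, OF this] show "\<exists>\<phi>. continuous_map ?P K \<phi> \<and>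
        (\<forall>s\<in>topspace S. \<forall>x\<in>topspace K. \<phi> ((s, 0), x) = x) \<and>
        (\<forall>s\<in>topspace S. \<forall>v\<in>I. c v s = 1 \<longrightarrow> (\<exists>p. \<forall>x\<in>V v. \<phi> ((s, 1), x) = p))"
      unfolding concl_def .
  qed
qed

section \<open>Null-homotopies\<close>

lemma homotopic_withI_right:
  assumes h: "continuous_map (prod_topology S unit_interval) Y h"
    and "\<And>s. s \<in> topspace S \<Longrightarrow> h (s, 0) = f s" "\<And>s. s \<in> topspace S \<Longrightarrow> h (s, 1) = g s"
  shows "homotopic_with (\<lambda>_. True) S Y f g"
proof -
  have "continuous_map (prod_topology unit_interval S) Y (\<lambda>p. h (snd p, fst p))"
    by (intro continuous_map_compose'[OF h] continuous_map_pairedI continuous_map_fst continuous_map_snd)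
  then show ?thesis
    unfolding homotopic_with[of S "\<lambda>_. True", simplified]
    using assms(2,3) by (intro exI[of _ "\<lambda>p. h (snd p, fst p)"]) auto
qed

text \<open>A free null-homotopy extends \<open>f\<close> over the disc, which is the quotient of
  the cylinder over the sphere by the cone map \<open>m\<close>. Straight lines in the disc towards
  \<open>sphere_base\<close> then contract the sphere and keep the base point fixed.\<close>

lemma pointed_null_homotopic:
  assumes hom: "homotopic_with (\<lambda>_. True) (nsphere k) Z f (\<lambda>_. c)" and z: "f sphere_base = z"
  shows "homotopic_with (\<lambda>h. h sphere_base = z) (nsphere k) Z f (\<lambda>_. z)"
proof -
  let ?S = "nsphere k"
  obtain h where h: "continuous_map (prod_topology unit_interval ?S) Z h"
    "\<And>s. s \<in> topspace ?S \<Longrightarrow> h (0, s) = f s" "\<And>s. s \<in> topspace ?S \<Longrightarrow> h (1, s) = c"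
    using hom unfolding homotopic_with[of ?S "\<lambda>_. True", simplified] by blast
  have b: "sphere_base \<in> topspace ?S"
    unfolding sphere_base_def by (rule in_topspace_nsphere)
  define m where "m = (\<lambda>(t :: real, s :: nat \<Rightarrow> real) i. (1 - t) * s i)"
  let ?P = "prod_topology unit_interval ?S"
  \<comment> \<open>The closed unit disc, introduced as the image of \<open>m\<close> so that
    \<open>m\<close> is onto by construction.\<close>
  define D where "D = subtopology (powertop_real UNIV) (m ` topspace ?P)"
  have coord: "continuous_map ?P euclideanreal (\<lambda>p. snd p i)" "continuous_map ?P euclideanreal fst" for i
    by (rule continuous_map_compose'[OF continuous_map_nsphere_projection continuous_map_snd])
      (use continuous_map_fst continuous_map_into_fulltopology in blast)
  have "continuous_map ?P (powertop_real UNIV) m"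
    unfolding continuous_map_componentwise_UNIV m_def case_prod_unfold
    by (intro allI continuous_map_real_mult continuous_map_diff coord) auto
  then have mD: "continuous_map ?P D m"
    unfolding D_def by (rule continuous_map_into_subtopology) auto
  have topD: "topspace D = m ` topspace ?P" unfolding D_def by auto
  have "compact_space ?P"
    by (simp add: compact_space_prod_topology compact_space_nsphere compact_space_subtopology compactin_euclidean_iff)
  moreover have "Hausdorff_space D"
    unfolding D_def by (simp add: Hausdorff_space_subtopology Hausdorff_space_product_topology)
  ultimately have Q: "quotient_map ?P D m"
    using mD topD by (intro continuous_imp_quotient_map) auto
  have norm: "(\<Sum>i\<le>k. (m (t, s) i)\<^sup>2) = (1 - t)\<^sup>2" if "s \<in> topspace ?S" for s t
    using that by (simp add: m_def power_mult_distrib topspace_nsphere flip: sum_distrib_left)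
  have "h p = h p'" if p: "p \<in> topspace ?P" "p' \<in> topspace ?P" and eq: "m p = m p'" for p p'
  proof -
    obtain t s t' s' where [simp]: "p = (t, s)" "p' = (t', s')" by (cases p, cases p')
    have ts: "t \<in> {0..1}" "s \<in> topspace ?S" "t' \<in> {0..1}" "s' \<in> topspace ?S" using p by auto
    have "(1 - t)\<^sup>2 = (1 - t')\<^sup>2"
      using norm[OF ts(2), of t] norm[OF ts(4), of t'] eq by simp
    then have t: "t = t'" using ts by (simp add: power2_eq_iff_nonneg)
    show ?thesis
    proof (cases "t = 1")
      case True
      then show ?thesis using h(3) ts t by simp
    next
      case False
      then have "s = s'" using eq t by (auto simp: m_def fun_eq_iff)
      then show ?thesis using t by simp
    qed
  qed
  then obtain F where F: "continuous_map D Z F" "\<And>p. p \<in> topspace ?P \<Longrightarrow> F (m p) = h p"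
    using quotient_map_lift_exists[OF Q h(1)] by metis
  \<comment> \<open>Polar coordinates; the centre is the image of time 1, with any point of the
    sphere.\<close>
  have inD: "x \<in> topspace D" if x: "\<And>i. i > k \<Longrightarrow> x i = 0" "(\<Sum>i\<le>k. (x i)\<^sup>2) \<le> 1" for x
  proof -
    define \<rho> where "\<rho> = sqrt (\<Sum>i\<le>k. (x i)\<^sup>2)"
    have \<rho>: "0 \<le> \<rho>" "\<rho> \<le> 1" "\<rho>\<^sup>2 = (\<Sum>i\<le>k. (x i)\<^sup>2)"
      using x(2) by (auto simp: \<rho>_def sum_nonneg)
    show ?thesis
    proof (cases "\<rho> = 0")
      case True
      then have "(\<Sum>i\<le>k. (x i)\<^sup>2) = 0" using \<rho> by simp
      then have "x i = 0" if "i \<le> k" for i using that by (simp add: sum_nonneg_eq_0_iff)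
      then have "x = m (1, sphere_base)" using x(1) by (auto simp: m_def fun_eq_iff) (metis not_le)
      then show ?thesis using b unfolding topD by (intro image_eqI[of _ _ "(1, sphere_base)"]) auto
    next
      case False
      have "(\<Sum>i\<le>k. (x i / \<rho>)\<^sup>2) = 1"
        using False by (simp add: power_divide flip: sum_divide_distrib \<rho>(3))
      then have "(\<lambda>i. x i / \<rho>) \<in> topspace ?S" using x(1) by (simp add: topspace_nsphere)
      moreover have "x = m (1 - \<rho>, \<lambda>i. x i / \<rho>)" using False by (auto simp: m_def)
      ultimately show ?thesis unfolding topD using \<rho>
        by (intro image_eqI[of _ _ "(1 - \<rho>, \<lambda>i. x i / \<rho>)"]) auto
    qed
  qed
  define G where "G = (\<lambda>p. F (\<lambda>i. (1 - fst p) * snd p i + fst p * sphere_base i))"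
  have "continuous_map ?P D (\<lambda>p i. (1 - fst p) * snd p i + fst p * sphere_base i)"
    unfolding D_def
  proof (rule continuous_map_into_subtopology)
    show "continuous_map ?P (powertop_real UNIV) (\<lambda>p i. (1 - fst p) * snd p i + fst p * sphere_base i)"
      unfolding continuous_map_componentwise_UNIV
      by (intro allI continuous_map_add continuous_map_real_mult continuous_map_diff coord) auto
    have "(\<lambda>i. (1 - t) * s i + t * sphere_base i) \<in> topspace D"
      if t: "t \<in> {0..1}" and s: "s \<in> topspace ?S" for t s
    proof (rule inD)
      show "(1 - t) * s i + t * sphere_base i = 0" if "i > k" for i
        using s b that by (simp add: topspace_nsphere)
      have "((1 - t) * s i + t * sphere_base i)\<^sup>2 \<le> (1 - t) * (s i)\<^sup>2 + t * (sphere_base i)\<^sup>2" for i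
      proof -
        have "(1 - t) * (s i)\<^sup>2 + t * (sphere_base i)\<^sup>2 - ((1 - t) * s i + t * sphere_base i)\<^sup>2 =
            t * (1 - t) * (s i - sphere_base i)\<^sup>2"
          by (simp add: power2_eq_square algebra_simps)
        also have "\<dots> \<ge> 0" using t by simp
        finally show ?thesis by linarith
      qed
      then have "(\<Sum>i\<le>k. ((1 - t) * s i + t * sphere_base i)\<^sup>2) \<le>
          (\<Sum>i\<le>k. (1 - t) * (s i)\<^sup>2 + t * (sphere_base i)\<^sup>2)"
        by (intro sum_mono)
      also have "\<dots> = 1"
        using s b by (simp add: sum.distrib topspace_nsphere flip: sum_distrib_left)
      finally show "(\<Sum>i\<le>k. ((1 - t) * s i + t * sphere_base i)\<^sup>2) \<le> 1" .
    qed
    then show "(\<lambda>p i. (1 - fst p) * snd p i + fst p * sphere_base i) \<in> topspace ?P \<rightarrow> m ` topspace ?P"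
      unfolding topD by auto
  qed
  then have G: "continuous_map ?P Z G"
    unfolding G_def by (rule continuous_map_compose'[OF F(1)])
  have Fs: "F s = f s" if "s \<in> topspace ?S" for s
  proof -
    have "m (0, s) = s" by (simp add: m_def)
    then show ?thesis using F(2)[of "(0, s)"] h(2)[OF that] that by simp
  qed
  have Fb: "F (\<lambda>i. (1 - t) * sphere_base i + t * sphere_base i) = z" for t
  proof -
    have "(\<lambda>i. (1 - t) * sphere_base i + t * sphere_base i) = sphere_base"
      by (auto simp: algebra_simps)
    then show ?thesis using Fs[OF b] z by simp
  qed
  show ?thesis
  proof (subst homotopic_with)
    show "\<exists>h. continuous_map ?P Z h \<and> (\<forall>x\<in>topspace ?S. h (0, x) = f x) \<and> (\<forall>x\<in>topspace ?S. h (1, x) = z) \<and>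
        (\<forall>t\<in>{0..1}. h (t, sphere_base) = z)"
      using G Fs Fs[OF b] z Fb by (intro exI[of _ G]) (auto simp: G_def)
  qed (use b in auto)
qed

section \<open>Integrals, and densities split into finitely many summands\<close>

lemma integ_add: "integ \<mu> (\<lambda>x. g x + h x) = integ \<mu> g + integ \<mu> h"
  by (simp add: integ_def algebra_simps sum.distrib)

lemma integ_mult_left: "integ \<mu> (\<lambda>x. c * g x) = c * integ \<mu> g"
  by (simp add: integ_def algebra_simps sum_distrib_left)

lemma integ_sum: "integ \<mu> (\<lambda>x. \<Sum>v\<in>I. g v x) = (\<Sum>v\<in>I. integ \<mu> (g v))"
  unfolding integ_def by (subst sum.swap) (simp add: sum_distrib_left)

lemma integ_const: "\<mu> \<in> barycenters n Z \<Longrightarrow> integ \<mu> (\<lambda>_. c) = c"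
  by (simp add: integ_def barycenters_def flip: sum_distrib_right)

lemma integ_nonneg:
  "\<mu> \<in> barycenters n Z \<Longrightarrow> (\<And>x. x \<in> topspace Z \<Longrightarrow> 0 \<le> g x) \<Longrightarrow> 0 \<le> integ \<mu> g"
  unfolding integ_def barycenters_def by (intro sum_nonneg mult_nonneg_nonneg) auto

lemma integ_pos:
  assumes \<mu>: "\<mu> \<in> barycenters n Z" and g: "\<And>x. x \<in> topspace Z \<Longrightarrow> 0 \<le> g x"
    and x: "x \<in> Poly_Mapping.keys \<mu>" "0 < g x"
  shows "0 < integ \<mu> g"
  unfolding integ_def
proof (rule sum_pos2[OF _ x(1)])
  have "0 < Poly_Mapping.lookup \<mu> x"
    using \<mu> x(1) by (auto simp: barycenters_def in_keys_iff less_le)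
  then show "0 < Poly_Mapping.lookup \<mu> x * g x" using x(2) by simp
  show "0 \<le> Poly_Mapping.lookup \<mu> y * g y" if "y \<in> Poly_Mapping.keys \<mu>" for y
    using \<mu> g that by (auto simp: barycenters_def)
qed auto

lemma single_sum_right:
  fixes a :: "'x \<Rightarrow> real"
  shows "Poly_Mapping.single p (\<Sum>x\<in>A. a x) = (\<Sum>x\<in>A. Poly_Mapping.single p (a x))"
  by (induction A rule: infinite_finite_induct) (auto simp: single_add)

text \<open>The mass with density \<open>g v\<close> sits on points that \<open>\<phi>\<close> sends
  to the single point \<open>p v\<close>.\<close>

lemma transport_eq_sum_single:
  assumes "\<And>v x. v \<in> I \<Longrightarrow> x \<in> Poly_Mapping.keys \<mu> \<Longrightarrow> g v x \<noteq> 0 \<Longrightarrow> \<phi> x = p v"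
  shows "transport \<mu> (\<lambda>x. \<Sum>v\<in>I. g v x) \<phi> = (\<Sum>v\<in>I. Poly_Mapping.single (p v) (integ \<mu> (g v)))"
proof -
  have "transport \<mu> (\<lambda>x. \<Sum>v\<in>I. g v x) \<phi> =
      (\<Sum>x\<in>Poly_Mapping.keys \<mu>. \<Sum>v\<in>I. Poly_Mapping.single (\<phi> x) (Poly_Mapping.lookup \<mu> x * g v x))"
    unfolding transport_def by (simp add: sum_distrib_left single_sum_right)
  also have "\<dots> = (\<Sum>v\<in>I. \<Sum>x\<in>Poly_Mapping.keys \<mu>. Poly_Mapping.single (\<phi> x) (Poly_Mapping.lookup \<mu> x * g v x))"
    by (rule sum.swap)
  also have "\<dots> = (\<Sum>v\<in>I. \<Sum>x\<in>Poly_Mapping.keys \<mu>. Poly_Mapping.single (p v) (Poly_Mapping.lookup \<mu> x * g v x))"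
  proof (intro sum.cong refl)
    fix v x assume "v \<in> I" "x \<in> Poly_Mapping.keys \<mu>"
    then show "Poly_Mapping.single (\<phi> x) (Poly_Mapping.lookup \<mu> x * g v x) =
        Poly_Mapping.single (p v) (Poly_Mapping.lookup \<mu> x * g v x)"
      using assms[of v x] by (cases "g v x = 0") auto
  qed
  finally show ?thesis
    by (simp add: integ_def single_sum_right)
qed

text \<open>The homotopy \<open>H\<close> pushes \<open>f s\<close> forward along the collapse at
  time \<open>\<tau>\<close>, while its density moves linearly from 1 to \<open>\<theta> s\<close>
  and is normalised. At \<open>\<tau> = 1\<close> mass remains only on sets \<open>V v\<close> that
  are completely collapsed, so the measure is a combination of the points \<open>p v s\<close>, with
  at most one active \<open>v\<close> of each colour.\<close>

lemma barycenter_space_null_homotopic: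
  assumes K: "compact_space K" "Hausdorff_space K" and lc: "locally_contractible_space K"
    and n: "k + 2 \<le> n" and f: "continuous_map (nsphere k) (barycenter_space n K) f"
  shows "\<exists>c. homotopic_with (\<lambda>_. True) (nsphere k) (barycenter_space n K) f (\<lambda>_. c)"
proof -
  let ?S = "nsphere k" and ?B = "barycenter_space n K"
  have n1: "n \<ge> 1" using n by simp
  have fB: "f s \<in> barycenters n K" if "s \<in> topspace ?S" for s
    using continuous_map_image_subset_topspace[OF f] that by (auto simp: topspace_barycenter_space[OF n1])
  have keysK: "Poly_Mapping.keys (f s) \<subseteq> topspace K" if "s \<in> topspace ?S" for s
    using fB[OF that] by (simp add: barycenters_def)
  obtain \<O> where O: "\<And>V. V \<in> \<O> \<Longrightarrow> openin K V" "topspace K \<subseteq> \<Union>\<O>"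
    and collapse: "\<And>I :: (nat \<Rightarrow> int) set. \<And>V c col.
       \<lbrakk>coloured_family ?S I c col (Suc k); \<And>v. v \<in> I \<Longrightarrow> V v \<in> \<O>; \<And>v s. v \<in> I \<Longrightarrow> s \<in> topspace ?S \<Longrightarrow> c v s \<le> 1\<rbrakk> \<Longrightarrow>
       \<exists>\<phi>. continuous_map (prod_topology (prod_topology ?S unit_interval) K) K \<phi> \<and>
          (\<forall>s\<in>topspace ?S. \<forall>x\<in>topspace K. \<phi> ((s, 0), x) = x) \<and>
          (\<forall>s\<in>topspace ?S. \<forall>v\<in>I. c v s = 1 \<longrightarrow> (\<exists>p. \<forall>x\<in>V v. \<phi> ((s, 1), x) = p))"
    by (rule multi_collapse[OF K lc, where S = ?S and b = "Suc k" and ?'i = "nat \<Rightarrow> int"]) blast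
  \<comment> \<open>\<open>\<psi>\<close> is a continuous substitute for the indicator function of
    \<open>V\<close>: its integral depends continuously on the measure, which the mass of a set does
    not do in general.\<close>
  define good where "good \<psi> V \<longleftrightarrow> continuous_map K euclideanreal \<psi> \<and> (\<forall>x\<in>topspace K. 0 \<le> \<psi> x) \<and> V \<in> \<O> \<and>
      (\<forall>x\<in>topspace K. 0 < \<psi> x \<longrightarrow> x \<in> V)" for \<psi> V
  define \<C> where "\<C> = {{s \<in> topspace ?S. integ (f s) \<psi> \<in> {0<..}} | \<psi> V. good \<psi> V}"
  obtain I :: "(nat \<Rightarrow> int) set" and t col where fam: "coloured_family ?S I t col (Suc k)"
    and sub: "\<And>v. v \<in> I \<Longrightarrow> \<exists>C\<in>\<C>. \<forall>s\<in>topspace ?S. 0 < t v s \<longrightarrow> s \<in> C"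
    and ex: "\<And>s. s \<in> topspace ?S \<Longrightarrow> \<exists>v\<in>I. 0 < t v s"
  proof (rule nsphere_coloured_family[of \<C> k])
    show "openin ?S C" if C\<C>: "C \<in> \<C>" for C
    proof -
      obtain \<psi> V where \<psi>: "good \<psi> V" and C: "C = {s \<in> topspace ?S. integ (f s) \<psi> \<in> {0<..}}"
        using C\<C> unfolding \<C>_def by blast
      have "continuous_map ?S euclideanreal (\<lambda>s. integ (f s) \<psi>)"
        by (rule continuous_map_compose'[OF continuous_map_integ[OF n1] f]) (use \<psi> in \<open>simp add: good_def\<close>)
      then show ?thesis unfolding C by (rule openin_continuous_map_preimage) auto
    qed
    show "topspace ?S \<subseteq> \<Union>\<C>"
    proof
      fix s assume s: "s \<in> topspace ?S"
      have "Poly_Mapping.keys (f s) \<noteq> {}" using fB[OF s] by (auto simp: barycenters_def)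
      then obtain x where x: "x \<in> Poly_Mapping.keys (f s)" by blast
      then have xK: "x \<in> topspace K" using keysK[OF s] by blast
      then obtain V where V: "V \<in> \<O>" "x \<in> V" using O by blast
      have "normal_space K" using K compact_Hausdorff_or_regular_imp_normal_space by blast
      moreover have "closedin K (topspace K - V)" using O(1)[OF V(1)] by auto
      moreover have "closedin K {x}" by (rule closedin_Hausdorff_singleton[OF K(2) xK])
      moreover have "disjnt (topspace K - V) {x}" using V by (auto simp: disjnt_iff)
      ultimately obtain \<psi> where \<psi>: "continuous_map K (top_of_set {0..1::real}) \<psi>"
        "\<psi> ` (topspace K - V) \<subseteq> {0}" "\<psi> ` {x} \<subseteq> {1}"
        by (rule Urysohn_lemma[where a = 0 and b = 1]) auto
      have nn: "0 \<le> \<psi> y" if "y \<in> topspace K" for y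
        using \<psi>(1) that by (force simp: continuous_map_in_subtopology)
      have "y \<in> V" if "y \<in> topspace K" "0 < \<psi> y" for y
        using \<psi>(2) that by (fastforce simp: image_subset_iff)
      then have "good \<psi> V"
        using \<psi>(1) nn V(1) continuous_map_into_fulltopology by (auto simp: good_def)
      moreover have "0 < integ (f s) \<psi>"
        by (rule integ_pos[OF fB[OF s] nn x]) (use \<psi>(3) in auto)
      ultimately show "s \<in> \<Union>\<C>" using s unfolding \<C>_def by auto
    qed
  qed blast
  have I: "finite I" and tc: "\<And>v. v \<in> I \<Longrightarrow> continuous_map ?S euclideanreal (t v)"
    and col: "\<And>v. v \<in> I \<Longrightarrow> col v < Suc k"
    and t0: "\<And>v s. v \<in> I \<Longrightarrow> s \<in> topspace ?S \<Longrightarrow> 0 \<le> t v s"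
    and inj: "\<And>v w s. s \<in> topspace ?S \<Longrightarrow> v \<in> I \<Longrightarrow> w \<in> I \<Longrightarrow> 0 < t v s \<Longrightarrow> 0 < t w s \<Longrightarrow> col v = col w \<Longrightarrow> v = w"
    using fam unfolding coloured_family_def by blast+
  have "\<exists>\<psi> V. good \<psi> V \<and> (\<forall>s\<in>topspace ?S. 0 < t v s \<longrightarrow> 0 < integ (f s) \<psi>)" if "v \<in> I" for v
    using sub[OF that] unfolding \<C>_def by auto
  then obtain \<psi> V where \<psi>V: "\<And>v. v \<in> I \<Longrightarrow> good (\<psi> v) (V v)"
    and int_pos: "\<And>v s. v \<in> I \<Longrightarrow> s \<in> topspace ?S \<Longrightarrow> 0 < t v s \<Longrightarrow> 0 < integ (f s) (\<psi> v)"
    by metis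
  have \<psi>c: "continuous_map K euclideanreal (\<psi> v)" and \<psi>0: "\<And>x. x \<in> topspace K \<Longrightarrow> 0 \<le> \<psi> v x"
    and VO: "V v \<in> \<O>" and \<psi>V': "\<And>x. x \<in> topspace K \<Longrightarrow> 0 < \<psi> v x \<Longrightarrow> x \<in> V v" if "v \<in> I" for v
    using \<psi>V[OF that] by (auto simp: good_def)
  obtain s0 where "s0 \<in> topspace ?S" using in_topspace_nsphere by blast
  then have "I \<noteq> {}" using ex by blast
  obtain x0 where x0: "x0 \<in> topspace K"
    using keysK[OF \<open>s0 \<in> topspace ?S\<close>] fB[OF \<open>s0 \<in> topspace ?S\<close>] by (fastforce simp: barycenters_def)
  define M where "M s = Max ((\<lambda>v. t v s) ` I)" for s
  have Mc: "continuous_map ?S euclideanreal M"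
    unfolding M_def by (rule continuous_map_Max[OF I \<open>I \<noteq> {}\<close> tc])
  have M_ge: "t v s \<le> M s" if "v \<in> I" for v s
    unfolding M_def using I that by (intro Max_ge) auto
  have M_pos: "0 < M s" if "s \<in> topspace ?S" for s
    using ex[OF that] M_ge by (meson less_le_trans)
  have M_eq: "\<exists>v\<in>I. t v s = M s" for s
  proof -
    have "M s \<in> (\<lambda>v. t v s) ` I" unfolding M_def using I \<open>I \<noteq> {}\<close> by (intro Max_in) auto
    then show ?thesis by auto
  qed
  \<comment> \<open>Two cut-offs of the same \<open>t v\<close>. Where \<open>t' v\<close> is
    positive, \<open>t v\<close> exceeds half the maximum \<open>M\<close> and \<open>c v\<close> is
    1, so weight goes only to sets that are completely collapsed. An index that attains the maximum
    always keeps positive weight. Since \<open>c v\<close> is positive only where \<open>t v\<close>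
    is, the colouring remains valid.\<close>
  define t' where "t' v s = max 0 (t v s - M s / 2)" for v s
  define c where "c v s = min 1 (2 * t v s / M s)" for v s
  have t'c: "continuous_map ?S euclideanreal (t' v)" if "v \<in> I" for v
    unfolding t'_def using that M_pos
    by (intro continuous_map_real_max continuous_map_diff continuous_map_real_divide tc Mc) auto
  have cc: "continuous_map ?S euclideanreal (c v)" if "v \<in> I" for v
    unfolding c_def using that M_pos
    by (intro continuous_map_real_min continuous_map_real_mult continuous_map_real_divide tc Mc) force+
  have c_pos: "0 < t v s" if "s \<in> topspace ?S" "0 < c v s" for v s
    using that M_pos[OF that(1)] by (auto simp: c_def zero_less_divide_iff zero_less_mult_iff)
  have t'_nonneg: "0 \<le> t' v s" for v s by (simp add: t'_def)
  have t'_c: "c v s = 1" "0 < t v s" if "s \<in> topspace ?S" "t' v s \<noteq> 0" for v s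
  proof -
    have *: "M s / 2 < t v s" using that(2) by (auto simp: t'_def max_def split: if_splits)
    then show "0 < t v s" using M_pos[OF that(1)] by linarith
    show "c v s = 1" using * M_pos[OF that(1)] by (auto simp: c_def min_def field_simps)
  qed
  have "coloured_family ?S I c col (Suc k)"
    unfolding coloured_family_def
  proof (intro conjI ballI impI)
    fix s v assume s: "s \<in> topspace ?S" and v: "v \<in> I"
    show "0 \<le> c v s" using t0[OF v s] M_pos[OF s] by (simp add: c_def)
    show "v = w" if "w \<in> I" "0 < c v s" "0 < c w s" "col v = col w" for w
      using inj[OF s v that(1)] c_pos[OF s] that by blast
  qed (use I cc col in auto)
  moreover have "c v s \<le> 1" for v s by (simp add: c_def)
  ultimately have "\<exists>\<phi>. continuous_map (prod_topology (prod_topology ?S unit_interval) K) K \<phi> \<and>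
      (\<forall>s\<in>topspace ?S. \<forall>x\<in>topspace K. \<phi> ((s, 0), x) = x) \<and>
      (\<forall>s\<in>topspace ?S. \<forall>v\<in>I. c v s = 1 \<longrightarrow> (\<exists>p. \<forall>x\<in>V v. \<phi> ((s, 1), x) = p))"
    by (intro collapse[of I c col V] VO)
  then obtain \<phi> where \<phi>: "continuous_map (prod_topology (prod_topology ?S unit_interval) K) K \<phi>"
    and \<phi>id': "\<forall>s\<in>topspace ?S. \<forall>x\<in>topspace K. \<phi> ((s, 0), x) = x"
    and \<phi>1': "\<forall>s\<in>topspace ?S. \<forall>v\<in>I. c v s = 1 \<longrightarrow> (\<exists>p. \<forall>x\<in>V v. \<phi> ((s, 1), x) = p)"
    by (elim exE conjE)
  note \<phi>id = \<phi>id'[rule_format] and \<phi>1 = \<phi>1'[rule_format]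
  define \<theta> where "\<theta> s x = (\<Sum>v\<in>I. t' v s * \<psi> v x)" for s x
  define w where "w v s = t' v s * integ (f s) (\<psi> v)" for v s
  have \<theta>w: "integ (f s) (\<theta> s) = (\<Sum>v\<in>I. w v s)" for s
    unfolding \<theta>_def w_def by (simp add: integ_sum integ_mult_left)
  have w_nonneg: "0 \<le> w v s" if "v \<in> I" "s \<in> topspace ?S" for v s
    unfolding w_def using t'_nonneg integ_nonneg[OF fB[OF that(2)] \<psi>0[OF that(1)]] by simp
  have w_sum: "0 < (\<Sum>v\<in>I. w v s)" if s: "s \<in> topspace ?S" for s
  proof -
    obtain v where v: "v \<in> I" "t v s = M s" using M_eq by blast
    have "0 < t' v s" using v M_pos[OF s] by (simp add: t'_def)
    moreover have "0 < integ (f s) (\<psi> v)" using int_pos[OF v(1) s] v M_pos[OF s] by simp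
    ultimately have "0 < w v s" by (simp add: w_def)
    then show ?thesis using I v w_nonneg s by (intro sum_pos2[of I v]) auto
  qed
  define W where "W s = (\<Sum>v\<in>I. w v s)" for s
  have wc: "continuous_map ?S euclideanreal (w v)" if "v \<in> I" for v
    unfolding w_def
    by (intro continuous_map_real_mult t'c that continuous_map_compose'[OF continuous_map_integ[OF n1 \<psi>c] f])
  have Wc: "continuous_map ?S euclideanreal W"
    unfolding W_def by (intro continuous_map_sum wc I)
  let ?P = "prod_topology ?S unit_interval"
  have compP: "compact_space ?P"
    by (simp add: compact_space_prod_topology compact_space_nsphere compact_space_subtopology compactin_euclidean_iff)
  have HausP: "Hausdorff_space ?P"
    by (simp add: Hausdorff_space_prod_topology Hausdorff_space_nsphere Hausdorff_space_subtopology)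
  \<comment> \<open>The density at time \<open>\<tau>\<close>. Its total mass
    \<open>(1 - \<tau>) + \<tau> * W s\<close> is positive because \<open>W s\<close> is.\<close>
  define a where "a = (\<lambda>q. (1 - snd (fst q)) + snd (fst q) * \<theta> (fst (fst q)) (snd q))"
    for q :: "((nat \<Rightarrow> real) \<times> real) \<times> 'a"
  have sndP: "continuous_map ?P euclideanreal snd"
    using continuous_map_snd continuous_map_into_fulltopology by blast
  have tauc: "continuous_map (prod_topology ?P K) euclideanreal (\<lambda>q. snd (fst q))"
    by (rule continuous_map_compose'[OF sndP continuous_map_fst])
  have sc: "continuous_map (prod_topology ?P K) ?S (\<lambda>q. fst (fst q))"
    by (rule continuous_map_compose'[OF continuous_map_fst continuous_map_fst])
  have ac: "continuous_map (prod_topology ?P K) euclideanreal a"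
    unfolding a_def \<theta>_def
    by (intro continuous_map_add continuous_map_diff continuous_map_real_mult tauc continuous_map_sum I
        continuous_map_compose'[OF t'c sc] continuous_map_compose'[OF \<psi>c continuous_map_snd]) auto
  have \<theta>0: "0 \<le> \<theta> s x" if "x \<in> topspace K" for s x
    unfolding \<theta>_def using t'_nonneg \<psi>0 that by (intro sum_nonneg mult_nonneg_nonneg) auto
  have a_int: "integ (f s) (\<lambda>x. a ((s, \<tau>), x)) = (1 - \<tau>) + \<tau> * W s" if "s \<in> topspace ?S" for s \<tau>
    unfolding a_def using \<theta>w[of s] by (simp add: integ_add integ_mult_left integ_const[OF fB[OF that]] W_def)
  have a_pos: "0 < (1 - \<tau>) + \<tau> * W s" if "s \<in> topspace ?S" "\<tau> \<in> {0..1}" for s \<tau>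
  proof (cases "\<tau> = 0")
    case False
    then have "0 < \<tau> * W s" using w_sum[OF that(1)] that(2) by (simp add: W_def)
    then show ?thesis using that(2) by simp
  qed simp
  define H where "H = (\<lambda>q. transport (f (fst q)) (\<lambda>x. a (q, x) / integ (f (fst q)) (\<lambda>x. a (q, x))) (\<lambda>x. \<phi> (q, x)))"
  have Hc: "continuous_map ?P ?B H"
    unfolding H_def
  proof (rule continuous_map_transport[OF n1 compP HausP _ \<phi> ac])
    show "continuous_map ?P ?B (\<lambda>q. f (fst q))"
      by (rule continuous_map_compose'[OF f continuous_map_fst])
    show "0 \<le> a (q, x)" if "q \<in> topspace ?P" "x \<in> topspace K" for q x
      using that \<theta>0 by (auto simp: a_def)
    show "0 < integ (f (fst q)) (\<lambda>x. a (q, x))" if "q \<in> topspace ?P" for q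
      using that a_int[of "fst q" "snd q"] a_pos[of "fst q" "snd q"] by auto
  qed
  \<comment> \<open>The point to which \<open>V v\<close> collapses is only known to exist for each
    \<open>s\<close> separately. The image of a fixed \<open>o' v\<close> in \<open>V v\<close>
    gives it as a continuous function of \<open>s\<close>; where \<open>V v\<close> is not collapsed
    completely, this image has weight 0. The default \<open>x0\<close> serves an empty
    \<open>V v\<close>.\<close>
  define o' where "o' v = (if V v \<inter> topspace K = {} then x0 else SOME x. x \<in> V v \<inter> topspace K)" for v
  have o'K: "o' v \<in> topspace K" for v
    unfolding o'_def using x0 some_in_eq[of "V v \<inter> topspace K"] by auto
  have o'V: "o' v \<in> V v" if "x \<in> V v" "x \<in> topspace K" for v x
    unfolding o'_def using that some_in_eq[of "V v \<inter> topspace K"] by auto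
  define p where "p v s = \<phi> ((s, 1), o' v)" for v s
  have pc: "continuous_map ?S K (p v)" for v
    unfolding p_def using o'K by (intro continuous_map_compose'[OF \<phi>] continuous_map_pairedI) auto
  define g where "g s = (\<Sum>v\<in>I. Poly_Mapping.single (p v s) (w v s / W s))" for s
  have H0: "H (s, 0) = f s" if s: "s \<in> topspace ?S" for s
  proof -
    have "H (s, 0) = transport (f s) (\<lambda>_. 1) (\<lambda>x. \<phi> ((s, 0), x))"
      using a_int[OF s, of 0] by (simp add: H_def a_def)
    also have "\<dots> = transport (f s) (\<lambda>_. 1) (\<lambda>x. x)"
      unfolding transport_def using keysK[OF s] \<phi>id[OF s] by (intro sum.cong) auto
    finally show ?thesis by (simp add: transport_id)
  qed
  have H1: "H (s, 1) = g s" if s: "s \<in> topspace ?S" for s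
  proof -
    have "H (s, 1) = transport (f s) (\<lambda>x. \<Sum>v\<in>I. t' v s / W s * \<psi> v x) (\<lambda>x. \<phi> ((s, 1), x))"
      using a_int[OF s, of 1] by (simp add: H_def a_def \<theta>_def sum_divide_distrib)
    also have "\<dots> = (\<Sum>v\<in>I. Poly_Mapping.single (p v s) (integ (f s) (\<lambda>x. t' v s / W s * \<psi> v x)))"
    proof (rule transport_eq_sum_single)
      fix v x assume v: "v \<in> I" and x: "x \<in> Poly_Mapping.keys (f s)" and nz: "t' v s / W s * \<psi> v x \<noteq> 0"
      then have "c v s = 1" using t'_c[OF s, of v] by auto
      then obtain q where q: "\<forall>x\<in>V v. \<phi> ((s, 1), x) = q" using \<phi>1[OF s v] by blast
      have xK: "x \<in> topspace K" using x keysK[OF s] by blast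
      then have "x \<in> V v" using \<psi>V'[OF v xK] \<psi>0[OF v xK] nz by auto
      then show "\<phi> ((s, 1), x) = p v s" using q o'V[OF _ xK] by (simp add: p_def)
    qed
    also have "\<dots> = g s"
      unfolding g_def integ_mult_left by (simp add: w_def)
    finally show ?thesis .
  qed
  have hom1: "homotopic_with (\<lambda>_. True) ?S ?B f g"
    by (rule homotopic_withI_right[OF Hc H0 H1])
  \<comment> \<open>The linear cone over \<open>g\<close>, with \<open>None\<close> as the index of
    the apex \<open>x0\<close>.\<close>
  define J where "J = insert None (Some ` I)"
  define q where "q u = (\<lambda>y :: (nat \<Rightarrow> real) \<times> real. case u of None \<Rightarrow> x0 | Some v \<Rightarrow> p v (fst y))" for u
  define b where "b u = (\<lambda>y :: (nat \<Rightarrow> real) \<times> real. case u of None \<Rightarrow> snd y | Some v \<Rightarrow> (1 - snd y) * (w v (fst y) / W (fst y)))"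
    for u
  have sumJ: "(\<Sum>u\<in>J. F u) = F None + (\<Sum>v\<in>I. F (Some v))" for F :: "(nat \<Rightarrow> int) option \<Rightarrow> 'z::comm_monoid_add"
    unfolding J_def using I by (subst sum.insert) (auto simp: sum.reindex)
  have G: "continuous_map ?P ?B (\<lambda>y. \<Sum>u\<in>J. Poly_Mapping.single (q u y) (b u y))"
  proof (rule continuous_map_into_barycenter_space_family[OF n1])
    show "finite J" using I by (simp add: J_def)
    show "continuous_map ?P K (q u)" for u
      unfolding q_def using x0
      by (cases u) (auto intro: continuous_map_compose'[OF pc continuous_map_fst])
    show "continuous_map ?P euclideanreal (b u)" if "u \<in> J" for u
    proof (cases u)
      case None
      then show ?thesis using sndP by (simp add: b_def)
    next
      case (Some v)
      then have v: "v \<in> I" using that by (auto simp: J_def)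
      have "W (fst y) \<noteq> 0" if "y \<in> topspace ?P" for y
        using w_sum[of "fst y"] that by (auto simp: W_def)
      then show ?thesis
        unfolding b_def Some option.case
        by (intro continuous_map_real_mult continuous_map_diff continuous_map_real_divide sndP
            continuous_map_compose'[OF wc[OF v] continuous_map_fst] continuous_map_compose'[OF Wc continuous_map_fst]) auto
    qed
    fix y assume y: "y \<in> topspace ?P"
    then obtain s \<tau> where [simp]: "y = (s, \<tau>)" and s: "s \<in> topspace ?S" and \<tau>: "\<tau> \<in> {0..1}" by (cases y) auto
    have Ws: "0 < W s" using w_sum[OF s] by (simp add: W_def)
    show "0 \<le> b u y" if "u \<in> J" for u
      using that w_nonneg s \<tau> Ws by (auto simp: b_def J_def split: option.splits)
    show "(\<Sum>u\<in>J. b u y) = 1"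
    proof -
      have "(\<Sum>v\<in>I. (1 - \<tau>) * (w v s / W s)) = (1 - \<tau>) * (W s / W s)"
        unfolding W_def by (simp only: sum_distrib_left sum_divide_distrib)
      then show ?thesis using Ws by (simp add: sumJ b_def)
    qed
    show "card {u \<in> J. b u y \<noteq> 0} \<le> n"
    proof -
      \<comment> \<open>Colours are injective on the indices active at \<open>s\<close>, which
        leaves at most \<open>k + 1\<close> points besides the apex.\<close>
      let ?A = "{v \<in> I. 0 < t v s}"
      have "{u \<in> J. b u y \<noteq> 0} \<subseteq> insert None (Some ` ?A)"
        using t'_c(2)[OF s] by (auto simp: J_def b_def w_def)
      then have "card {u \<in> J. b u y \<noteq> 0} \<le> card (insert None (Some ` ?A))"
        by (rule card_mono[rotated]) (use I in auto)
      also have "\<dots> \<le> Suc (card ?A)"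
        using I by (simp add: card_insert_if card_image)
      also have "card ?A \<le> card {..<Suc k}"
        by (rule card_inj_on_le[of col]) (use inj[OF s] col in \<open>auto simp: inj_on_def\<close>)
      finally show ?thesis using n by simp
    qed
  qed
  have hom2: "homotopic_with (\<lambda>_. True) ?S ?B g (\<lambda>_. Poly_Mapping.single x0 1)"
    by (rule homotopic_withI_right[OF G]) (auto simp: sumJ q_def b_def g_def)
  show ?thesis
    using homotopic_with_trans[OF hom1 hom2] by blast
qed

section \<open>Finite subcomplexes\<close>

text \<open>Tube lemma: projection along the compact interval is a closed map, here applied to the
  preimage of the complement of \<open>U\<close>.\<close>

lemma openin_all_unit_interval:
  assumes r: "continuous_map (prod_topology Y unit_interval) Z r" and U: "openin Z U"
  shows "openin Y {y \<in> topspace Y. \<forall>t\<in>{0..1}. r (y, t) \<in> U}"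
proof -
  let ?P = "prod_topology Y unit_interval"
  let ?C = "{p \<in> topspace ?P. r p \<in> topspace Z - U}"
  have rZ: "p \<in> topspace ?P \<Longrightarrow> r p \<in> topspace Z" for p
    using continuous_map_image_subset_topspace[OF r] by blast
  have "closedin ?P ?C"
    using U by (intro closedin_continuous_map_preimage[OF r]) auto
  moreover have "closed_map ?P Y fst"
    by (rule closed_map_fst) (simp add: compact_space_subtopology)
  ultimately have "closedin Y (fst ` ?C)" unfolding closed_map_def by blast
  moreover have "{y \<in> topspace Y. \<forall>t\<in>{0..1}. r (y, t) \<in> U} = topspace Y - fst ` ?C"
    using rZ by (force simp: image_iff)
  ultimately show ?thesis by (simp add: openin_diff)
qed

section \<open>Closed and open discs\<close>

lemma topspace_closed_disc: "x \<in> topspace (closed_disc k) \<longleftrightarrow> (\<forall>i\<ge>k. x i = 0) \<and> (\<Sum>i<k. (x i)\<^sup>2) \<le> 1"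
  by (auto simp: closed_disc_def topspace_Euclidean_space)

lemma topspace_open_disc: "x \<in> topspace (open_disc k) \<longleftrightarrow> (\<forall>i\<ge>k. x i = 0) \<and> (\<Sum>i<k. (x i)\<^sup>2) < 1"
  by (auto simp: open_disc_def topspace_Euclidean_space)

lemma closed_disc_eq: "closed_disc k = subtopology (powertop_real UNIV) (topspace (closed_disc k))"
  by (simp add: closed_disc_def Euclidean_space_def subtopology_subtopology)

lemma open_disc_eq: "open_disc k = subtopology (powertop_real UNIV) (topspace (open_disc k))"
  by (simp add: open_disc_def Euclidean_space_def subtopology_subtopology)

lemma continuous_map_into_closed_disc:
  assumes "\<And>i. i < k \<Longrightarrow> continuous_map X euclideanreal (\<lambda>x. f x i)"
    and "\<And>x. x \<in> topspace X \<Longrightarrow> f x \<in> topspace (closed_disc k)"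
  shows "continuous_map X (closed_disc k) f"
proof -
  have "continuous_map X euclideanreal (\<lambda>x. f x i)" for i
  proof (cases "i < k")
    case False
    then have "continuous_map X euclideanreal (\<lambda>x. 0)" "\<And>x. x \<in> topspace X \<Longrightarrow> 0 = f x i"
      using assms(2) by (auto simp: topspace_closed_disc)
    then show ?thesis by (rule continuous_map_eq)
  qed (use assms in auto)
  then show ?thesis
    using assms(2) by (subst closed_disc_eq) (auto simp: continuous_map_in_subtopology continuous_map_componentwise_UNIV)
qed

lemma continuous_map_into_open_disc:
  assumes "\<And>i. continuous_map X euclideanreal (\<lambda>x. f x i)"
    and "\<And>x. x \<in> topspace X \<Longrightarrow> f x \<in> topspace (open_disc k)"
  shows "continuous_map X (open_disc k) f"
  using assms by (subst open_disc_eq) (auto simp: continuous_map_in_subtopology continuous_map_componentwise_UNIV)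

lemma continuous_map_closed_disc_projection: "continuous_map (closed_disc k) euclideanreal (\<lambda>x. x i)"
  by (subst closed_disc_eq) (intro continuous_map_from_subtopology continuous_map_product_projection, simp)

lemma continuous_map_open_disc_projection: "continuous_map (open_disc k) euclideanreal (\<lambda>x. x i)"
  by (subst open_disc_eq) (intro continuous_map_from_subtopology continuous_map_product_projection, simp)

lemma compact_space_closed_disc: "compact_space (closed_disc k)"
proof -
  have "topspace (closed_disc k) \<subseteq> (UNIV \<rightarrow>\<^sub>E {-1..1})"
  proof
    fix s assume s: "s \<in> topspace (closed_disc k)"
    have "(s i)\<^sup>2 \<le> 1" for i
    proof (cases "i < k")
      case True
      then have "(s i)\<^sup>2 \<le> (\<Sum>i<k. (s i)\<^sup>2)" by (intro member_le_sum) auto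
      then show ?thesis using s by (simp add: topspace_closed_disc)
    qed (use s in \<open>simp add: topspace_closed_disc\<close>)
    then show "s \<in> (UNIV \<rightarrow>\<^sub>E {-1..1})" by (auto simp: abs_square_le_1 abs_le_iff)
  qed
  moreover have "compactin (powertop_real UNIV) (UNIV \<rightarrow>\<^sub>E {-1..1})"
    by (simp add: compactin_PiE)
  moreover have "closedin (powertop_real UNIV) (topspace (closed_disc k))"
  proof -
    have "topspace (closed_disc k) = (\<Inter>i\<in>{k..}. {s \<in> topspace (powertop_real UNIV). s i \<in> {0}}) \<inter>
        {s \<in> topspace (powertop_real UNIV). (\<Sum>i<k. (s i)\<^sup>2) \<in> {..1}}"
      by (auto simp: topspace_closed_disc)
    also have "closedin (powertop_real UNIV) \<dots>"
      by (intro closedin_Int closedin_INT closedin_continuous_map_preimage[where Y = euclideanreal]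
          continuous_map_sum continuous_map_real_pow continuous_map_product_projection) auto
    finally show ?thesis .
  qed
  ultimately have "compactin (powertop_real UNIV) (topspace (closed_disc k))"
    using closed_compactin by blast
  then show ?thesis
    by (subst closed_disc_eq) (simp add: compactin_subspace)
qed

lemma compactin_cell_image:
  assumes "continuous_map (closed_disc k) X \<Phi>" "closedin (closed_disc k) A"
  shows "compactin X (\<Phi> ` A)"
  using assms compact_space_closed_disc closedin_compact_space image_compactin by blast

text \<open>
  Around a point of \<open>L\<close>, first push the outer shell of the cell radially into \<open>L\<close> by means of \<open>R\<close>,
  then contract within \<open>L\<close>.
\<close>

lemma locally_contractible_attach_cell:
  assumes X: "Hausdorff_space X" and L: "closedin X L" and lc: "locally_contractible_space (subtopology X L)"
    and \<Phi>: "continuous_map (closed_disc k) X \<Phi>" and hom: "homeomorphic_map (open_disc k) (subtopology X e) \<Phi>"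
    and eX: "e \<subseteq> topspace X" and eL: "e \<inter> L = {}"
    and bd: "\<Phi> ` (topspace (closed_disc k) - topspace (open_disc k)) \<subseteq> L"
  shows "locally_contractible_space (subtopology X (L \<union> e))"
proof -
  let ?K = "subtopology X (L \<union> e)" and ?D = "closed_disc k" and ?O = "open_disc k"
  have LX: "L \<subseteq> topspace X" using L closedin_subset by blast
  have topK: "topspace ?K = L \<union> e" using LX eX by auto
  have OD: "topspace ?O \<subseteq> topspace ?D" by (auto simp: topspace_closed_disc topspace_open_disc)
  obtain g where g: "homeomorphic_maps ?O (subtopology X e) \<Phi> g"
    using hom homeomorphic_map_maps by blast
  have gc: "continuous_map (subtopology X e) ?O g" and g\<Phi>: "\<And>z. z \<in> topspace ?O \<Longrightarrow> g (\<Phi> z) = z"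
    and \<Phi>g: "\<And>y. y \<in> e \<Longrightarrow> \<Phi> (g y) = y"
    using g eX by (auto simp: homeomorphic_maps_def)
  have \<Phi>O: "\<Phi> z \<in> e" if "z \<in> topspace ?O" for z
    using homeomorphic_imp_surjective_map[OF hom] that eX by auto
  have gO: "g y \<in> topspace ?O" if "y \<in> e" for y
    using continuous_map_image_subset_topspace[OF gc] that eX by auto
  have \<Phi>D: "\<Phi> ` topspace ?D \<subseteq> L \<union> e" using \<Phi>O bd by auto
  define nrm where "nrm z = sqrt (\<Sum>i<k. (z i)\<^sup>2)" for z :: "nat \<Rightarrow> real"
  have nrm0: "0 \<le> nrm z" for z by (simp add: nrm_def sum_nonneg)
  have nrm_scale: "nrm (\<lambda>i. a * z i) = \<bar>a\<bar> * nrm z" for a z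
    by (simp add: nrm_def power_mult_distrib real_sqrt_mult flip: sum_distrib_left)
  have D_iff: "z \<in> topspace ?D \<longleftrightarrow> (\<forall>i\<ge>k. z i = 0) \<and> nrm z \<le> 1" for z
    by (simp add: topspace_closed_disc nrm_def)
  have O_iff: "z \<in> topspace ?O \<longleftrightarrow> (\<forall>i\<ge>k. z i = 0) \<and> nrm z < 1" for z
    by (simp add: topspace_open_disc nrm_def)
  have nrm_cont: "continuous_map ?D euclideanreal nrm"
  proof -
    have "continuous_map euclideanreal euclideanreal sqrt" by (simp add: continuous_on_real_sqrt)
    then show ?thesis unfolding nrm_def
      by (rule continuous_map_compose') (intro continuous_map_sum continuous_map_real_pow continuous_map_closed_disc_projection finite_lessThan)
  qed
  \<comment> \<open>Radial expansion by the factor \<open>1 + t\<close>, stopped at norm 1. At time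
    1 every point of norm at least 1/2 has reached the boundary sphere, which is fixed
    throughout.\<close>
  define \<sigma> where "\<sigma> = (\<lambda>p :: (nat \<Rightarrow> real) \<times> real. \<lambda>i. (1 + snd p) / max 1 ((1 + snd p) * nrm (fst p)) * fst p i)"
  have \<sigma>nrm: "nrm (\<sigma> (z, t)) = (1 + t) * nrm z / max 1 ((1 + t) * nrm z)" if "0 \<le> t" for z t
    unfolding \<sigma>_def nrm_scale using that nrm0[of z] by simp
  have \<sigma>D: "\<sigma> (z, t) \<in> topspace ?D" if "z \<in> topspace ?D" "t \<in> {0..1}" for z t
  proof -
    have "nrm (\<sigma> (z, t)) \<le> 1" using that by (subst \<sigma>nrm) (auto simp: divide_le_eq)
    then show ?thesis using that unfolding D_iff by (auto simp: \<sigma>_def)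
  qed
  have sndI: "continuous_map (prod_topology Y unit_interval) euclideanreal snd" for Y :: "'z topology"
    using continuous_map_snd continuous_map_into_fulltopology by blast
  have \<sigma>c: "continuous_map (prod_topology ?D unit_interval) ?D \<sigma>"
  proof (rule continuous_map_into_closed_disc)
    show "continuous_map (prod_topology ?D unit_interval) euclideanreal (\<lambda>x. \<sigma> x i)" for i
      unfolding \<sigma>_def
      by (intro continuous_map_real_mult continuous_map_real_divide continuous_map_add continuous_map_real_max
          sndI continuous_map_compose'[OF nrm_cont continuous_map_fst]
          continuous_map_compose'[OF continuous_map_closed_disc_projection continuous_map_fst]) auto
  qed (use \<sigma>D in auto)
  have \<sigma>0: "\<sigma> (z, 0) = z" if "z \<in> topspace ?D" for z
    using that by (auto simp: \<sigma>_def D_iff max_def)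
  have \<sigma>bd: "\<sigma> (z, t) = z" if "z \<in> topspace ?D" "z \<notin> topspace ?O" "t \<in> {0..1}" for z t
  proof -
    have "nrm z = 1" using that by (auto simp: D_iff O_iff)
    then show ?thesis using that(3) by (auto simp: \<sigma>_def max_def)
  qed
  \<comment> \<open>\<open>\<sigma>\<close> transported to the cell, and the identity on
    \<open>L\<close>. As \<open>\<sigma>\<close> fixes the boundary sphere, both prescriptions agree
    there; so \<open>R\<close> is induced by \<open>\<sigma>\<close> over the whole closed cell,
    where continuity descends along the quotient map from the disc.\<close>
  define R where "R = (\<lambda>p. if fst p \<in> L then fst p else \<Phi> (\<sigma> (g (fst p), snd p)))"
  let ?C = "\<Phi> ` topspace ?D"
  have Cc: "closedin X ?C"
    using compactin_cell_image[OF \<Phi> closedin_topspace] X compactin_imp_closedin by blast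
  have LC: "L \<union> ?C = L \<union> e"
    using \<Phi>D \<Phi>g gO OD by (auto simp: image_iff) (metis subsetD)
  have R\<Phi>: "R (\<Phi> z, t) = \<Phi> (\<sigma> (z, t))" if z: "z \<in> topspace ?D" and t: "t \<in> {0..1}" for z t
  proof (cases "z \<in> topspace ?O")
    case True
    then have "\<Phi> z \<notin> L" using \<Phi>O eL by blast
    then show ?thesis using g\<Phi>[OF True] by (simp add: R_def)
  next
    case False
    then have "\<Phi> z \<in> L" using bd z by blast
    then show ?thesis using \<sigma>bd[OF z False t] by (simp add: R_def)
  qed
  have RK: "R (y, t) \<in> L \<union> e" if "y \<in> L \<union> e" "t \<in> {0..1}" for y t
  proof (cases "y \<in> L")
    case False
    then have "y \<in> e" using that by blast
    then have "R (y, t) = \<Phi> (\<sigma> (g y, t))" using R\<Phi>[of "g y" t] gO OD \<Phi>g that by (metis subsetD)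
    then show ?thesis using \<Phi>D \<sigma>D[of "g y" t] gO[OF \<open>y \<in> e\<close>] OD that by auto
  qed (simp add: R_def)
  have Rc: "continuous_map (prod_topology ?K unit_interval) ?K R"
  proof (rule continuous_map_into_subtopology)
    show "R \<in> topspace (prod_topology ?K unit_interval) \<rightarrow> L \<union> e"
    proof
      fix p assume "p \<in> topspace (prod_topology ?K unit_interval)"
      then have "fst p \<in> topspace ?K" "snd p \<in> topspace unit_interval"
        by (simp_all only: topspace_prod_topology mem_Times_iff)
      then have "fst p \<in> L \<union> e" "snd p \<in> {0..1}" by (simp_all only: topK topspace_euclidean_subtopology)
      then show "R p \<in> L \<union> e" using RK[of "fst p" "snd p"] by simp
    qed
    show "continuous_map (prod_topology ?K unit_interval) X R"
    proof (rule pasting_lemma_closed[where I = UNIV and f = "\<lambda>_. R" and T = "\<lambda>b. (if b then L else ?C) \<times> {0..1}"])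
      fix b :: bool
      have "closedin ?K (if b then L else ?C)"
        using L Cc LC by (auto intro!: closedin_subset_topspace)
      then show "closedin (prod_topology ?K unit_interval) ((if b then L else ?C) \<times> {0..1})"
        by (auto simp: closedin_prod_Times_iff)
      have "continuous_map (prod_topology (subtopology X L) unit_interval) X R"
      proof (rule continuous_map_eq)
        show "continuous_map (prod_topology (subtopology X L) unit_interval) X fst"
          using continuous_map_fst continuous_map_into_fulltopology by blast
      qed (auto simp: R_def)
      moreover have "(L \<union> e) \<inter> ?C = ?C" "(L \<union> e) \<inter> L = L" using LC by blast+
      moreover have "continuous_map (prod_topology (subtopology X ?C) unit_interval) X R"
      proof -
        let ?q = "\<lambda>p. (\<Phi> (fst p), snd p)"
        have "quotient_map (prod_topology ?D unit_interval) (prod_topology (subtopology X ?C) unit_interval) ?q"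
        proof (rule continuous_imp_quotient_map)
          show "continuous_map (prod_topology ?D unit_interval) (prod_topology (subtopology X ?C) unit_interval) ?q"
            by (intro continuous_map_pairedI continuous_map_snd continuous_map_compose'[OF _ continuous_map_fst]
                continuous_map_into_subtopology \<Phi>) auto
          show "compact_space (prod_topology ?D unit_interval)"
            by (simp add: compact_space_prod_topology compact_space_closed_disc compact_space_subtopology)
          show "Hausdorff_space (prod_topology (subtopology X ?C) unit_interval)"
            by (simp add: Hausdorff_space_prod_topology Hausdorff_space_subtopology X)
          show "?q ` topspace (prod_topology ?D unit_interval) = topspace (prod_topology (subtopology X ?C) unit_interval)"
            using continuous_map_image_subset_topspace[OF \<Phi>] by (auto simp: image_iff)
        qed
        moreover have "continuous_map (prod_topology ?D unit_interval) X (R \<circ> ?q)"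
        proof (rule continuous_map_eq)
          show "continuous_map (prod_topology ?D unit_interval) X (\<lambda>p. \<Phi> (\<sigma> p))"
            by (rule continuous_map_compose'[OF \<Phi> \<sigma>c])
        qed (auto simp: R\<Phi>)
        ultimately show ?thesis by (rule continuous_compose_quotient_map)
      qed
      ultimately show "continuous_map (subtopology (prod_topology ?K unit_interval) ((if b then L else ?C) \<times> {0..1})) X R"
        by (cases b) (simp_all only: subtopology_Times subtopology_subtopology Int_absorb if_True if_False)
    next
      fix p assume "p \<in> topspace (prod_topology ?K unit_interval)"
      then have "fst p \<in> topspace ?K" "snd p \<in> topspace unit_interval"
        by (simp_all only: topspace_prod_topology mem_Times_iff)
      then have "fst p \<in> L \<union> ?C" "snd p \<in> {0..1}"
        by (simp_all only: topK LC topspace_euclidean_subtopology)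
      then show "\<exists>j. j \<in> UNIV \<and> p \<in> (if j then L else ?C) \<times> {0..1} \<and> R p = R p"
        by (cases p) (auto intro: exI[of _ True] exI[of _ False])
    qed auto
  qed
  have R0: "R (y, 0) = y" if "y \<in> L \<union> e" for y
    using that \<sigma>0 gO OD \<Phi>g by (auto simp: R_def) (metis subsetD)
  \<comment> \<open>\<open>L\<close> together with the cell beyond radius 1/2. It is open because
    the image of the ball of radius 1/2 is compact.\<close>
  define N where "N = (L \<union> e) - \<Phi> ` {z \<in> topspace ?D. nrm z \<in> {..1/2}}"
  have "closedin ?D {z \<in> topspace ?D. nrm z \<in> {..1/2}}"
    by (rule closedin_continuous_map_preimage[OF nrm_cont]) auto
  then have "closedin X (\<Phi> ` {z \<in> topspace ?D. nrm z \<in> {..1/2}})"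
    using compactin_cell_image[OF \<Phi>] X compactin_imp_closedin by blast
  then have No: "openin ?K N"
  proof -
    have "N = topspace ?K - (L \<union> e) \<inter> \<Phi> ` {z \<in> topspace ?D. nrm z \<in> {..1/2}}"
      unfolding N_def topK by blast
    then show ?thesis
      by (simp only: openin_diff openin_topspace closedin_subtopology_Int_closed
          \<open>closedin X (\<Phi> ` {z \<in> topspace ?D. nrm z \<in> {..1/2}})\<close>)
  qed
  have LN: "L \<subseteq> N"
  proof -
    have "z \<in> topspace ?O" if "z \<in> topspace ?D" "nrm z \<le> 1/2" for z
      using that by (auto simp: D_iff O_iff)
    then show ?thesis using \<Phi>O eL by (fastforce simp: N_def)
  qed
  have NR: "R (y, 1) \<in> L" if "y \<in> N" for y
  proof (cases "y \<in> L")
    case False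
    then have y: "y \<in> e" using that by (auto simp: N_def)
    have gD: "g y \<in> topspace ?D" using gO[OF y] OD by blast
    have "nrm (g y) > 1/2" using that \<Phi>g[OF y] gD by (force simp: N_def)
    then have "nrm (\<sigma> (g y, 1)) = 1" by (simp add: \<sigma>nrm max_def)
    then have "\<sigma> (g y, 1) \<in> topspace ?D - topspace ?O" using \<sigma>D[OF gD, of 1] by (auto simp: O_iff)
    then show ?thesis using bd False by (auto simp: R_def)
  qed (simp add: R_def)
  show ?thesis
    unfolding locally_contractible_space_def
  proof (intro allI impI, elim conjE)
    fix U x assume U: "openin ?K U" and x: "x \<in> U"
    have UK: "U \<subseteq> L \<union> e" using openin_subset[OF U] topK by blast
    show "\<exists>V h c. openin ?K V \<and> x \<in> V \<and> V \<subseteq> U \<and>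
        continuous_map (prod_topology (subtopology ?K V) unit_interval) ?K h \<and>
        (\<forall>y\<in>V. h (y, 0) = y \<and> h (y, 1) = c \<and> (\<forall>t\<in>{0..1}. h (y, t) \<in> U))"
    proof (cases "x \<in> L")
      case True
      have LK: "subtopology X L = subtopology ?K L" by (simp add: subtopology_subtopology Int_absorb1)
      have "openin (subtopology X L) (L \<inter> U)" unfolding LK using U by (simp add: openin_subtopology_Int2)
      then obtain V2 h c where V2: "openin (subtopology X L) V2" "x \<in> V2" "V2 \<subseteq> L \<inter> U"
        and h: "continuous_map (prod_topology (subtopology (subtopology X L) V2) unit_interval) (subtopology X L) h"
        and h01: "\<And>y. y \<in> V2 \<Longrightarrow> h (y, 0) = y" "\<And>y. y \<in> V2 \<Longrightarrow> h (y, 1) = c"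
          "\<And>y t. y \<in> V2 \<Longrightarrow> t \<in> {0..1} \<Longrightarrow> h (y, t) \<in> L \<inter> U"
        using lc x True unfolding locally_contractible_space_def by (metis IntI)
      \<comment> \<open>The path of \<open>y\<close> under \<open>R\<close> has to stay in
        \<open>U\<close> and to end where \<open>h\<close> is defined. The first condition is open
        by the tube lemma.\<close>
      define V where "V = {y \<in> N. R (y, 1) \<in> V2} \<inter> {y \<in> topspace ?K. \<forall>t\<in>{0..1}. R (y, t) \<in> U}"
      have R1: "continuous_map (subtopology ?K N) (subtopology X L) (\<lambda>y. R (y, 1))"
      proof (rule continuous_map_into_subtopology)
        have "continuous_map ?K ?K (\<lambda>y. R (y, 1))"
          by (intro continuous_map_compose'[OF Rc] continuous_map_pairedI) auto
        then show "continuous_map (subtopology ?K N) X (\<lambda>y. R (y, 1))"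
          using continuous_map_from_subtopology continuous_map_into_fulltopology by blast
      qed (use NR in auto)
      have "openin (subtopology ?K N) {y \<in> topspace (subtopology ?K N). R (y, 1) \<in> V2}"
        by (rule openin_continuous_map_preimage[OF R1 V2(1)])
      moreover have "{y \<in> topspace (subtopology ?K N). R (y, 1) \<in> V2} = {y \<in> N. R (y, 1) \<in> V2}"
        using openin_subset[OF No] by auto
      ultimately have "openin ?K {y \<in> N. R (y, 1) \<in> V2}"
        using No openin_trans_full by metis
      then have Vo: "openin ?K V"
        unfolding V_def using openin_all_unit_interval[OF Rc U] by (rule openin_Int)
      have xV: "x \<in> V"
        using True LN V2 x UK topK by (auto simp: V_def R_def)
      have VU: "V \<subseteq> U"
      proof
        fix y assume "y \<in> V"
        then have "R (y, 0) \<in> U" "y \<in> L \<union> e" using topK by (auto simp: V_def)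
        then show "y \<in> U" using R0 by simp
      qed
      have VK: "V \<subseteq> L \<union> e" using VU UK by blast
      define H where "H = (\<lambda>p. if snd p \<le> 1/2 then R (fst p, 2 * snd p) else h (R (fst p, 1), 2 * snd p - 1))"
      let ?V = "prod_topology (subtopology ?K V) unit_interval"
      have HU: "H (y, t) \<in> U" if "y \<in> V" "t \<in> {0..1}" for y t
        using that h01(3)[of "R (y, 1)" "2 * t - 1"] by (auto simp: H_def V_def)
      have Hc: "continuous_map ?V ?K H"
      proof (rule pasting_lemma_closed[where I = UNIV and
            f = "\<lambda>b p. if b then R (fst p, 2 * snd p) else h (R (fst p, 1), 2 * snd p - 1)" and
            T = "\<lambda>b. {p \<in> topspace ?V. snd p \<in> (if b then {..1/2} else {1/2..})}"])
        fix b :: bool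
        let ?T = "{p \<in> topspace ?V. snd p \<in> (if b then {..1/2} else {1/2..})}"
        show "closedin ?V ?T"
          by (rule closedin_continuous_map_preimage[OF sndI]) auto
        have fstV: "continuous_map (subtopology ?V T) (subtopology ?K V) fst" and sndV: "continuous_map (subtopology ?V T) euclideanreal snd" for T
          using continuous_map_from_subtopology[OF continuous_map_fst] continuous_map_from_subtopology[OF sndI] by blast+
        have fstK: "continuous_map (subtopology ?V T) ?K fst" for T
          by (rule continuous_map_into_fulltopology[OF fstV])
        show "continuous_map (subtopology ?V ?T) ?K (\<lambda>p. if b then R (fst p, 2 * snd p) else h (R (fst p, 1), 2 * snd p - 1))"
        proof (cases b)
          case True
          have "continuous_map (subtopology ?V ?T) (prod_topology ?K unit_interval) (\<lambda>p. (fst p, 2 * snd p))"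
          proof (rule continuous_map_pairedI[OF fstK], rule continuous_map_into_subtopology)
            show "continuous_map (subtopology ?V ?T) euclideanreal (\<lambda>p. 2 * snd p)"
              by (rule continuous_map_real_mult_left[OF sndV])
          qed (use True in auto)
          then show ?thesis using True continuous_map_compose'[OF Rc] by simp
        next
          case False
          have "continuous_map (subtopology ?V ?T) ?K (\<lambda>p. R (fst p, 1))"
          proof (rule continuous_map_compose'[OF Rc], intro continuous_map_pairedI)
            show "continuous_map (subtopology ?V ?T) ?K fst" by (rule fstK)
          qed auto
          then have RX: "continuous_map (subtopology ?V ?T) X (\<lambda>p. R (fst p, 1))"
            by (rule continuous_map_into_fulltopology)
          have RV: "R (fst p, 1) \<in> V2" if "p \<in> topspace (subtopology ?V ?T)" for p
            using that by (auto simp: V_def)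
          have RV2: "continuous_map (subtopology ?V ?T) (subtopology (subtopology X L) V2) (\<lambda>p. R (fst p, 1))"
            by (intro continuous_map_into_subtopology RX Pi_I; drule RV; use V2(3) in blast)
          have "continuous_map (subtopology ?V ?T) (prod_topology (subtopology (subtopology X L) V2) unit_interval)
              (\<lambda>p. (R (fst p, 1), 2 * snd p - 1))"
          proof (rule continuous_map_pairedI[OF RV2], rule continuous_map_into_subtopology)
            show "continuous_map (subtopology ?V ?T) euclideanreal (\<lambda>p. 2 * snd p - 1)"
              by (intro continuous_map_diff continuous_map_real_mult_left sndV) simp
          qed (use False in auto)
          from continuous_map_compose'[OF h this]
          have "continuous_map (subtopology ?V ?T) (subtopology X L) (\<lambda>p. h (R (fst p, 1), 2 * snd p - 1))" .
          then show ?thesis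
            using False by (simp add: LK continuous_map_in_subtopology)
        qed
      next
        fix i j p assume p: "p \<in> topspace ?V \<inter> {p \<in> topspace ?V. snd p \<in> (if i then {..1/2} else {1/2..})} \<inter>
            {p \<in> topspace ?V. snd p \<in> (if j then {..1/2} else {1/2..})}"
        then have s: "snd p \<in> (if i then {..1/2} else {1/2..})" "snd p \<in> (if j then {..1/2} else {1/2..})"
          and "p \<in> topspace ?V" by blast+
        then have "R (fst p, 1) \<in> V2" by (auto simp: V_def)
        then have h0: "h (R (fst p, 1), 0) = R (fst p, 1)" by (rule h01(1))
        show "(if i then R (fst p, 2 * snd p) else h (R (fst p, 1), 2 * snd p - 1)) =
            (if j then R (fst p, 2 * snd p) else h (R (fst p, 1), 2 * snd p - 1))"
        proof (cases "i = j")
          case False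
          then have "2 * snd p = 1" using s by (cases i; cases j) auto
          then show ?thesis using h0 by simp
        qed simp
      next
        fix p assume "p \<in> topspace ?V"
        then show "\<exists>j. j \<in> UNIV \<and> p \<in> {p \<in> topspace ?V. snd p \<in> (if j then {..1/2} else {1/2..})} \<and>
            H p = (if j then R (fst p, 2 * snd p) else h (R (fst p, 1), 2 * snd p - 1))"
          by (intro exI[of _ "snd p \<le> 1/2"]) (auto simp: H_def)
      qed auto
      have "H (y, 0) = y \<and> H (y, 1) = c \<and> (\<forall>t\<in>{0..1}. H (y, t) \<in> U)" if y: "y \<in> V" for y
        using HU[OF y] R0 h01(2) y VK by (auto simp: H_def V_def)
      then show ?thesis using Vo xV VU Hc by blast
    next
      case False
      then have xe: "x \<in> e" using x UK by blast
      have eo: "openin ?K e"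
      proof -
        have "closedin ?K L" by (rule closedin_subset_topspace[OF L]) auto
        then have "openin ?K (topspace ?K - L)" by (rule openin_diff[OF openin_topspace])
        moreover have "topspace ?K - L = e" unfolding topK using eL by blast
        ultimately show ?thesis by (simp only:)
      qed
      have Ke: "subtopology ?K e = subtopology X e" by (simp add: subtopology_subtopology Int_absorb1)
      \<comment> \<open>In disc coordinates, the segment from \<open>g y\<close> to
        \<open>g x\<close>. The points whose segment stays in \<open>U\<close> form an open set by
        the tube lemma; it contains \<open>x\<close>, whose segment is constant.\<close>
      define l where "l = (\<lambda>p i. (1 - snd p) * g (fst p) i + snd p * g x i)"
      have lO: "l (y, t) \<in> topspace ?O" if "y \<in> e" "t \<in> {0..1}" for y t
        unfolding topspace_open_disc
      proof (intro conjI allI impI)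
        show "l (y, t) i = 0" if "k \<le> i" for i
          using gO[OF \<open>y \<in> e\<close>] gO[OF xe] that by (simp add: l_def topspace_open_disc)
        have "(l (y, t) i)\<^sup>2 \<le> (1 - t) * (g y i)\<^sup>2 + t * (g x i)\<^sup>2" for i
        proof -
          have "(1 - t) * (g y i)\<^sup>2 + t * (g x i)\<^sup>2 - (l (y, t) i)\<^sup>2 = t * (1 - t) * (g y i - g x i)\<^sup>2"
            by (simp add: l_def power2_eq_square algebra_simps)
          also have "\<dots> \<ge> 0" using that(2) by simp
          finally show ?thesis by linarith
        qed
        then have "(\<Sum>i<k. (l (y, t) i)\<^sup>2) \<le> (\<Sum>i<k. (1 - t) * (g y i)\<^sup>2 + t * (g x i)\<^sup>2)"
          by (intro sum_mono)
        also have "\<dots> = (1 - t) * (\<Sum>i<k. (g y i)\<^sup>2) + t * (\<Sum>i<k. (g x i)\<^sup>2)"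
          by (simp add: sum.distrib flip: sum_distrib_left)
        also have "\<dots> < 1"
          using gO[OF \<open>y \<in> e\<close>] gO[OF xe] that(2) convex_bound_lt[of "\<Sum>i<k. (g y i)\<^sup>2" 1 "\<Sum>i<k. (g x i)\<^sup>2" "1 - t" t]
          by (simp add: topspace_open_disc)
        finally show "(\<Sum>i<k. (l (y, t) i)\<^sup>2) < 1" .
      qed
      have lc': "continuous_map (prod_topology (subtopology X e) unit_interval) ?O l"
      proof (rule continuous_map_into_open_disc)
        show "continuous_map (prod_topology (subtopology X e) unit_interval) euclideanreal (\<lambda>p. l p i)" for i
          unfolding l_def
          by (intro continuous_map_add continuous_map_real_mult continuous_map_diff sndI
              continuous_map_compose'[OF continuous_map_open_disc_projection continuous_map_compose'[OF gc continuous_map_fst]]) auto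
      qed (use lO in auto)
      have \<Phi>c: "continuous_map ?O (subtopology X e) \<Phi>" using hom homeomorphic_imp_continuous_map by blast
      have h: "continuous_map (prod_topology (subtopology X e) unit_interval) (subtopology X e) (\<lambda>p. \<Phi> (l p))"
        by (rule continuous_map_compose'[OF \<Phi>c lc'])
      define V where "V = {y \<in> topspace (subtopology X e). \<forall>t\<in>{0..1}. \<Phi> (l (y, t)) \<in> e \<inter> U}"
      have "openin (subtopology X e) (e \<inter> U)"
        using U Ke by (metis openin_subtopology_Int2)
      then have "openin (subtopology X e) V"
        unfolding V_def by (rule openin_all_unit_interval[OF h])
      then have Vo: "openin ?K V" using eo Ke openin_trans_full by metis
      have Ve: "V \<subseteq> e" by (auto simp: V_def)
      have l0: "\<Phi> (l (y, 0)) = y" "\<Phi> (l (y, 1)) = x" if "y \<in> e" for y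
        using \<Phi>g that xe by (simp_all add: l_def)
      have "l (x, t) = g x" for t by (auto simp: l_def algebra_simps)
      then have xV: "x \<in> V" using xe x eX \<Phi>g by (auto simp: V_def)
      have "V \<subseteq> U" using l0(1) by (force simp: V_def)
      moreover have "continuous_map (prod_topology (subtopology ?K V) unit_interval) ?K (\<lambda>p. \<Phi> (l p))"
      proof -
        have "subtopology ?K V = subtopology (subtopology X e) V"
          using Ve by (simp add: subtopology_subtopology Int_absorb1 le_supI2 Int_absorb2)
        then have "continuous_map (prod_topology (subtopology ?K V) unit_interval) (subtopology X e) (\<lambda>p. \<Phi> (l p))"
          using continuous_map_from_subtopology[OF h, of "V \<times> {0..1}"] by (simp add: subtopology_Times subtopology_subtopology)
        then show ?thesis by (simp add: Ke[symmetric] continuous_map_in_subtopology)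
      qed
      moreover have "\<forall>y\<in>V. \<Phi> (l (y, 0)) = y \<and> \<Phi> (l (y, 1)) = x \<and> (\<forall>t\<in>{0..1}. \<Phi> (l (y, t)) \<in> U)"
        using l0 Ve by (auto simp: V_def)
      ultimately show ?thesis using Vo xV
        by (intro exI[of _ V] exI[of _ "\<lambda>p. \<Phi> (l p)"] exI[of _ x]) auto
    qed
  qed
qed

section \<open>Cell structures and their finite subcomplexes\<close>

locale cw =
  fixes X :: "'a topology" and E d \<Phi>
  assumes cw: "cw_structure X E d \<Phi>"
begin

lemma Hausdorff: "Hausdorff_space X"
  and Union_cells: "\<Union>E = topspace X"
  using cw by (simp_all add: cw_structure_def)

lemma disjoint_cells:
  assumes "e \<in> E" "e' \<in> E" "x \<in> e" "x \<in> e'"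
  shows "e = e'"
proof -
  have "disjoint E" using cw by (simp add: cw_structure_def)
  then show ?thesis using assms by (auto simp: pairwise_def disjnt_iff)
qed

lemma continuous_char: "continuous_map (closed_disc (d e)) X (\<Phi> e)"
  and homeomorphic_char: "homeomorphic_map (open_disc (d e)) (subtopology X e) (\<Phi> e)"
  and boundary_char: "\<exists>F. finite F \<and> F \<subseteq> {e' \<in> E. d e' < d e} \<and>
    \<Phi> e ` (topspace (closed_disc (d e)) - topspace (open_disc (d e))) \<subseteq> \<Union>F"
  if "e \<in> E"
  using cw that by (simp_all add: cw_structure_def)

lemma weak_topology:
  "A \<subseteq> topspace X \<Longrightarrow> (\<And>e. e \<in> E \<Longrightarrow> closedin X (A \<inter> X closure_of e)) \<Longrightarrow> closedin X A"
  using cw by (simp add: cw_structure_def)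

lemma cell_subset: "e \<in> E \<Longrightarrow> e \<subseteq> topspace X"
  using Union_cells by blast

lemma image_open_disc: "e \<in> E \<Longrightarrow> \<Phi> e ` topspace (open_disc (d e)) = e"
  using homeomorphic_imp_surjective_map[OF homeomorphic_char] cell_subset by fastforce

lemma closed_cell_subset:
  assumes e: "e \<in> E"
  obtains F where "finite F" "F \<subseteq> {e' \<in> E. d e' < d e}"
    "\<Phi> e ` (topspace (closed_disc (d e)) - topspace (open_disc (d e))) \<subseteq> \<Union>F"
    "\<Phi> e ` topspace (closed_disc (d e)) \<subseteq> e \<union> \<Union>F"
proof -
  obtain F where F: "finite F" "F \<subseteq> {e' \<in> E. d e' < d e}"
    "\<Phi> e ` (topspace (closed_disc (d e)) - topspace (open_disc (d e))) \<subseteq> \<Union>F"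
    using boundary_char[OF e] by blast
  moreover have "\<Phi> e ` topspace (closed_disc (d e)) \<subseteq> e \<union> \<Union>F"
    using F(3) image_open_disc[OF e] by blast
  ultimately show thesis using that by blast
qed

lemma closed_closed_cell: "e \<in> E \<Longrightarrow> closedin X (\<Phi> e ` topspace (closed_disc (d e)))"
  by (rule compactin_imp_closedin[OF Hausdorff compactin_cell_image[OF continuous_char closedin_topspace]])

lemma cell_subset_closed_cell: "e \<in> E \<Longrightarrow> e \<subseteq> \<Phi> e ` topspace (closed_disc (d e))"
  using image_open_disc[of e] by (fastforce simp: topspace_closed_disc topspace_open_disc image_iff)

text \<open>The closed cell is compact, hence closed, and so contains the closure of the open
  cell.\<close>

lemma closure_cell_subset:
  assumes "e \<in> E"
  obtains F where "finite F" "F \<subseteq> E" "X closure_of e \<subseteq> e \<union> \<Union>F"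
proof -
  obtain F where "finite F" "F \<subseteq> {e' \<in> E. d e' < d e}" "\<Phi> e ` topspace (closed_disc (d e)) \<subseteq> e \<union> \<Union>F"
    using closed_cell_subset[OF assms] by metis
  moreover have "X closure_of e \<subseteq> \<Phi> e ` topspace (closed_disc (d e))"
    by (rule closure_of_minimal[OF cell_subset_closed_cell closed_closed_cell]) fact+
  ultimately show thesis using that[of F] by blast
qed

definition finite_subcomplex :: "'a set set \<Rightarrow> bool" where
  "finite_subcomplex F \<longleftrightarrow> finite F \<and> F \<subseteq> E \<and> (\<forall>e\<in>F. \<Phi> e ` topspace (closed_disc (d e)) \<subseteq> \<Union>F)"

lemma finite_subcomplex_Union:
  assumes "finite \<F>" "\<And>F. F \<in> \<F> \<Longrightarrow> finite_subcomplex F"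
  shows "finite_subcomplex (\<Union>\<F>)"
  unfolding finite_subcomplex_def
proof (intro conjI ballI)
  fix e assume "e \<in> \<Union>\<F>"
  then obtain F where F: "F \<in> \<F>" "e \<in> F" by blast
  then have "\<Phi> e ` topspace (closed_disc (d e)) \<subseteq> \<Union>F"
    using assms(2) unfolding finite_subcomplex_def by blast
  also have "\<dots> \<subseteq> \<Union>(\<Union>\<F>)" using F(1) by blast
  finally show "\<Phi> e ` topspace (closed_disc (d e)) \<subseteq> \<Union>(\<Union>\<F>)" .
qed (use assms in \<open>auto simp: finite_subcomplex_def\<close>)

text \<open>Induction on the dimension: the boundary of a cell is covered by finitely many cells of
  lower dimension, each of which already has a finite subcomplex around it.\<close>

lemma finite_subcomplex_containing:
  "e \<in> E \<Longrightarrow> \<exists>F. finite_subcomplex F \<and> e \<in> F"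
proof (induction "d e" arbitrary: e rule: less_induct)
  case less
  obtain F0 where F0: "finite F0" "F0 \<subseteq> {e' \<in> E. d e' < d e}" "\<Phi> e ` topspace (closed_disc (d e)) \<subseteq> e \<union> \<Union>F0"
    using closed_cell_subset[OF less.prems] by metis
  have "\<forall>e'\<in>F0. \<exists>F. finite_subcomplex F \<and> e' \<in> F" using F0(2) less.hyps by blast
  then obtain S where S: "\<And>e'. e' \<in> F0 \<Longrightarrow> finite_subcomplex (S e') \<and> e' \<in> S e'" by metis
  have fs: "finite_subcomplex (\<Union>(S ` F0))"
    by (rule finite_subcomplex_Union) (use F0 S in auto)
  let ?G = "\<Union>(S ` F0)"
  have "F0 \<subseteq> ?G" using S by blast
  then have "e \<union> \<Union>F0 \<subseteq> \<Union>(insert e ?G)"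
    unfolding Union_insert by (intro Un_mono order_refl Union_mono)
  with F0(3) have e: "\<Phi> e ` topspace (closed_disc (d e)) \<subseteq> \<Union>(insert e ?G)" by (rule order_trans)
  have "finite_subcomplex (insert e ?G)"
    unfolding finite_subcomplex_def
  proof (intro conjI ballI)
    fix e' assume "e' \<in> insert e ?G"
    then consider "e' = e" | "e' \<in> ?G" by blast
    then show "\<Phi> e' ` topspace (closed_disc (d e')) \<subseteq> \<Union>(insert e ?G)"
    proof cases
      case 2
      then have "\<Phi> e' ` topspace (closed_disc (d e')) \<subseteq> \<Union>?G" using fs unfolding finite_subcomplex_def by blast
      then show ?thesis by blast
    qed (use e in simp)
  next
    show "finite (insert e ?G)" using fs by (simp add: finite_subcomplex_def)
    show "insert e ?G \<subseteq> E" using fs less.prems by (simp add: finite_subcomplex_def)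
  qed
  then show ?case by blast
qed

lemma compactin_finite_subcomplex:
  assumes F: "finite_subcomplex F"
  shows "compactin X (\<Union>F)"
proof -
  have "\<Union>F = (\<Union>e\<in>F. \<Phi> e ` topspace (closed_disc (d e)))"
  proof
    show "\<Union>F \<subseteq> (\<Union>e\<in>F. \<Phi> e ` topspace (closed_disc (d e)))"
    proof (rule Union_least)
      fix e assume e: "e \<in> F"
      then have "e \<in> E" using F by (auto simp: finite_subcomplex_def)
      from order_trans[OF cell_subset_closed_cell[OF this] UN_upper[OF e, of "\<lambda>e. \<Phi> e ` topspace (closed_disc (d e))"]]
      show "e \<subseteq> (\<Union>e\<in>F. \<Phi> e ` topspace (closed_disc (d e)))" .
    qed
    show "(\<Union>e\<in>F. \<Phi> e ` topspace (closed_disc (d e))) \<subseteq> \<Union>F"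
      using F unfolding finite_subcomplex_def by (intro UN_least) simp
  qed
  moreover have "compactin X (\<Union>e\<in>F. \<Phi> e ` topspace (closed_disc (d e)))"
    using F compactin_cell_image[OF continuous_char closedin_topspace]
    by (intro compactin_Union) (auto simp: finite_subcomplex_def)
  ultimately show ?thesis by simp
qed

lemma closedin_finite_subcomplex: "finite_subcomplex F \<Longrightarrow> closedin X (\<Union>F)"
  by (rule compactin_imp_closedin[OF Hausdorff compactin_finite_subcomplex])

text \<open>Induction on the number of cells. A cell \<open>e\<close> of maximal dimension meets the
  boundary of no cell of \<open>F\<close>, so the others still form a subcomplex, to which
  \<open>e\<close> is attached.\<close>

lemma locally_contractible_finite_subcomplex:
  "finite_subcomplex F \<Longrightarrow> locally_contractible_space (subtopology X (\<Union>F))"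
proof (induction "card F" arbitrary: F)
  case 0
  then have "F = {}" by (simp add: finite_subcomplex_def)
  then show ?case by (auto simp: locally_contractible_space_def openin_subtopology)
next
  case (Suc m)
  have F: "finite F" "F \<subseteq> E" "F \<noteq> {}" using Suc.prems Suc.hyps(2) by (auto simp: finite_subcomplex_def)
  obtain e where e: "e \<in> F" "\<And>e'. e' \<in> F \<Longrightarrow> d e' \<le> d e"
  proof -
    have "Max (d ` F) \<in> d ` F" using F by (intro Max_in) auto
    then obtain e where "e \<in> F" "d e = Max (d ` F)" by auto
    then show thesis using F by (intro that[of e]) auto
  qed
  have eE: "e \<in> E" using e F by blast
  let ?F = "F - {e}"
  \<comment> \<open>Outside its open cell, a closed cell consists of points in cells of dimension
    below \<open>d e' \<le> d e\<close>, hence not in \<open>e\<close>. For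
    \<open>e' \<noteq> e\<close> this gives the smaller subcomplex, for \<open>e' = e\<close> the
    attaching condition.\<close>
  have low: "\<Phi> e' ` topspace (closed_disc (d e')) - e' \<subseteq> \<Union>?F" if e': "e' \<in> F" for e'
  proof
    fix y assume y: "y \<in> \<Phi> e' ` topspace (closed_disc (d e')) - e'"
    obtain F0 where F0: "F0 \<subseteq> {e'' \<in> E. d e'' < d e'}" "\<Phi> e' ` topspace (closed_disc (d e')) \<subseteq> e' \<union> \<Union>F0"
      using closed_cell_subset[of e'] e' F by (metis subsetD)
    then obtain e1 where e1: "e1 \<in> F0" "y \<in> e1" using y by blast
    obtain e2 where e2: "e2 \<in> F" "y \<in> e2"
      using y e' Suc.prems unfolding finite_subcomplex_def by blast
    have "e1 = e2" using disjoint_cells[of e1 e2 y] e1 e2 F0(1) F by blast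
    moreover have "e1 \<noteq> e" using e1 F0(1) e(2)[OF e'] by auto
    ultimately show "y \<in> \<Union>?F" using e2 by blast
  qed
  have "finite_subcomplex ?F"
    unfolding finite_subcomplex_def
  proof (intro conjI ballI)
    fix e' assume e': "e' \<in> ?F"
    then have "e' \<subseteq> \<Union>?F" by blast
    then show "\<Phi> e' ` topspace (closed_disc (d e')) \<subseteq> \<Union>?F" using low[of e'] e' by blast
  qed (use F in auto)
  moreover have "m = card ?F" using Suc.hyps(2) F e by simp
  ultimately have lc: "locally_contractible_space (subtopology X (\<Union>?F))" and cl: "closedin X (\<Union>?F)"
    using Suc.hyps(1) closedin_finite_subcomplex by blast+
  have disj: "e \<inter> \<Union>?F = {}"
    using disjoint_cells eE F by blast
  have "\<Phi> e z \<notin> e" if "z \<in> topspace (closed_disc (d e)) - topspace (open_disc (d e))" for z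
  proof -
    obtain F0 where "F0 \<subseteq> {e'' \<in> E. d e'' < d e}"
      "\<Phi> e ` (topspace (closed_disc (d e)) - topspace (open_disc (d e))) \<subseteq> \<Union>F0"
      using boundary_char[OF eE] by blast
    then show ?thesis using that disjoint_cells[OF eE] by blast
  qed
  then have "\<Phi> e ` (topspace (closed_disc (d e)) - topspace (open_disc (d e))) \<subseteq> \<Union>?F"
    using low[OF e(1)] by blast
  from locally_contractible_attach_cell[OF Hausdorff cl lc continuous_char[OF eE] homeomorphic_char[OF eE]
      cell_subset[OF eE] disj this]
  have "locally_contractible_space (subtopology X (\<Union>?F \<union> e))" .
  moreover have "\<Union>?F \<union> e = \<Union>F" using e(1) by blast
  ultimately show ?case by simp
qed

text \<open>Choose one support point in each cell that the supports meet. The closure of a cell lies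
  in finitely many cells, so every set of chosen points is closed in the weak topology, and
  \<open>finite_discrete_in_support\<close> shows that there are only finitely many.\<close>

lemma compact_support_finite_subcomplex:
  assumes n: "n \<ge> 1" and S: "compact_space S" and f: "continuous_map S (barycenter_space n X) f"
  obtains F where "finite_subcomplex F" "\<And>s. s \<in> topspace S \<Longrightarrow> Poly_Mapping.keys (f s) \<subseteq> \<Union>F"
proof -
  define \<C> where "\<C> = {e \<in> E. \<exists>s\<in>topspace S. Poly_Mapping.keys (f s) \<inter> e \<noteq> {}}"
  have "\<forall>e\<in>\<C>. \<exists>x s. s \<in> topspace S \<and> x \<in> Poly_Mapping.keys (f s) \<and> x \<in> e" by (auto simp: \<C>_def)
  then obtain x where x: "\<And>e. e \<in> \<C> \<Longrightarrow> x e \<in> e \<and> (\<exists>s\<in>topspace S. x e \<in> Poly_Mapping.keys (f s))" by metis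
  have \<C>E: "\<C> \<subseteq> E" by (auto simp: \<C>_def)
  have "finite (x ` \<C>)"
  proof (rule finite_discrete_in_support[OF n Hausdorff S f])
    show "closedin X A" if A: "A \<subseteq> x ` \<C>" for A
    proof (rule weak_topology)
      show AX: "A \<subseteq> topspace X" using A x \<C>E cell_subset by blast
      fix e assume e: "e \<in> E"
      obtain F where F: "finite F" "F \<subseteq> E" "X closure_of e \<subseteq> e \<union> \<Union>F"
        using closure_cell_subset[OF e] by metis
      have "A \<inter> X closure_of e \<subseteq> x ` insert e F"
      proof
        fix y assume y: "y \<in> A \<inter> X closure_of e"
        then obtain e1 where e1: "e1 \<in> \<C>" "y = x e1" using A by blast
        obtain e2 where e2: "e2 \<in> insert e F" "y \<in> e2" using y F by blast
        have "e1 = e2" using disjoint_cells[of e1 e2 y] e1 e2 x[OF e1(1)] \<C>E e F by blast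
        then show "y \<in> x ` insert e F" using e1 e2 by blast
      qed
      then have "finite (A \<inter> X closure_of e)" using F finite_subset by blast
      then show "closedin X (A \<inter> X closure_of e)"
        using AX by (intro closedin_Hausdorff_finite[OF Hausdorff]) auto
    qed
    show "\<exists>s\<in>topspace S. y \<in> Poly_Mapping.keys (f s)" if "y \<in> x ` \<C>" for y
      using that x by blast
  qed
  moreover have "inj_on x \<C>"
    using x disjoint_cells \<C>E by (intro inj_onI) (metis subsetD)
  ultimately have fin: "finite \<C>" using finite_imageD by blast
  have "\<forall>e\<in>\<C>. \<exists>F. finite_subcomplex F \<and> e \<in> F" using finite_subcomplex_containing \<C>E by blast
  then obtain G where G: "\<And>e. e \<in> \<C> \<Longrightarrow> finite_subcomplex (G e) \<and> e \<in> G e" by metis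
  show thesis
  proof
    show "finite_subcomplex (\<Union>(G ` \<C>))"
      by (rule finite_subcomplex_Union) (use fin G in auto)
    fix s assume s: "s \<in> topspace S"
    show "Poly_Mapping.keys (f s) \<subseteq> \<Union>(\<Union>(G ` \<C>))"
    proof
      fix y assume y: "y \<in> Poly_Mapping.keys (f s)"
      have "f s \<in> barycenters n X"
        using continuous_map_image_subset_topspace[OF f] s topspace_barycenter_space[OF n] by blast
      then have "y \<in> \<Union>E" using y Union_cells by (auto simp: barycenters_def)
      then obtain e where "e \<in> E" "y \<in> e" by blast
      then have "e \<in> \<C>" using y s by (auto simp: \<C>_def)
      then show "y \<in> \<Union>(\<Union>(G ` \<C>))" using G \<open>y \<in> e\<close> by blast
    qed
  qed
qed

end

text \<open>This carries a null-homotopy found over a finite subcomplex back to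
  \<open>X\<close>.\<close>

lemma continuous_map_barycenter_space_inclusion:
  assumes n: "n \<ge> 1"
  shows "continuous_map (barycenter_space n (subtopology X K)) (barycenter_space n X) id"
proof (rule continuous_compose_quotient_map[OF quotient_map_weighted_sum[OF n]])
  let ?W = "weighted_points n (subtopology X K)"
  have "continuous_map ?W (barycenter_space n X) (\<lambda>p. \<Sum>i<n. Poly_Mapping.single (fst p i) (snd p i))"
  proof (rule continuous_map_into_barycenter_space[OF n])
    show "continuous_map ?W X (\<lambda>p. fst p i)" if "i < n" for i
      by (rule continuous_map_into_fulltopology[OF continuous_map_weighted_points_coords(1)[OF that]])
    show "continuous_map ?W euclideanreal (\<lambda>p. snd p i)" for i
      by (rule continuous_map_weighted_points_coords)
  qed (use weighted_pointsD[OF n, of "fst p" "snd p" for p] in auto)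
  then show "continuous_map ?W (barycenter_space n X) (id \<circ> weighted_sum n)"
    by (simp add: weighted_sum_def case_prod_unfold o_def)
qed

theorem theorem3p1:
  fixes X :: "'a topology" and n :: nat
  assumes "CW_complex X" and "topspace X \<noteq> {}" and "n \<ge> 1"
  shows "n_connected (int n - 2) (barycenter_space n X)"
  unfolding n_connected_def trivial_homotopy_group_def
proof (intro conjI allI impI ballI)
  obtain x where "x \<in> topspace X" using assms(2) by blast
  then have "Poly_Mapping.single x 1 \<in> barycenters n X"
    using assms(3) by (auto simp: barycenters_def lookup_single when_def)
  then show "topspace (barycenter_space n X) \<noteq> {}"
    using topspace_barycenter_space[OF assms(3)] by blast
  obtain E d \<Phi> where "cw_structure X E d \<Phi>" using assms(1) unfolding CW_complex_def by blast
  then interpret cw X E d \<Phi> by unfold_locales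
  \<comment> \<open>For \<open>n = 1\<close> no \<open>k\<close> satisfies the bound, and only
    nonemptiness is claimed.\<close>
  fix k z f
  assume k: "int k \<le> int n - 2"
    and "continuous_map (nsphere k) (barycenter_space n X) f \<and> f sphere_base = z"
  then have f: "continuous_map (nsphere k) (barycenter_space n X) f" and z: "f sphere_base = z" by blast+
  obtain F where F: "finite_subcomplex F" "\<And>s. s \<in> topspace (nsphere k) \<Longrightarrow> Poly_Mapping.keys (f s) \<subseteq> \<Union>F"
    using compact_support_finite_subcomplex[OF assms(3) compact_space_nsphere f] by blast
  let ?K = "subtopology X (\<Union>F)"
  have fK: "continuous_map (nsphere k) (barycenter_space n ?K) f"
    by (rule continuous_map_into_barycenter_space_subtopology[OF assms(3) closedin_finite_subcomplex[OF F(1)] f F(2)])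
  have "compact_space ?K" using compactin_finite_subcomplex[OF F(1)] by (simp add: compactin_subspace)
  moreover have "Hausdorff_space ?K" using Hausdorff by (rule Hausdorff_space_subtopology)
  ultimately obtain c where c: "homotopic_with (\<lambda>_. True) (nsphere k) (barycenter_space n ?K) f (\<lambda>_. c)"
    using barycenter_space_null_homotopic[OF _ _ locally_contractible_finite_subcomplex[OF F(1)] _ fK] k by auto
  have "homotopic_with (\<lambda>_. True) (nsphere k) (barycenter_space n X) (id \<circ> f) (id \<circ> (\<lambda>_. c))"
    by (rule homotopic_with_compose_continuous_map_left[OF c continuous_map_barycenter_space_inclusion[OF assms(3)]]) simp
  then have "homotopic_with (\<lambda>_. True) (nsphere k) (barycenter_space n X) f (\<lambda>_. c)"
    by (simp add: o_def)
  \<comment> \<open>The null-homotopy may move the base point, whereas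
    \<open>trivial_homotopy_group\<close> demands a pointed one.\<close>
  from pointed_null_homotopic[OF this z]
  show "homotopic_with (\<lambda>h. h sphere_base = z) (nsphere k) (barycenter_space n X) f (\<lambda>_. z)" .
qed

end
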